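(* There is an absolute constant $C$ such that the following holds. Let $v_0\in\mathbb{R}^n$ be a unit vector, $\epsilon>0$, $\tau\ge C n^{3/4}(\log n)^{1/4}/\epsilon$, and let $\mathbf{A}$ be an $n\times n\times n$ tensor with independent $\mathcal{N}(0,1)$ entries. Let $\mathbf{T}=\tau v_0^{\otimes 3}+\mathbf{A}$ and $\mathbf{T}'=\tau v_0^{\otimes 3}+\frac{1}{6}\sum_{\pi\in\mathcal{S}_3}\mathbf{A}^\pi$. With probability $1-O(n^{-10})$ over $\mathbf{A}$, the following holds for both $\mathbf{S}\in\{\mathbf{T},\mathbf{T}'\}$: for every degree-$4$ pseudo-expectation $\tilde{\mathbb{E}}$ satisfying $\{\|x\|^2=1\}$ that maximizes $\tilde{\mathbb{E}}\,\mathbf{S}(x)$ over all such pseudo-expectations, the vector $v=\tilde{\mathbb{E}}x/\|\tilde{\mathbb{E}}x\|$ satisfies $\langle v,v_0\rangle\ge 1-O(\epsilon)$.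
   Context: For a 3-tensor $\mathbf{S}$, $\mathbf{S}(x)=\sum_{i,j,k}\mathbf{S}_{ijk}x_ix_jx_k$. For $\pi\in\mathcal{S}_3$, $\mathbf{A}^\pi$ is the tensor with indices permuted by $\pi$: $\mathbf{A}^\pi_\alpha=\mathbf{A}_{\pi^{-1}(\alpha)}$. A degree-$d$ pseudo-expectation ($d$ even) is a linear functional $\tilde{\mathbb{E}}:\mathbb{R}[x]_{\le d}\to\mathbb{R}$ with $\tilde{\mathbb{E}}\,1=1$ and $\tilde{\mathbb{E}}\,p(x)^2\ge 0$ for all $p$ of degree $\le d/2$; it satisfies $\{p=0\}$ if $\tilde{\mathbb{E}}\,pq=0$ for all $q$ with $\deg(pq)\le d$. $\tilde{\mathbb{E}}x$ denotes the vector $(\tilde{\mathbb{E}}x_i)_i$. *)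

theory Defs
  imports "HOL-Probability.Probability" "HOL-Library.Multiset"
begin

text \<open>Vectors in R^n are functions nat => real, only indices < n matter.
  A 3-tensor is a function nat => nat => nat => real (indices < n).
  Monomials in x_0..x_{n-1} are multisets of indices; a polynomial of degree <= d is a
  finitely supported coefficient function on such multisets of size <= d.
  A linear functional on R[x]_{<=d} is determined by its values on monomials,
  so it is represented by L :: nat multiset => real.\<close>

definition monoms :: "nat \<Rightarrow> nat \<Rightarrow> nat multiset set" where
  "monoms n d = {m. set_mset m \<subseteq> {..<n} \<and> size m \<le> d}"


definition pe_apply :: "nat \<Rightarrow> nat \<Rightarrow> (nat multiset \<Rightarrow> real) \<Rightarrow> (nat multiset \<Rightarrow> real) \<Rightarrow> real" where
  "pe_apply n d L p = (\<Sum>m\<in>monoms n d. p m * L m)"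

definition poly_mult :: "nat \<Rightarrow> nat \<Rightarrow> nat \<Rightarrow> (nat multiset \<Rightarrow> real) \<Rightarrow> (nat multiset \<Rightarrow> real) \<Rightarrow> (nat multiset \<Rightarrow> real)" where
  "poly_mult n d1 d2 p q = (\<lambda>m. \<Sum>a\<in>monoms n d1. \<Sum>b\<in>monoms n d2. if a + b = m then p a * q b else 0)"

definition supported :: "nat \<Rightarrow> nat \<Rightarrow> (nat multiset \<Rightarrow> real) \<Rightarrow> bool" where
  "supported n d p \<longleftrightarrow> (\<forall>m. m \<notin> monoms n d \<longrightarrow> p m = 0)"

definition pseudo_expectation :: "nat \<Rightarrow> nat \<Rightarrow> (nat multiset \<Rightarrow> real) \<Rightarrow> bool" where
  "pseudo_expectation n d L \<longleftrightarrow>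
     L {#} = 1 \<and>
     (\<forall>p. supported n (d div 2) p \<longrightarrow>
        pe_apply n d L (poly_mult n (d div 2) (d div 2) p p) \<ge> 0)"

definition sphere_poly :: "nat \<Rightarrow> nat multiset \<Rightarrow> real" where
  "sphere_poly n m = (if m = {#} then -1 else if (\<exists>i<n. m = {#i, i#}) then 1 else 0)"

definition satisfies :: "nat \<Rightarrow> nat \<Rightarrow> (nat multiset \<Rightarrow> real) \<Rightarrow> nat \<Rightarrow> (nat multiset \<Rightarrow> real) \<Rightarrow> bool" where
  "satisfies n d L dp p \<longleftrightarrow>
     (\<forall>q. supported n (d - dp) q \<longrightarrow> pe_apply n d L (poly_mult n dp (d - dp) p q) = 0)"

definition sphere_pe4 :: "nat \<Rightarrow> (nat multiset \<Rightarrow> real) \<Rightarrow> bool" where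
  "sphere_pe4 n L \<longleftrightarrow> pseudo_expectation n 4 L \<and> satisfies n 4 L 2 (sphere_poly n)"

definition pe_tensor :: "nat \<Rightarrow> (nat multiset \<Rightarrow> real) \<Rightarrow> (nat \<Rightarrow> nat \<Rightarrow> nat \<Rightarrow> real) \<Rightarrow> real" where
  "pe_tensor n L S = (\<Sum>i<n. \<Sum>j<n. \<Sum>k<n. S i j k * L {#i, j, k#})"

definition pe_vec :: "(nat multiset \<Rightarrow> real) \<Rightarrow> nat \<Rightarrow> real" where
  "pe_vec L i = L {#i#}"

definition vnorm :: "nat \<Rightarrow> (nat \<Rightarrow> real) \<Rightarrow> real" where
  "vnorm n v = sqrt (\<Sum>i<n. (v i)^2)"

definition vinner :: "nat \<Rightarrow> (nat \<Rightarrow> real) \<Rightarrow> (nat \<Rightarrow> real) \<Rightarrow> real" where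
  "vinner n u v = (\<Sum>i<n. u i * v i)"

definition tensor_perm :: "(nat \<Rightarrow> nat) \<Rightarrow> (nat \<Rightarrow> nat \<Rightarrow> nat \<Rightarrow> real) \<Rightarrow> (nat \<Rightarrow> nat \<Rightarrow> nat \<Rightarrow> real)" where
  "tensor_perm \<pi> A = (\<lambda>i j k. let a = [i, j, k] in A (a ! inv \<pi> 0) (a ! inv \<pi> 1) (a ! inv \<pi> 2))"

definition rank_one3 :: "real \<Rightarrow> (nat \<Rightarrow> real) \<Rightarrow> (nat \<Rightarrow> nat \<Rightarrow> nat \<Rightarrow> real)" where
  "rank_one3 \<tau> v = (\<lambda>i j k. \<tau> * v i * v j * v k)"

definition gauss_tensor :: "nat \<Rightarrow> (nat \<times> nat \<times> nat \<Rightarrow> real) measure" where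
  "gauss_tensor n = PiM ({..<n} \<times> {..<n} \<times> {..<n}) (\<lambda>_. density lborel std_normal_density)"

definition spiked :: "real \<Rightarrow> (nat \<Rightarrow> real) \<Rightarrow> (nat \<times> nat \<times> nat \<Rightarrow> real) \<Rightarrow> (nat \<Rightarrow> nat \<Rightarrow> nat \<Rightarrow> real)" where
  "spiked \<tau> v G = (\<lambda>i j k. rank_one3 \<tau> v i j k + G (i, j, k))"

definition spiked_sym :: "real \<Rightarrow> (nat \<Rightarrow> real) \<Rightarrow> (nat \<times> nat \<times> nat \<Rightarrow> real) \<Rightarrow> (nat \<Rightarrow> nat \<Rightarrow> nat \<Rightarrow> real)" where
  "spiked_sym \<tau> v G = (\<lambda>i j k. rank_one3 \<tau> v i j k +
      (1/6) * (\<Sum>\<pi>\<in>{\<pi>. \<pi> permutes {0::nat, 1, 2}}. tensor_perm \<pi> (\<lambda>a b c. G (a, b, c)) i j k))"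

end

theory Submission
  imports Defs "HOL-Library.Poly_Mapping"
begin

text \<open>
  By Cauchy--Schwarz under a pseudo-expectation, the noise \<open>A(x) = \<Sum>\<^sub>i x\<^sub>i * q\<^sub>i(x)\<close> with
  \<open>q\<^sub>i(x) = \<langle>x, A\<^sub>i x\<rangle>\<close> is at most the square root of the pseudo-expectation of \<open>\<Sum>\<^sub>i q\<^sub>i\<^sup>2\<close>.
  The terms of \<open>\<Sum>\<^sub>i q\<^sub>i\<^sup>2\<close> in which both factors use the same row of \<open>A\<^sub>i\<close> are controlled by Frobenius
  norms. The remaining ones are four times an average over bipartitions of the rows into \<open>S\<close> and
  its complement; for fixed \<open>S\<close> they are the pairing of the moment matrix, which is positive
  semidefinite of trace one, with a matrix that is linear in the rows in \<open>S\<close>. Flipping the signs of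
  the entries in those rows preserves the Gaussian measure, so conditionally this matrix is a
  Rademacher series, and a noncommutative Khintchine inequality bounds the trace of its
  \<open>2p\<close>-th power with \<open>p\<close> of order \<open>log n\<close>. This gives the noise level
  \<open>n\<^bsup>3/4\<^esup> (log n)\<^bsup>1/4\<^esup>\<close>, uniformly over all pseudo-expectations.

  By symmetry of the moments, \<open>T'(x)\<close> and \<open>T(x)\<close> have the same pseudo-expectation. Comparing a maximizer with the point
  evaluation at \<open>v\<^sub>0\<close> bounds \<open>1 - \<langle>x, v\<^sub>0\<rangle>\<^sup>3\<close> in pseudo-expectation, and a sum-of-squares identity in
  one variable passes from the third to the first power.
\<close>

section \<open>Finitely supported matrices\<close>

text \<open>The coefficients of the quartic \<open>\<Sum>\<^sub>i q\<^sub>i\<^sup>2\<close> can be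
  arranged as a matrix in several ways. With rows (a,b) and columns (c,d) one gets a sum of n
  rank-one matrices of norm about n^2, which is too large. A moment depends only on the multiset
  {a,b,c,d}, so G(i,a,b) G(i,c,d) may instead sit in row (a,c) and column (b,d): a sum of Kronecker
  squares of slices. Without the same-row terms, which carry its mean, this has norm about n^(3/2)
  sqrt(log n), the square of the noise level. It is quadratic in the noise; splitting the rows makes
  it linear in those in S, so a linear Khintchine bound suffices. Its variance is under control only
  on a good event, and that event is not invariant under the sign flips. The variance bounds are
  therefore drawn from data that are invariant: squares of entries, and rows outside S. No
  eigenvalues are used. The pairing is compared with a trace by repeated squaring, at the price that
  the exponent is a power of two; hence p is dyadic, between log n and 2 log n.\<close>

typedef 'i fmat = "{X :: 'i \<Rightarrow> 'i \<Rightarrow> real. finite {(a, b). X a b \<noteq> 0}}"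
  morphisms entry Abs_fmat
  by (rule exI[of _ "\<lambda>_ _. 0"]) simp

setup_lifting type_definition_fmat

lemma fmat_eqI: "(\<And>a b. entry X a b = entry Y a b) \<Longrightarrow> X = Y"
  by (metis entry_inject ext)

definition idx :: "'i fmat \<Rightarrow> 'i set" where
  "idx X = fst ` {(a, b). entry X a b \<noteq> 0} \<union> snd ` {(a, b). entry X a b \<noteq> 0}"

lemma finite_idx [simp]: "finite (idx X)"
  using entry[of X] by (auto simp: idx_def)

lemma entry_eq_0: "a \<notin> idx X \<or> b \<notin> idx X \<Longrightarrow> entry X a b = 0"
  unfolding idx_def by force

lemma entry_outL [simp]: "a \<notin> idx X \<Longrightarrow> entry X a b = 0"
  and entry_outR [simp]: "b \<notin> idx X \<Longrightarrow> entry X a b = 0"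
  by (simp_all add: entry_eq_0)

text \<open>The supports are finite while the index type may be infinite, so there is no identity
  matrix and the ring has no unit. Powers and dimension are phrased without it; in exchange no
  dimension appears in the types.\<close>

instantiation fmat :: (type) ring
begin

lift_definition zero_fmat :: "'a fmat" is "\<lambda>_ _. 0" by simp

lift_definition plus_fmat :: "'a fmat \<Rightarrow> 'a fmat \<Rightarrow> 'a fmat" is "\<lambda>X Y a b. X a b + Y a b"
  subgoal for X Y
    by (rule finite_subset[of _ "{(a, b). X a b \<noteq> 0} \<union> {(a, b). Y a b \<noteq> 0}"]) auto
  done

lift_definition minus_fmat :: "'a fmat \<Rightarrow> 'a fmat \<Rightarrow> 'a fmat" is "\<lambda>X Y a b. X a b - Y a b"
  subgoal for X Y
    by (rule finite_subset[of _ "{(a, b). X a b \<noteq> 0} \<union> {(a, b). Y a b \<noteq> 0}"]) auto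
  done

lift_definition uminus_fmat :: "'a fmat \<Rightarrow> 'a fmat" is "\<lambda>X a b. - X a b"
  by simp

lift_definition times_fmat :: "'a fmat \<Rightarrow> 'a fmat \<Rightarrow> 'a fmat"
  is "\<lambda>X Y a b. \<Sum>c | X a c \<noteq> 0. X a c * Y c b"
proof -
  fix X Y :: "'a \<Rightarrow> 'a \<Rightarrow> real"
  assume f: "finite {(a, b). X a b \<noteq> 0}" "finite {(a, b). Y a b \<noteq> 0}"
  have "{(a, b). (\<Sum>c | X a c \<noteq> 0. X a c * Y c b) \<noteq> 0}
      \<subseteq> fst ` {(a, b). X a b \<noteq> 0} \<times> snd ` {(a, b). Y a b \<noteq> 0}"
  proof (clarify)
    fix a b
    assume "(\<Sum>c | X a c \<noteq> 0. X a c * Y c b) \<noteq> 0"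
    then obtain c where "X a c \<noteq> 0" "X a c * Y c b \<noteq> 0"
      by (metis (mono_tags, lifting) mem_Collect_eq sum.neutral)
    then show "a \<in> fst ` {(a, b). X a b \<noteq> 0} \<and> b \<in> snd ` {(a, b). Y a b \<noteq> 0}" 
      by force
  qed
  then show "finite {(a, b). (\<Sum>c | X a c \<noteq> 0. X a c * Y c b) \<noteq> 0}"
    by (rule finite_subset) (use f in auto)
qed

text \<open>The summation range may be any sufficiently large finite set, so products with different
  supports can be compared over a common one.\<close>

lemma entry_mult:
  assumes "finite S" "\<And>c. c \<notin> S \<Longrightarrow> entry X a c = 0 \<or> entry Y c b = 0"
  shows "entry (X * Y) a b = (\<Sum>c\<in>S. entry X a c * entry Y c b)"
proof -
  have "{c. entry X a c \<noteq> 0} \<subseteq> idx X"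
    using entry_eq_0 by fastforce
  then have fin: "finite {c. entry X a c \<noteq> 0}"
    by (rule finite_subset) simp
  have "entry (X * Y) a b = (\<Sum>c | entry X a c \<noteq> 0. entry X a c * entry Y c b)"
    by (simp add: times_fmat.rep_eq)
  also have "\<dots> = (\<Sum>c\<in>{c. entry X a c \<noteq> 0} \<union> S. entry X a c * entry Y c b)"
    by (rule sum.mono_neutral_left) (use fin assms in auto)
  also have "\<dots> = (\<Sum>c\<in>S. entry X a c * entry Y c b)"
    by (rule sum.mono_neutral_right) (use fin assms in auto)
  finally show ?thesis .
qed

instance
proof
  fix X Y Z :: "'a fmat"
  show "X + Y + Z = X + (Y + Z)" by (rule fmat_eqI) (simp add: plus_fmat.rep_eq)
  show "X + Y = Y + X" by (rule fmat_eqI) (simp add: plus_fmat.rep_eq)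
  show "0 + X = X" by (rule fmat_eqI) (simp add: plus_fmat.rep_eq zero_fmat.rep_eq)
  show "- X + X = 0" by (rule fmat_eqI) (simp add: plus_fmat.rep_eq zero_fmat.rep_eq uminus_fmat.rep_eq)
  show "X - Y = X + - Y" by (rule fmat_eqI) (simp add: plus_fmat.rep_eq minus_fmat.rep_eq uminus_fmat.rep_eq)
  show "X * Y * Z = X * (Y * Z)"
  proof (rule fmat_eqI)
    fix a b
    have 1: "entry (X * Y) a c = (\<Sum>d\<in>idx Y. entry X a d * entry Y d c)" for c
      by (rule entry_mult) (auto simp: entry_eq_0)
    have 2: "entry (Y * Z) d b = (\<Sum>c\<in>idx Y. entry Y d c * entry Z c b)" for d
      by (rule entry_mult) (auto simp: entry_eq_0)
    have "entry (X * Y * Z) a b = (\<Sum>c\<in>idx Y. entry (X * Y) a c * entry Z c b)"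
      by (rule entry_mult) (auto simp: entry_eq_0 1)
    also have "\<dots> = (\<Sum>d\<in>idx Y. entry X a d * entry (Y * Z) d b)"
      unfolding 1 2 sum_distrib_left sum_distrib_right mult.assoc by (rule sum.swap)
    also have "\<dots> = entry (X * (Y * Z)) a b"
      by (rule entry_mult[symmetric]) (auto simp: entry_eq_0 2)
    finally show "entry (X * Y * Z) a b = entry (X * (Y * Z)) a b" .
  qed
  have *: "entry (U * V) a b = (\<Sum>c\<in>idx X \<union> idx Y \<union> idx Z. entry U a c * entry V c b)"
    if "\<And>c. c \<notin> idx X \<union> idx Y \<union> idx Z \<Longrightarrow> entry U a c = 0" for U V :: "'a fmat" and a b
    by (rule entry_mult) (use that in auto)
  show "(X + Y) * Z = X * Z + Y * Z"
  proof (rule fmat_eqI)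
    fix a b
    have "entry ((X + Y) * Z) a b = (\<Sum>c\<in>idx X \<union> idx Y \<union> idx Z. entry (X + Y) a c * entry Z c b)"
      by (rule *) (simp add: plus_fmat.rep_eq)
    also have "\<dots> = entry (X * Z) a b + entry (Y * Z) a b"
    proof -
      have "entry (X * Z) a b = (\<Sum>c\<in>idx X \<union> idx Y \<union> idx Z. entry X a c * entry Z c b)"
        "entry (Y * Z) a b = (\<Sum>c\<in>idx X \<union> idx Y \<union> idx Z. entry Y a c * entry Z c b)"
        by (rule *, simp)+
      then show ?thesis by (simp add: plus_fmat.rep_eq distrib_right sum.distrib)
    qed
    finally show "entry ((X + Y) * Z) a b = entry (X * Z + Y * Z) a b"
      by (simp add: plus_fmat.rep_eq)
  qed
  show "X * (Y + Z) = X * Y + X * Z"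
  proof (rule fmat_eqI)
    fix a b
    have "entry (X * U) a b = (\<Sum>c\<in>idx X \<union> idx Y \<union> idx Z. entry X a c * entry U c b)" for U
      by (rule *) simp
    then show "entry (X * (Y + Z)) a b = entry (X * Y + X * Z) a b"
      by (simp add: plus_fmat.rep_eq distrib_left sum.distrib)
  qed
qed

end

lemmas entry_simps [simp] = zero_fmat.rep_eq plus_fmat.rep_eq minus_fmat.rep_eq uminus_fmat.rep_eq

lemma entry_sum [simp]: "entry (sum f A) a b = (\<Sum>x\<in>A. entry (f x) a b)"
  by (induction A rule: infinite_finite_induct) auto

lift_definition tp :: "'i fmat \<Rightarrow> 'i fmat" is "\<lambda>X a b. X b a"
proof -
  fix X :: "'i \<Rightarrow> 'i \<Rightarrow> real"
  assume "finite {(a, b). X a b \<noteq> 0}"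
  then have "finite (prod.swap ` {(a, b). X a b \<noteq> 0})" by simp
  also have "prod.swap ` {(a, b). X a b \<noteq> 0} = {(a, b). X b a \<noteq> 0}" by force
  finally show "finite {(a, b). X b a \<noteq> 0}" .
qed

lemmas entry_tp [simp] = tp.rep_eq

lemma tp_tp [simp]: "tp (tp X) = X"
  by (rule fmat_eqI) simp

lemma tp_mult: "tp (X * Y) = tp Y * tp X"
proof (rule fmat_eqI)
  fix a b
  have "entry (X * Y) b a = (\<Sum>c\<in>idx X. entry X b c * entry Y c a)"
    by (rule entry_mult) (auto simp: entry_eq_0)
  moreover have "entry (tp Y * tp X) a b = (\<Sum>c\<in>idx X. entry (tp Y) a c * entry (tp X) c b)"
    by (rule entry_mult) (auto simp: entry_eq_0)
  ultimately show "entry (tp (X * Y)) a b = entry (tp Y * tp X) a b" 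
    by (simp add: mult.commute)
qed

lemma tp_diff: "tp (X - Y) = tp X - tp Y" by (rule fmat_eqI) simp
lemma tp_uminus: "tp (- X) = - tp X" by (rule fmat_eqI) simp
lemma tp_sum: "tp (sum f A) = (\<Sum>x\<in>A. tp (f x))" by (rule fmat_eqI) simp

section \<open>Trace and the Frobenius inner product\<close>

definition tr :: "'i fmat \<Rightarrow> real" where
  "tr X = (\<Sum>a\<in>idx X. entry X a a)"

lemma tr_eq:
  assumes "finite S" "\<And>a. a \<notin> S \<Longrightarrow> entry X a a = 0"
  shows "tr X = (\<Sum>a\<in>S. entry X a a)"
proof -
  have "tr X = (\<Sum>a\<in>idx X \<union> S. entry X a a)"
    unfolding tr_def by (rule sum.mono_neutral_left) (use assms in auto)
  also have "\<dots> = (\<Sum>a\<in>S. entry X a a)"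
    by (rule sum.mono_neutral_right) (use assms in auto)
  finally show ?thesis .
qed

lemma tr_add: "tr (X + Y) = tr X + tr Y"
proof -
  have "tr U = (\<Sum>a\<in>idx X \<union> idx Y. entry U a a)" if "U \<in> {X, Y, X + Y}" for U
    by (rule tr_eq) (use that in auto)
  then show ?thesis by (simp add: sum.distrib)
qed

lemma tr_0 [simp]: "tr 0 = 0"
  using tr_eq[of "{}" 0] by simp

lemma tr_uminus: "tr (- X) = - tr X"
  by (metis add.right_inverse eq_neg_iff_add_eq_0 neg_eq_iff_add_eq_0 tr_0 tr_add)

lemma tr_diff: "tr (X - Y) = tr X - tr Y"
  by (metis diff_conv_add_uminus tr_add tr_uminus)

lemma tr_sum: "tr (sum f A) = (\<Sum>x\<in>A. tr (f x))"
  by (induction A rule: infinite_finite_induct) (auto simp: tr_add)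

lemma tr_tp [simp]: "tr (tp X) = tr X"
proof -
  have "tr (tp X) = (\<Sum>a\<in>idx X. entry (tp X) a a)"
    by (rule tr_eq) (auto simp: entry_eq_0)
  then show ?thesis by (simp add: tr_def)
qed

lemma tr_mult:
  assumes "finite S" "idx X \<subseteq> S"
  shows "tr (X * Y) = (\<Sum>a\<in>S. \<Sum>c\<in>S. entry X a c * entry Y c a)"
proof -
  have 1: "entry (X * Y) a b = (\<Sum>c\<in>S. entry X a c * entry Y c b)" for a b
    by (rule entry_mult) (use assms entry_eq_0[of _ X] in auto)
  have "tr (X * Y) = (\<Sum>a\<in>S. entry (X * Y) a a)"
  proof (rule tr_eq[OF assms(1)])
    fix a assume "a \<notin> S"
    then have "a \<notin> idx X" using assms(2) by blast
    then show "entry (X * Y) a a = 0" by (simp add: 1)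
  qed
  then show ?thesis by (simp add: 1)
qed

lemma tr_commute: "tr (X * Y) = tr (Y * X)"
proof -
  have "tr (X * Y) = (\<Sum>a\<in>idx X \<union> idx Y. \<Sum>c\<in>idx X \<union> idx Y. entry X a c * entry Y c a)"
    by (rule tr_mult) auto
  also have "\<dots> = (\<Sum>c\<in>idx X \<union> idx Y. \<Sum>a\<in>idx X \<union> idx Y. entry Y c a * entry X a c)"
    by (subst sum.swap) (simp add: mult.commute)
  also have "\<dots> = tr (Y * X)"
    by (rule tr_mult[symmetric]) auto
  finally show ?thesis .
qed

lemma tr_square_nonneg: "tr (tp X * X) \<ge> 0"
proof -
  have "idx (tp X) \<subseteq> idx X" unfolding idx_def by force
  then have "tr (tp X * X) = (\<Sum>a\<in>idx X. \<Sum>c\<in>idx X. entry X c a * entry X c a)"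
    by (subst tr_mult[of "idx X"]) auto
  then show ?thesis by (simp add: sum_nonneg)
qed

lemma tr_amgm: "tr (tp U * V) \<le> (tr (tp U * U) + tr (tp V * V)) / 2"
proof -
  have "tr (tp (U - V) * (U - V)) = tr (tp U * U) + tr (tp V * V) - tr (tp U * V) - tr (tp V * U)"
    by (simp add: tp_diff algebra_simps tr_diff tr_add)
  moreover have "tr (tp V * U) = tr (tp U * V)"
    by (metis tp_mult tp_tp tr_tp)
  ultimately show ?thesis using tr_square_nonneg[of "U - V"] by simp
qed

text \<open>As the ring has no unit, \<open>actl X m X\<close> stands for the power
  \<open>m + 1\<close> of \<open>X\<close>; the odd counts \<open>2 * m + 1\<close> below are
  therefore even powers.\<close>

abbreviation actl :: "'i fmat \<Rightarrow> nat \<Rightarrow> 'i fmat \<Rightarrow> 'i fmat" where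
  "actl P q \<equiv> (\<lambda>Z. P * Z) ^^ q"

abbreviation actr :: "'i fmat \<Rightarrow> nat \<Rightarrow> 'i fmat \<Rightarrow> 'i fmat" where
  "actr R q \<equiv> (\<lambda>Z. Z * R) ^^ q"

lemma actl_mult: "actl P q Z * W = actl P q (Z * W)"
  by (induction q) (auto simp: mult.assoc)

lemma mult_actr: "W * actr R q Z = actr R q (W * Z)"
  by (induction q) (auto simp: mult.assoc[symmetric])

lemma actr_actl: "actr R r (actl P q Z) = actl P q (actr R r Z)"
  by (induction r) (auto simp: actl_mult)

lemma actl_add: "actl P q (U + V) = actl P q U + actl P q V"
  by (induction q) (auto simp: distrib_left)

lemma actr_add: "actr P q (U + V) = actr P q U + actr P q V"
  by (induction q) (auto simp: distrib_right)

lemma actr_uminus: "actr P q (- U) = - actr P q U"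
  by (induction q) auto

lemma actr_shift: "actr R q (Z * R) = actr R q Z * R"
  by (induction q) auto

lemma mult_actl_self: "W * actl Y n Y = actr Y (Suc n) W"
proof (induction n arbitrary: W)
  case (Suc n)
  have "W * actl Y (Suc n) Y = (W * Y) * actl Y n Y" by (simp add: mult.assoc)
  also have "\<dots> = actr Y (Suc n) (W * Y)" by (rule Suc.IH)
  also have "\<dots> = actr Y (Suc (Suc n)) W" by (simp add: actr_shift)
  finally show ?case .
qed simp

lemma tr_actl_eq_actr: "tr (actl X n W) = tr (actr X n W)"
proof (induction n arbitrary: W)
  case (Suc n)
  have "tr (actl X (Suc n) W) = tr (actl X n (W * X))"
    by (simp add: tr_commute[of X] actl_mult)
  also have "\<dots> = tr (actr X (Suc n) W)"
    by (simp add: Suc.IH actr_shift)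
  finally show ?case .
qed simp

lemma actl_adj: "tp P = P \<Longrightarrow> tr (tp (actl P q U) * V) = tr (tp U * actl P q V)"
proof (induction q arbitrary: V)
  case (Suc q)
  have "tr (tp (actl P (Suc q) U) * V) = tr (tp (actl P q U) * (P * V))"
    by (simp add: tp_mult Suc.prems mult.assoc)
  also have "\<dots> = tr (tp U * actl P (Suc q) V)"
    by (simp add: Suc funpow_swap1)
  finally show ?case .
qed simp

lemma actr_adj: "tp R = R \<Longrightarrow> tr (tp (actr R q U) * V) = tr (tp U * actr R q V)"
proof (induction q arbitrary: V)
  case (Suc q)
  have "tr (tp (actr R (Suc q) U) * V) = tr (R * (tp (actr R q U) * V))"
    by (simp add: tp_mult Suc.prems mult.assoc)
  also have "\<dots> = tr (tp (actr R q U) * (V * R))"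
    by (simp add: tr_commute[of R] mult.assoc)
  also have "\<dots> = tr (tp U * actr R (Suc q) V)"
    by (simp add: Suc actr_shift)
  finally show ?case .
qed simp

text \<open>Left multiplication by \<open>P\<close> and right multiplication by \<open>R\<close>
  commute and are self-adjoint for the trace form, so only the total exponents matter.\<close>

lemma tr_sandwich_split:
  assumes "tp P = P" "tp R = R"
  shows "tr (tp (actl P s (actr R t B)) * actl P s' (actr R t' B))
    = tr (tp B * actl P (s + s') (actr R (t + t') B))"
proof -
  have "tr (tp (actl P s (actr R t B)) * actl P s' (actr R t' B))
      = tr (tp (actr R t B) * actl P (s + s') (actr R t' B))"
    by (simp add: actl_adj[OF assms(1)] funpow_add)
  also have "\<dots> = tr (tp B * actr R t (actl P (s + s') (actr R t' B)))"
    by (rule actr_adj[OF assms(2)])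
  also have "\<dots> = tr (tp B * actl P (s + s') (actr R (t + t') B))"
    by (simp add: actr_actl funpow_add)
  finally show ?thesis .
qed

text \<open>At an interior first maximum, convexity would force the left neighbour to attain the
  maximum as well.\<close>

lemma discrete_max_principle:
  fixes g :: "nat \<Rightarrow> real"
  assumes "\<And>s. 0 < s \<Longrightarrow> s < m \<Longrightarrow> 2 * g s \<le> g (s - 1) + g (s + 1)" and "s \<le> m"
  shows "g s \<le> max (g 0) (g m)"
proof -
  define M where "M = Max (g ` {..m})"
  have M: "g u \<le> M" if "u \<le> m" for u
    unfolding M_def using that by (intro Max_ge) auto
  have "M \<in> g ` {..m}" unfolding M_def by (rule Max_in) auto
  then have ex: "\<exists>u. u \<le> m \<and> g u = M" by auto
  define u where "u = (LEAST u. u \<le> m \<and> g u = M)"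
  have u: "u \<le> m" "g u = M" using LeastI_ex[OF ex] by (auto simp: u_def)
  have least: "w < u \<Longrightarrow> w \<le> m \<Longrightarrow> g w \<noteq> M" for w
    using not_less_Least[of w "\<lambda>u. u \<le> m \<and> g u = M"] by (auto simp: u_def)
  have "u = 0 \<or> u = m"
  proof (rule ccontr)
    assume n: "\<not> (u = 0 \<or> u = m)"
    have "0 < u" "u < m" using n u(1) by auto
    then have "2 * g u \<le> g (u - 1) + g (u + 1)" by (rule assms(1))
    moreover have "g (u - 1) \<le> M" using \<open>u < m\<close> by (intro M) simp
    moreover have "g (u - 1) \<noteq> M" using \<open>0 < u\<close> \<open>u < m\<close> by (intro least) auto
    moreover have "g (u + 1) \<le> M" using \<open>u < m\<close> by (intro M) simp
    ultimately show False using u(2) by linarith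
  qed
  then show ?thesis using M[OF assms(2)] u(2) by (metis max.cobounded1 max.cobounded2 order_trans)
qed

text \<open>Along \<open>q + r = 2 * m\<close> the trace of \<open>B * P\<^sup>q * B * R\<^sup>r\<close> is midpoint convex in \<open>q\<close>
  by Cauchy--Schwarz, so it is governed by its two end values.\<close>

lemma tr_sandwich_le:
  assumes P: "tp P = P" and R: "tp R = R" and qr: "q + r = 2 * m"
  shows "tr (tp B * actl P q (actr R r B))
    \<le> tr (tp B * actl P (2 * m) B) + tr (tp B * actr R (2 * m) B)"
proof -
  define f where "f q r = tr (tp B * actl P q (actr R r B))" for q r
  define g where "g s = f (2 * s) (2 * (m - s))" for s
  have mid: "2 * f (s + s') (t + t') \<le> f (2 * s) (2 * t) + f (2 * s') (2 * t')" for s s' t t'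
    using tr_amgm[of "actl P s (actr R t B)" "actl P s' (actr R t' B)"]
    unfolding tr_sandwich_split[OF P R] f_def mult_2 by simp
  have nonneg: "f (2 * s) (2 * t) \<ge> 0" for s t
    using tr_square_nonneg[of "actl P s (actr R t B)"]
    unfolding tr_sandwich_split[OF P R] f_def mult_2 .
  have "2 * g s \<le> g (s - 1) + g (s + 1)" if "0 < s" "s < m" for s
  proof -
    have "s - 1 + (s + 1) = 2 * s" "m - s + 1 + (m - s - 1) = 2 * (m - s)"
      "m - (s - 1) = m - s + 1" "m - (s + 1) = m - s - 1" using that by auto
    then show ?thesis using mid[of "s - 1" "s + 1" "m - s + 1" "m - s - 1"] by (simp only: g_def)
  qed
  then have mx: "g s \<le> max (g 0) (g m)" if "s \<le> m" for s
    using discrete_max_principle[of m g s] that by blast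
  have "g 0 \<ge> 0" "g m \<ge> 0" unfolding g_def by (rule nonneg)+
  then have even: "g s \<le> g 0 + g m" if "s \<le> m" for s
    using mx[OF that] by linarith
  have "f q r \<le> g 0 + g m"
  proof (cases "even q")
    case True
    then obtain s where s: "q = 2 * s" by blast
    with qr have "r = 2 * (m - s)" "s \<le> m" by auto
    with s even show ?thesis by (simp add: g_def)
  next
    case False
    then obtain s where s: "q = 2 * s + 1" by (rule oddE)
    with qr have sm: "s + 1 \<le> m" by linarith
    then obtain w where w: "m = s + 1 + w" by (rule le_Suc_ex[THEN exE])
    have "r = 2 * w + 1" using qr s w by linarith
    moreover have "m - s - 1 = w" by (simp add: w)
    ultimately have r: "r = 2 * (m - s - 1) + 1" by (simp only:)
    \<comment> \<open>Only even exponents are covered by the maximum principle; an odd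
      \<open>q\<close> lies midway between \<open>2 * s\<close> and
      \<open>2 * s + 2\<close>.\<close>
    have "2 * f q r \<le> f (2 * s) (2 * (m - s)) + f (2 * (s + 1)) (2 * (m - (s + 1)))"
    proof -
      have "s + (s + 1) = q" "m - s + (m - s - 1) = r" "m - (s + 1) = m - s - 1"
        using s r sm by linarith+
      then show ?thesis using mid[of s "s + 1" "m - s" "m - s - 1"] by (simp only:)
    qed
    also have "\<dots> = g s + g (s + 1)" by (simp add: g_def)
    finally show ?thesis using even[of s] even[of "s + 1"] sm by simp
  qed
  then show ?thesis by (simp add: f_def g_def)
qed

text \<open>The noncommutative form of the geometric-sum identity for a difference of
  powers.\<close>

lemma power_diff_telescope:
  "actl X n X - actl Y n Y = (\<Sum>q\<le>n. actl X q (actr Y (n - q) (X - Y)))"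
proof (induction n)
  case (Suc n)
  have "actl X (Suc n) X - actl Y (Suc n) Y
      = (X - Y) * actl Y n Y + X * (actl X n X - actl Y n Y)"
    by (simp add: algebra_simps)
  also have "\<dots> = actr Y (Suc n) (X - Y) + (\<Sum>q\<le>n. X * actl X q (actr Y (n - q) (X - Y)))"
    by (simp only: mult_actl_self Suc.IH sum_distrib_left)
  also have "\<dots> = (\<Sum>q\<le>Suc n. actl X q (actr Y (Suc n - q) (X - Y)))"
    by (subst sum.atMost_Suc_shift) simp
  finally show ?case .
qed simp

section \<open>A matrix Khintchine inequality for Rademacher signs\<close>

text \<open>\<open>T\<close> is the set of indices with sign -1, so a sum over \<open>Pow J\<close>
  is \<open>2 ^ card J\<close> times a Rademacher expectation.\<close>

definition flip :: "'j set \<Rightarrow> 'j \<Rightarrow> 'a::uminus \<Rightarrow> 'a" where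
  "flip T j x = (if j \<in> T then - x else x)"

text \<open>Discrete integration by parts: pairing \<open>T\<close> with the set in which the sign
  of \<open>j\<close> is reversed turns \<open>B j\<close> times an odd power into
  \<open>B j\<close> times a difference of odd powers. The two sums differ by twice the signed
  \<open>B j\<close>, so the difference telescopes into \<open>2 * m + 1\<close> sandwiched terms,
  each with a factor 2; this is the \<open>4 * m + 2\<close>. Then \<open>tr_sandwich_le\<close>
  trades each mixed product for pure powers of one sum or the other.\<close>

lemma khintchine_step:
  fixes B :: "'j \<Rightarrow> 'i fmat"
  assumes fin: "finite J" and sym: "\<And>j. j \<in> J \<Longrightarrow> tp (B j) = B j"
  defines "X \<equiv> \<lambda>T. \<Sum>j\<in>J. flip T j (B j)"
  shows "(\<Sum>T\<in>Pow J. tr (actl (X T) (2 * m + 1) (X T)))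
    \<le> (4 * real m + 2) * (\<Sum>T\<in>Pow J. \<Sum>j\<in>J. tr (tp (B j) * actr (X T) (2 * m) (B j)))"
proof -
  have symX: "tp (X T) = X T" for T
    unfolding X_def tp_sum by (rule sum.cong) (auto simp: flip_def tp_uminus sym)
  define h where "h j T = tr (flip T j (B j) * actl (X T) (2 * m) (X T))" for j T
  define u where "u j T = tr (tp (B j) * actr (X T) (2 * m) (B j))" for j T
  define sw where "sw j T = (if j \<in> T then T - {j} else insert j T)" for j :: 'j and T
  have sw_sum: "(\<Sum>T\<in>Pow J. k (sw j T)) = (\<Sum>T\<in>Pow J. k T)" if "j \<in> J" for j and k :: "'j set \<Rightarrow> real"
    by (rule sum.reindex_bij_witness[of _ "sw j" "sw j"]) (use that in \<open>auto simp: sw_def\<close>)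
  have pair: "h j T + h j (sw j T) \<le> (4 * real m + 2) * (u j T + u j (sw j T))"
    if j: "j \<in> J" for j T
  proof -
    define B' where "B' = flip T j (B j)"
    define Y where "Y = X (sw j T)"
    have flip_sw: "flip (sw j T) j (B j) = - B'" by (auto simp: B'_def flip_def sw_def)
    have "X T - Y = (\<Sum>i\<in>J. flip T i (B i) - flip (sw j T) i (B i))"
      by (simp add: X_def Y_def sum_subtractf)
    also have "\<dots> = (\<Sum>i\<in>J. if i = j then B' + B' else 0)"
    proof (rule sum.cong[OF refl])
      fix i assume "i \<in> J"
      show "flip T i (B i) - flip (sw j T) i (B i) = (if i = j then B' + B' else 0)"
        using flip_sw by (cases "i = j") (simp_all add: B'_def flip_def sw_def)
    qed
    also have "\<dots> = B' + B'" using fin j by simp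
    finally have diff: "X T - Y = B' + B'" .
    have symB: "tp B' = B'" using sym[OF j] by (auto simp: B'_def flip_def tp_uminus)
    have uT: "u j T = tr (tp B' * actr (X T) (2 * m) B')"
      by (auto simp: u_def B'_def flip_def tp_uminus actr_uminus)
    have uY: "u j (sw j T) = tr (tp B' * actr Y (2 * m) B')"
      by (auto simp: u_def B'_def Y_def flip_def tp_uminus actr_uminus)
    have lr: "tr (tp B' * actl (X T) (2 * m) B') = u j T"
    proof -
      have "tr (tp B' * actl (X T) (2 * m) B') = tr (actl (X T) (2 * m) (B' * B'))"
        by (subst tr_commute) (simp add: actl_mult symB)
      also have "\<dots> = u j T" by (simp add: tr_actl_eq_actr uT mult_actr symB)
      finally show ?thesis .
    qed
    have "h j T + h j (sw j T) = tr (B' * (actl (X T) (2 * m) (X T) - actl Y (2 * m) Y))"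
      unfolding h_def flip_sw Y_def[symmetric] right_diff_distrib tr_diff
      by (simp only: B'_def[symmetric] mult_minus_left tr_uminus diff_conv_add_uminus)
    also have "\<dots> = (\<Sum>q\<le>2 * m. 2 * tr (tp B' * actl (X T) q (actr Y (2 * m - q) B')))"
      unfolding power_diff_telescope diff sum_distrib_left tr_sum actl_add actr_add distrib_left tr_add symB
      by (rule sum.cong) simp_all
    also have "\<dots> \<le> (\<Sum>q\<le>2 * m. 2 * (u j T + u j (sw j T)))"
    proof (rule sum_mono)
      fix q assume "q \<in> {..2 * m}"
      then have "tr (tp B' * actl (X T) q (actr Y (2 * m - q) B'))
          \<le> tr (tp B' * actl (X T) (2 * m) B') + tr (tp B' * actr Y (2 * m) B')"
        by (intro tr_sandwich_le) (auto simp: symX Y_def)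
      then show "2 * tr (tp B' * actl (X T) q (actr Y (2 * m - q) B')) \<le> 2 * (u j T + u j (sw j T))"
        by (simp add: lr uY)
    qed
    also have "\<dots> = (4 * real m + 2) * (u j T + u j (sw j T))" by (simp add: algebra_simps)
    finally show ?thesis .
  qed
  have tr_h: "tr (actl (X T) (2 * m + 1) (X T)) = (\<Sum>j\<in>J. h j T)" for T
  proof -
    have "tr (actl (X T) (2 * m + 1) (X T)) = tr (X T * actl (X T) (2 * m) (X T))" by simp
    also have "\<dots> = tr (\<Sum>j\<in>J. flip T j (B j) * actl (X T) (2 * m) (X T))"
      by (subst X_def) (simp only: sum_distrib_right)
    also have "\<dots> = (\<Sum>j\<in>J. h j T)" by (simp only: tr_sum h_def)
    finally show ?thesis .
  qed
  have "(\<Sum>T\<in>Pow J. tr (actl (X T) (2 * m + 1) (X T))) = (\<Sum>j\<in>J. \<Sum>T\<in>Pow J. h j T)"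
    unfolding tr_h by (rule sum.swap)
  also have "\<dots> \<le> (\<Sum>j\<in>J. (4 * real m + 2) * (\<Sum>T\<in>Pow J. u j T))"
  proof (rule sum_mono)
    fix j assume j: "j \<in> J"
    have "2 * (\<Sum>T\<in>Pow J. h j T) = (\<Sum>T\<in>Pow J. h j T + h j (sw j T))"
      by (simp add: sum.distrib sw_sum[OF j])
    also have "\<dots> \<le> (\<Sum>T\<in>Pow J. (4 * real m + 2) * (u j T + u j (sw j T)))"
      by (intro sum_mono pair j)
    also have "\<dots> = 2 * ((4 * real m + 2) * (\<Sum>T\<in>Pow J. u j T))"
      by (simp add: sum_distrib_left[symmetric] sum.distrib sw_sum[OF j])
    finally show "(\<Sum>T\<in>Pow J. h j T) \<le> (4 * real m + 2) * (\<Sum>T\<in>Pow J. u j T)" by simp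
  qed
  also have "\<dots> = (4 * real m + 2) * (\<Sum>T\<in>Pow J. \<Sum>j\<in>J. u j T)"
    by (simp only: sum_distrib_left[symmetric] sum.swap[of _ "Pow J" J])
  finally show ?thesis by (simp add: u_def)
qed

text \<open>Iterates \<open>khintchine_step\<close>: \<open>var\<close> lowers the power by two, and
  \<open>dim\<close> ends the recursion. The hypothesis \<open>var\<close> is the operator
  inequality \<open>\<Sum> B\<^sub>j\<^sup>2 \<le> v\<close> tested against every \<open>Z\<close>;
  \<open>dim\<close> is its instance at the identity, stated separately because the ring has no
  unit, with \<open>d\<close> in the role of the dimension. Each factor \<open>4 * m + 2\<close>
  with \<open>m < p\<close> is at most \<open>4 * p\<close>.\<close>

theorem rademacher_khintchine:
  fixes B :: "'j \<Rightarrow> 'i fmat"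
  assumes fin: "finite J" and sym: "\<And>j. j \<in> J \<Longrightarrow> tp (B j) = B j"
    and var: "\<And>Z. (\<Sum>j\<in>J. tr (tp (B j * Z) * (B j * Z))) \<le> v * tr (tp Z * Z)"
    and dim: "(\<Sum>j\<in>J. tr (tp (B j) * B j)) \<le> v * d"
    and v: "v \<ge> 0" and d: "d \<ge> 0" and m: "m < p"
  defines "X \<equiv> \<lambda>T. \<Sum>j\<in>J. flip T j (B j)"
  shows "(\<Sum>T\<in>Pow J. tr (actl (X T) (2 * m + 1) (X T))) \<le> (4 * real p * v) ^ (m + 1) * d * 2 ^ card J"
  using m
proof (induction m)
  case 0
  have "(\<Sum>T\<in>Pow J. tr (actl (X T) (2 * 0 + 1) (X T)))
      \<le> (4 * real 0 + 2) * (\<Sum>T\<in>Pow J. \<Sum>j\<in>J. tr (tp (B j) * actr (X T) (2 * 0) (B j)))"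
    unfolding X_def using khintchine_step[OF fin sym, where m = 0] by simp
  also have "\<dots> \<le> 2 * (\<Sum>T\<in>Pow J. v * d)"
    using dim by (simp add: mult_left_mono)
  also have "\<dots> = 2 * v * d * 2 ^ card J" using fin by (simp add: card_Pow)
  also have "\<dots> \<le> (4 * real p * v) ^ (0 + 1) * d * 2 ^ card J"
  proof -
    have "2 * v \<le> (4 * real p * v) ^ (0 + 1)" using 0 mult_right_mono[of 2 "4 * real p" v] v by simp
    then show ?thesis using d by (intro mult_right_mono) auto
  qed
  finally show ?case .
next
  case (Suc m)
  have symX: "tp (X T) = X T" for T
    unfolding X_def tp_sum by (rule sum.cong) (auto simp: flip_def tp_uminus sym)
  have key: "(\<Sum>j\<in>J. tr (tp (B j) * actr (X T) (2 * Suc m) (B j))) \<le> v * tr (actl (X T) (2 * m + 1) (X T))" for T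
  proof -
    \<comment> \<open>Half of the power \<open>2 * m + 2\<close>: the trace of the square of
      \<open>B j\<close> times that power is the squared Frobenius norm of
      \<open>B j * Z\<close>.\<close>
    define Z where "Z = actl (X T) m (X T)"
    have "tr (tp (B j) * actr (X T) (2 * Suc m) (B j)) = tr (tp (B j * Z) * (B j * Z))" for j
    proof -
      have "tr (tp (B j * Z) * (B j * Z)) = tr (tp (actr (X T) (Suc m) (B j)) * actr (X T) (Suc m) (B j))"
        by (simp only: Z_def mult_actl_self)
      also have "\<dots> = tr (tp (B j) * actr (X T) (Suc m) (actr (X T) (Suc m) (B j)))"
        by (rule actr_adj) (rule symX)
      also have "\<dots> = tr (tp (B j) * actr (X T) (2 * Suc m) (B j))"
        by (simp only: mult_2 funpow_add o_apply)
      finally show ?thesis by simp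
    qed
    then have "(\<Sum>j\<in>J. tr (tp (B j) * actr (X T) (2 * Suc m) (B j))) \<le> v * tr (tp Z * Z)"
      using var[of Z] by simp
    also have "tr (tp Z * Z) = tr (tp (X T) * actl (X T) m Z)"
      unfolding Z_def by (rule actl_adj) (rule symX)
    also have "\<dots> = tr (actl (X T) (Suc (m + m)) (X T))"
      by (simp add: symX Z_def funpow_add)
    finally show ?thesis by (simp add: mult_2)
  qed
  have "(\<Sum>T\<in>Pow J. tr (actl (X T) (2 * Suc m + 1) (X T)))
      \<le> (4 * real (Suc m) + 2) * (\<Sum>T\<in>Pow J. \<Sum>j\<in>J. tr (tp (B j) * actr (X T) (2 * Suc m) (B j)))"
    unfolding X_def by (rule khintchine_step[OF fin sym])
  also have "\<dots> \<le> (4 * real (Suc m) + 2) * (\<Sum>T\<in>Pow J. v * tr (actl (X T) (2 * m + 1) (X T)))"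
    using key by (intro mult_left_mono sum_mono) auto
  also have "\<dots> = (4 * real (Suc m) + 2) * v * (\<Sum>T\<in>Pow J. tr (actl (X T) (2 * m + 1) (X T)))"
    by (simp add: sum_distrib_left mult.assoc)
  also have "\<dots> \<le> (4 * real (Suc m) + 2) * v * ((4 * real p * v) ^ (m + 1) * d * 2 ^ card J)"
    using Suc v by (intro mult_left_mono) auto
  also have "\<dots> \<le> 4 * real p * v * ((4 * real p * v) ^ (m + 1) * d * 2 ^ card J)"
    using Suc.prems v d by (intro mult_right_mono) auto
  finally show ?case by (simp add: mult.assoc)
qed

lemma idx_subsetI:
  assumes "\<And>a b. entry X a b \<noteq> 0 \<Longrightarrow> a \<in> S \<and> b \<in> S"
  shows "idx X \<subseteq> S"
  using assms unfolding idx_def by (auto simp del: entry_outL entry_outR)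

lemma actl_square: "actl (X * X) n (X * X) = actl X (2 * n + 1) X"
  by (induction n) (auto simp: mult.assoc)

lemma idx_mult: "idx X \<subseteq> S \<Longrightarrow> idx Y \<subseteq> S \<Longrightarrow> idx (X * Y) \<subseteq> S"
proof -
  assume S: "idx X \<subseteq> S" "idx Y \<subseteq> S"
  have e: "entry (X * Y) a b = (\<Sum>c\<in>idx X. entry X a c * entry Y c b)" for a b
    by (rule entry_mult) (auto simp: entry_eq_0)
  have "a \<in> S \<and> b \<in> S" if "entry (X * Y) a b \<noteq> 0" for a b
  proof -
    from that obtain c where "entry X a c * entry Y c b \<noteq> 0" unfolding e
      by (rule sum.not_neutral_contains_not_neutral)
    then have "a \<in> idx X" "b \<in> idx Y" using entry_eq_0[of a X c] entry_eq_0[of c Y b] by auto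
    then show ?thesis using S by blast
  qed
  then show ?thesis by (rule idx_subsetI) blast
qed

section \<open>Pairing with a positive semidefinite matrix\<close>

text \<open>The trace is left free because diagonal blocks of the moment matrix and rank-one
  matrices are also instances; it is set to 1 only where powers are compared.\<close>

locale density_matrix =
  fixes I :: "'i set" and Q :: "'i \<Rightarrow> 'i \<Rightarrow> real"
  assumes finite_I: "finite I"
    and Q_sym: "\<And>a b. a \<in> I \<Longrightarrow> b \<in> I \<Longrightarrow> Q a b = Q b a"
    and Q_psd: "\<And>z. (\<Sum>a\<in>I. \<Sum>b\<in>I. z a * z b * Q a b) \<ge> 0"
begin

definition trQ where "trQ = (\<Sum>a\<in>I. Q a a)"

lemma Q_diag: "a \<in> I \<Longrightarrow> Q a a \<ge> 0"
proof -
  assume a: "a \<in> I"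
  have "0 \<le> (\<Sum>x\<in>I. \<Sum>y\<in>I. (if x = a then 1 else 0) * (if y = a then 1 else 0) * Q x y)"
    by (rule Q_psd)
  also have "\<dots> = (\<Sum>x\<in>I. if x = a then (\<Sum>y\<in>I. if y = a then Q x y else 0) else 0)"
    by (intro sum.cong refl) (auto intro!: sum.cong)
  also have "\<dots> = Q a a" using a finite_I by simp
  finally show ?thesis .
qed

text \<open>Test vectors supported on \<open>{a, b}\<close> reduce this to a binary quadratic form.
  The weights \<open>Q a b\<close> and \<open>- Q a a\<close> produce \<open>Q a a\<close> times the
  minor; if \<open>Q a a = 0\<close>, a suitable multiple of the first unit vector would make the
  form negative unless \<open>Q a b = 0\<close>.\<close>

lemma Q_minor:
  assumes a: "a \<in> I" and b: "b \<in> I"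
  shows "(Q a b)\<^sup>2 \<le> Q a a * Q b b"
proof (cases "a = b")
  case False
  have quad: "s\<^sup>2 * Q a a + 2 * s * t * Q a b + t\<^sup>2 * Q b b \<ge> 0" for s t
  proof -
    define z where "z x = (if x = a then s else if x = b then t else 0)" for x
    have "0 \<le> (\<Sum>x\<in>I. \<Sum>y\<in>I. z x * z y * Q x y)" by (rule Q_psd)
    also have "\<dots> = (\<Sum>x\<in>{a, b}. \<Sum>y\<in>I. z x * z y * Q x y)"
      by (rule sum.mono_neutral_right) (use a b finite_I in \<open>auto simp: z_def\<close>)
    also have "\<dots> = (\<Sum>x\<in>{a, b}. \<Sum>y\<in>{a, b}. z x * z y * Q x y)"
      by (intro sum.cong refl sum.mono_neutral_right) (use a b finite_I in \<open>auto simp: z_def\<close>)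
    also have "\<dots> = s\<^sup>2 * Q a a + 2 * s * t * Q a b + t\<^sup>2 * Q b b"
      using False Q_sym[OF a b] by (simp add: z_def power2_eq_square algebra_simps)
    finally show ?thesis .
  qed
  have q: "Q a a \<ge> 0" using Q_diag[OF a] .
  show ?thesis
  proof (cases "Q a a = 0")
    case True
    have "0 \<le> 2 * s * Q a b + Q b b" for s using quad[of s 1] True by simp
    have "Q a b = 0"
    proof (rule ccontr)
      assume nz: "Q a b \<noteq> 0"
      then have "2 * (- (Q b b + 1) / (2 * Q a b)) * Q a b = - (Q b b + 1)" by (simp add: field_simps)
      with \<open>\<And>s. 0 \<le> 2 * s * Q a b + Q b b\<close>[of "- (Q b b + 1) / (2 * Q a b)"] show False by linarith
    qed
    with True show ?thesis by simp
  next
    case False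
    have "0 \<le> (Q a b)\<^sup>2 * Q a a + 2 * (Q a b) * (- Q a a) * Q a b + (- Q a a)\<^sup>2 * Q b b"
      using quad[of "Q a b" "- Q a a"] .
    also have "\<dots> = Q a a * (Q a a * Q b b - (Q a b)\<^sup>2)" by (simp add: power2_eq_square algebra_simps)
    finally show ?thesis using q False by (simp add: zero_le_mult_iff)
  qed
qed (simp add: power2_eq_square)

lemma Q_abs_le: "a \<in> I \<Longrightarrow> b \<in> I \<Longrightarrow> \<bar>Q a b\<bar> \<le> sqrt (Q a a) * sqrt (Q b b)"
  using Q_minor[of a b] by (metis real_le_rsqrt real_sqrt_mult power2_abs)

lemma trQ_nonneg: "trQ \<ge> 0" unfolding trQ_def using Q_diag by (rule sum_nonneg)

lemma frobenius_Q: "(\<Sum>a\<in>I. \<Sum>b\<in>I. (Q a b)\<^sup>2) \<le> trQ\<^sup>2"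
proof -
  have "(\<Sum>a\<in>I. \<Sum>b\<in>I. (Q a b)\<^sup>2) \<le> (\<Sum>a\<in>I. \<Sum>b\<in>I. Q a a * Q b b)"
    by (intro sum_mono Q_minor)
  also have "\<dots> = trQ\<^sup>2" by (simp add: trQ_def power2_eq_square sum_product)
  finally show ?thesis .
qed

text \<open>The largest eigenvalue is at most the trace, obtained here from the minors and
  Cauchy--Schwarz.\<close>

lemma quadratic_form_le: "(\<Sum>a\<in>I. \<Sum>b\<in>I. z a * z b * Q a b) \<le> trQ * (\<Sum>a\<in>I. (z a)\<^sup>2)"
proof -
  have "(\<Sum>a\<in>I. \<Sum>b\<in>I. z a * z b * Q a b)
      \<le> (\<Sum>a\<in>I. \<Sum>b\<in>I. (\<bar>z a\<bar> * sqrt (Q a a)) * (\<bar>z b\<bar> * sqrt (Q b b)))"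
  proof (intro sum_mono)
    fix a b assume ab: "a \<in> I" "b \<in> I"
    have "z a * z b * Q a b \<le> \<bar>z a\<bar> * \<bar>z b\<bar> * \<bar>Q a b\<bar>" by (metis abs_ge_self abs_mult)
    also have "\<dots> \<le> \<bar>z a\<bar> * \<bar>z b\<bar> * (sqrt (Q a a) * sqrt (Q b b))"
      by (intro mult_left_mono Q_abs_le ab) auto
    finally show "z a * z b * Q a b \<le> (\<bar>z a\<bar> * sqrt (Q a a)) * (\<bar>z b\<bar> * sqrt (Q b b))"
      by (simp add: mult_ac)
  qed
  also have "\<dots> = (\<Sum>a\<in>I. \<bar>z a\<bar> * sqrt (Q a a))\<^sup>2" by (simp add: power2_eq_square sum_product)
  also have "\<dots> \<le> (\<Sum>a\<in>I. \<bar>z a\<bar>\<^sup>2) * (\<Sum>a\<in>I. (sqrt (Q a a))\<^sup>2)" by (rule Cauchy_Schwarz_ineq_sum)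
  also have "\<dots> = trQ * (\<Sum>a\<in>I. (z a)\<^sup>2)" using Q_diag by (simp add: trQ_def)
  finally show ?thesis .
qed

text \<open>Made for Gram matrices, whose diagonal is large but uniform and whose other entries
  fluctuate: the diagonal meets the nonnegative diagonal of \<open>Q\<close>, the rest is handled by
  Cauchy--Schwarz and \<open>frobenius_Q\<close>.\<close>

lemma pairing_le_diag_plus_frobenius:
  assumes diag: "\<And>a. a \<in> I \<Longrightarrow> V a a \<le> D"
    and off: "(\<Sum>a\<in>I. \<Sum>b\<in>I - {a}. (V a b)\<^sup>2) \<le> F\<^sup>2" and F: "F \<ge> 0"
  shows "(\<Sum>a\<in>I. \<Sum>b\<in>I. V a b * Q a b) \<le> (D + F) * trQ"
proof -
  define W where "W a b = (if a = b then 0 else V a b)" for a b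
  have W: "(\<Sum>a\<in>I. \<Sum>b\<in>I. (W a b)\<^sup>2) \<le> F\<^sup>2"
  proof -
    have "(\<Sum>a\<in>I. \<Sum>b\<in>I. (W a b)\<^sup>2) = (\<Sum>a\<in>I. \<Sum>b\<in>I - {a}. (V a b)\<^sup>2)"
      by (intro sum.cong refl sum.mono_neutral_cong_right) (use finite_I in \<open>auto simp: W_def\<close>)
    then show ?thesis using off by simp
  qed
  have "(\<Sum>a\<in>I. \<Sum>b\<in>I. W a b * Q a b) \<le> F * trQ"
  proof -
    have "(\<Sum>(a, b)\<in>I \<times> I. W a b * Q a b)\<^sup>2
        \<le> (\<Sum>(a, b)\<in>I \<times> I. (W a b)\<^sup>2) * (\<Sum>(a, b)\<in>I \<times> I. (Q a b)\<^sup>2)"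
      using Cauchy_Schwarz_ineq_sum[of "\<lambda>(a, b). W a b" "\<lambda>(a, b). Q a b" "I \<times> I"]
      by (simp add: case_prod_unfold)
    also have "\<dots> \<le> F\<^sup>2 * trQ\<^sup>2"
      using W frobenius_Q by (intro mult_mono) (auto simp: sum.cartesian_product[symmetric] intro!: sum_nonneg)
    finally have "(\<Sum>(a, b)\<in>I \<times> I. W a b * Q a b)\<^sup>2 \<le> (F * trQ)\<^sup>2"
      by (simp only: power_mult_distrib)
    moreover have "0 \<le> F * trQ" using F trQ_nonneg by (rule mult_nonneg_nonneg)
    ultimately have "(\<Sum>(a, b)\<in>I \<times> I. W a b * Q a b) \<le> F * trQ"
      by (rule power2_le_imp_le)
    then show ?thesis by (simp add: sum.cartesian_product)
  qed
  moreover have "(\<Sum>a\<in>I. \<Sum>b\<in>I. V a b * Q a b)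
      = (\<Sum>a\<in>I. V a a * Q a a) + (\<Sum>a\<in>I. \<Sum>b\<in>I. W a b * Q a b)"
  proof -
    have "(\<Sum>b\<in>I. V a b * Q a b) = V a a * Q a a + (\<Sum>b\<in>I. W a b * Q a b)" if "a \<in> I" for a
    proof -
      have "(\<Sum>b\<in>I. V a b * Q a b) = (\<Sum>b\<in>I. (if b = a then V a a * Q a a else 0) + W a b * Q a b)"
        by (rule sum.cong) (auto simp: W_def)
      then show ?thesis using that finite_I by (simp add: sum.distrib)
    qed
    then show ?thesis by (simp add: sum.distrib)
  qed
  moreover have "(\<Sum>a\<in>I. V a a * Q a a) \<le> D * trQ"
    unfolding trQ_def sum_distrib_left by (intro sum_mono mult_right_mono diag Q_diag)
  ultimately show ?thesis by (simp add: distrib_right)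
qed

definition pairing :: "'i fmat \<Rightarrow> real" where
  "pairing X = (\<Sum>a\<in>I. \<Sum>b\<in>I. entry X a b * Q a b)"

context
  assumes trQ1: "trQ = 1"
begin

text \<open>With \<open>l = pairing X\<close>, the first bound is nonnegativity of a variance:
  \<open>Q\<close> is tested on each column of \<open>X\<close> minus \<open>l\<close> times the
  identity, and the results are added. The second applies \<open>quadratic_form_le\<close> to each
  column.\<close>

lemma pairing_square:
  assumes X: "tp X = X" "idx X \<subseteq> I"
  shows "(pairing X)\<^sup>2 \<le> pairing (X * X)" "pairing (X * X) \<le> tr (X * X)"
proof -
  have X': "entry X a b = entry X b a" for a b by (metis X(1) entry_tp)
  have XX: "entry (X * X) a b = (\<Sum>c\<in>I. entry X a c * entry X b c)" for a b
    by (subst entry_mult[of I]) (use X finite_I entry_eq_0[of _ X] in \<open>auto simp: X'[of b]\<close>)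
  have quad: "pairing (X * X) = (\<Sum>c\<in>I. \<Sum>a\<in>I. \<Sum>b\<in>I. entry X a c * entry X b c * Q a b)"
    unfolding pairing_def XX sum_distrib_right
  proof -
    have "(\<Sum>a\<in>I. \<Sum>b\<in>I. \<Sum>c\<in>I. entry X a c * entry X b c * Q a b)
      = (\<Sum>a\<in>I. \<Sum>c\<in>I. \<Sum>b\<in>I. entry X a c * entry X b c * Q a b)"
      by (rule sum.cong[OF refl], rule sum.swap)
    also have "\<dots> = (\<Sum>c\<in>I. \<Sum>a\<in>I. \<Sum>b\<in>I. entry X a c * entry X b c * Q a b)"
      by (rule sum.swap)
    finally show "(\<Sum>a\<in>I. \<Sum>b\<in>I. \<Sum>c\<in>I. entry X a c * entry X b c * Q a b)
      = (\<Sum>c\<in>I. \<Sum>a\<in>I. \<Sum>b\<in>I. entry X a c * entry X b c * Q a b)" .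
  qed
  define l where "l = pairing X"
  have "0 \<le> (\<Sum>c\<in>I. \<Sum>a\<in>I. \<Sum>b\<in>I. (entry X a c - l * (if a = c then 1 else 0))
      * (entry X b c - l * (if b = c then 1 else 0)) * Q a b)"
    by (intro sum_nonneg Q_psd)
  also have "\<dots> = (\<Sum>c\<in>I. (\<Sum>a\<in>I. \<Sum>b\<in>I. entry X a c * entry X b c * Q a b)
      - 2 * l * (\<Sum>b\<in>I. entry X b c * Q b c) + l\<^sup>2 * Q c c)"
  proof (rule sum.cong[OF refl])
    fix c assume c: "c \<in> I"
    define d :: "'i \<Rightarrow> real" where "d a = (if a = c then 1 else 0)" for a
    have D: "(\<Sum>a\<in>I. d a * k a) = k c" for k
    proof -
      have "(\<Sum>a\<in>I. d a * k a) = (\<Sum>a\<in>I. if a = c then k a else 0)"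
        by (rule sum.cong) (auto simp: d_def)
      then show ?thesis using c finite_I by simp
    qed
    have e: "(entry X a c - l * d a) * (entry X b c - l * d b) * Q a b
      = entry X a c * entry X b c * Q a b - l * (d b * (entry X a c * Q a b))
        - l * (d a * (entry X b c * Q a b)) + l\<^sup>2 * (d a * (d b * Q a b))" for a b
      by (simp add: power2_eq_square algebra_simps)
    have "(\<Sum>a\<in>I. \<Sum>b\<in>I. (entry X a c - l * d a) * (entry X b c - l * d b) * Q a b)
      = (\<Sum>a\<in>I. \<Sum>b\<in>I. entry X a c * entry X b c * Q a b)
        - l * (\<Sum>a\<in>I. entry X a c * Q a c) - l * (\<Sum>b\<in>I. entry X b c * Q c b) + l\<^sup>2 * Q c c"
      by (simp only: e sum.distrib sum_subtractf sum_distrib_left[symmetric] D)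
    also have "(\<Sum>b\<in>I. entry X b c * Q c b) = (\<Sum>b\<in>I. entry X b c * Q b c)"
      by (intro sum.cong refl) (simp add: Q_sym c)
    finally show "(\<Sum>a\<in>I. \<Sum>b\<in>I. (entry X a c - l * (if a = c then 1 else 0))
      * (entry X b c - l * (if b = c then 1 else 0)) * Q a b)
      = (\<Sum>a\<in>I. \<Sum>b\<in>I. entry X a c * entry X b c * Q a b)
      - 2 * l * (\<Sum>b\<in>I. entry X b c * Q b c) + l\<^sup>2 * Q c c" by (simp add: d_def)
  qed
  also have "\<dots> = pairing (X * X) - 2 * l * (\<Sum>c\<in>I. \<Sum>b\<in>I. entry X b c * Q b c) + l\<^sup>2 * trQ"
    by (simp add: sum.distrib sum_subtractf quad sum_distrib_left trQ_def)
  also have "(\<Sum>c\<in>I. \<Sum>b\<in>I. entry X b c * Q b c) = l"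
    unfolding l_def pairing_def by (rule sum.swap)
  finally show "(pairing X)\<^sup>2 \<le> pairing (X * X)"
    using trQ1 by (simp add: l_def power2_eq_square)
  have "pairing (X * X) \<le> (\<Sum>c\<in>I. trQ * (\<Sum>a\<in>I. (entry X a c)\<^sup>2))"
    unfolding quad by (intro sum_mono quadratic_form_le)
  also have "\<dots> = (\<Sum>c\<in>I. \<Sum>a\<in>I. entry X c a * entry X a c)"
    by (simp add: trQ1 power2_eq_square X')
  also have "\<dots> = tr (X * X)" by (rule tr_mult[symmetric, OF finite_I X(2)])
  finally show "pairing (X * X) \<le> tr (X * X)" .
qed

text \<open>Repeated squaring by \<open>pairing_square\<close> takes the place of a spectral
  argument, which is why the exponents are powers of two.\<close>

theorem pairing_power_le_tr:
  assumes "tp X = X" "idx X \<subseteq> I"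
  shows "(pairing X) ^ (2 ^ Suc k) \<le> tr (actl X (2 ^ Suc k - 1) X)"
  using assms
proof (induction k arbitrary: X)
  case 0
  then show ?case using pairing_square[of X] by simp
next
  case (Suc k)
  have e: "2 * (2 ^ Suc k - 1) + 1 = (2 ^ Suc (Suc k) - 1 :: nat)"
    using one_le_power[of "2::nat" "Suc k"] power_Suc[of "2::nat" "Suc k"] by linarith
  have "(pairing X) ^ (2 ^ Suc (Suc k)) = ((pairing X)\<^sup>2) ^ (2 ^ Suc k)"
    by (simp only: power_mult[symmetric] power_Suc)
  also have "\<dots> \<le> (pairing (X * X)) ^ (2 ^ Suc k)"
    by (intro power_mono pairing_square Suc.prems) auto
  also have "\<dots> \<le> tr (actl (X * X) (2 ^ Suc k - 1) (X * X))"
    using Suc.prems by (intro Suc.IH idx_mult) (auto simp: tp_mult)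
  also have "\<dots> = tr (actl X (2 ^ Suc (Suc k) - 1) X)"
    by (simp only: actl_square e)
  finally show ?case .
qed

end

end

section \<open>Gaussian product measures\<close>

abbreviation N1 :: "real measure" where
  "N1 \<equiv> density lborel std_normal_density"

abbreviation gauss :: "'i set \<Rightarrow> ('i \<Rightarrow> real) measure" where
  "gauss I \<equiv> PiM I (\<lambda>_. N1)"

lemma prob_space_N1: "prob_space N1"
  by (rule prob_space_normal_density) simp

lemma prob_space_gauss: "prob_space (gauss I)"
  by (rule prob_space_PiM) (rule prob_space_N1)

lemma product_sigma_finite_N1: "product_sigma_finite (\<lambda>_. N1)"
  unfolding product_sigma_finite_def
  using prob_space_N1 prob_space_imp_sigma_finite by blast

text \<open>Outside the index set a point of the product space is constantly \<open>undefined\<close>.\<close>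

lemma measurable_gauss_component [measurable]: "(\<lambda>x. x j) \<in> borel_measurable (gauss I)"
proof (cases "j \<in> I")
  case True
  then have "(\<lambda>x. x j) \<in> gauss I \<rightarrow>\<^sub>M N1" by (rule measurable_component_singleton)
  then show ?thesis by simp
next
  case False
  have "x j = undefined" if "x \<in> space (gauss I)" for x
    using that False unfolding space_PiM by (rule PiE_arb)
  then have "(\<lambda>x. x j) \<in> borel_measurable (gauss I)
      \<longleftrightarrow> (\<lambda>x. undefined :: real) \<in> borel_measurable (gauss I)"
    by (rule measurable_cong)
  then show ?thesis by simp
qed

lemma nn_integral_normal_density:
  "\<sigma> > 0 \<Longrightarrow> (\<integral>\<^sup>+x. ennreal (normal_density \<mu> \<sigma> x) \<partial>lborel) = 1"
  using prob_space.emeasure_space_1[OF prob_space_normal_density[of \<sigma> \<mu>]]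
  by (simp add: emeasure_density)

lemma gauss_exp_linear:
  "(\<integral>\<^sup>+x. ennreal (exp (s * x)) \<partial>N1) = ennreal (exp (s\<^sup>2 / 2))"
proof -
  have "(\<integral>\<^sup>+x. ennreal (exp (s * x)) \<partial>N1)
      = (\<integral>\<^sup>+x. ennreal (std_normal_density x) * ennreal (exp (s * x)) \<partial>lborel)"
    by (simp add: nn_integral_density)
  also have "\<dots> = (\<integral>\<^sup>+x. ennreal (exp (s\<^sup>2 / 2)) * ennreal (normal_density s 1 x) \<partial>lborel)"
  proof (rule nn_integral_cong)
    fix x :: real
    have "- x\<^sup>2 / 2 + s * x = s\<^sup>2 / 2 + - (x - s)\<^sup>2 / 2"
      by (simp add: power2_eq_square algebra_simps add_divide_distrib diff_divide_distrib)
    then have "exp (- x\<^sup>2 / 2) * exp (s * x) = exp (s\<^sup>2 / 2) * exp (- (x - s)\<^sup>2 / 2)"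
      by (simp add: exp_add[symmetric])
    then show "ennreal (std_normal_density x) * ennreal (exp (s * x))
        = ennreal (exp (s\<^sup>2 / 2)) * ennreal (normal_density s 1 x)"
      by (simp add: normal_density_def ennreal_mult'[symmetric] mult.assoc)
  qed
  also have "\<dots> = ennreal (exp (s\<^sup>2 / 2))"
    by (simp add: nn_integral_cmult nn_integral_normal_density)
  finally show ?thesis .
qed

text \<open>The weight turns the standard density into \<open>sqrt 2\<close> times the density of
  variance 2. The exponent 1/4 chosen here fixes the rate in the tail bounds below.\<close>

lemma gauss_exp_square:
  "(\<integral>\<^sup>+x. ennreal (exp (x\<^sup>2 / 4)) \<partial>N1) = ennreal (sqrt 2)"
proof -
  have "(\<integral>\<^sup>+x. ennreal (exp (x\<^sup>2 / 4)) \<partial>N1)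
      = (\<integral>\<^sup>+x. ennreal (std_normal_density x) * ennreal (exp (x\<^sup>2 / 4)) \<partial>lborel)"
    by (simp add: nn_integral_density)
  also have "\<dots> = (\<integral>\<^sup>+x. ennreal (sqrt 2) * ennreal (normal_density 0 (sqrt 2) x) \<partial>lborel)"
  proof (rule nn_integral_cong)
    fix x :: real
    have "exp (- x\<^sup>2 / 2) * exp (x\<^sup>2 / 4) = exp (- x\<^sup>2 / 4)"
      by (simp add: exp_add[symmetric])
    moreover have "sqrt (4 * pi) = sqrt 2 * sqrt (2 * pi)"
      by (subst real_sqrt_mult[symmetric]) simp
    ultimately show "ennreal (std_normal_density x) * ennreal (exp (x\<^sup>2 / 4))
        = ennreal (sqrt 2) * ennreal (normal_density 0 (sqrt 2) x)"
      by (simp add: normal_density_def ennreal_mult'[symmetric])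
  qed
  also have "\<dots> = ennreal (sqrt 2)"
    by (simp add: nn_integral_cmult nn_integral_normal_density)
  finally show ?thesis .
qed

lemma nn_integral_gauss_exp_sum:
  assumes I: "finite I" and J: "J \<subseteq> I" and [measurable]: "\<And>j. h j \<in> borel_measurable borel"
  shows "(\<integral>\<^sup>+x. ennreal (exp (\<Sum>j\<in>J. h j (x j))) \<partial>gauss I)
    = (\<Prod>j\<in>J. \<integral>\<^sup>+y. ennreal (exp (h j y)) \<partial>N1)"
proof -
  interpret product_sigma_finite "\<lambda>_::'a. N1" by (rule product_sigma_finite_N1)
  interpret N: prob_space N1 by (rule prob_space_N1)
  define f where "f j y = (if j \<in> J then ennreal (exp (h j y)) else 1)" for j y
  have [measurable]: "f j \<in> borel_measurable N1" for j
    unfolding f_def by (cases "j \<in> J") auto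
  have "ennreal (exp (\<Sum>j\<in>J. h j (x j))) = (\<Prod>j\<in>I. f j (x j))" for x
  proof -
    have "ennreal (exp (\<Sum>j\<in>J. h j (x j))) = (\<Prod>j\<in>J. ennreal (exp (h j (x j))))"
      using finite_subset[OF J I] by (simp add: exp_sum prod_ennreal)
    also have "\<dots> = (\<Prod>j\<in>I. f j (x j))"
      by (rule prod.mono_neutral_cong_left) (use I J in \<open>auto simp: f_def\<close>)
    finally show ?thesis .
  qed
  then have "(\<integral>\<^sup>+x. ennreal (exp (\<Sum>j\<in>J. h j (x j))) \<partial>gauss I) = (\<Prod>j\<in>I. integral\<^sup>N N1 (f j))"
    by (simp add: product_nn_integral_prod[OF I])
  also have "\<dots> = (\<Prod>j\<in>J. \<integral>\<^sup>+y. ennreal (exp (h j y)) \<partial>N1)"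
  proof (rule prod.mono_neutral_cong_right[OF I J])
    show "\<forall>i\<in>I - J. integral\<^sup>N N1 (f i) = 1"
      using N.emeasure_space_1 by (simp add: f_def[abs_def])
    show "integral\<^sup>N N1 (f j) = (\<integral>\<^sup>+y. ennreal (exp (h j y)) \<partial>N1)" if "j \<in> J" for j
      using that by (simp add: f_def[abs_def])
  qed
  finally show ?thesis .
qed

lemma gauss_exp_linear_form:
  assumes "finite I" "J \<subseteq> I"
  shows "(\<integral>\<^sup>+x. ennreal (exp (\<Sum>j\<in>J. s j * x j)) \<partial>gauss I) = ennreal (exp (\<Sum>j\<in>J. (s j)\<^sup>2 / 2))"
proof -
  have "(\<integral>\<^sup>+x. ennreal (exp (\<Sum>j\<in>J. s j * x j)) \<partial>gauss I)
      = (\<Prod>j\<in>J. \<integral>\<^sup>+y. ennreal (exp (s j * y)) \<partial>N1)"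
    by (rule nn_integral_gauss_exp_sum[OF assms]) measurable
  also have "\<dots> = (\<Prod>j\<in>J. ennreal (exp ((s j)\<^sup>2 / 2)))" by (simp only: gauss_exp_linear)
  also have "\<dots> = ennreal (exp (\<Sum>j\<in>J. (s j)\<^sup>2 / 2))"
    using finite_subset[OF assms(2,1)] by (simp add: prod_ennreal exp_sum)
  finally show ?thesis .
qed

lemma gauss_exp_sum_squares:
  assumes "finite I" "J \<subseteq> I"
  shows "(\<integral>\<^sup>+x. ennreal (exp (\<Sum>j\<in>J. (x j)\<^sup>2 / 4)) \<partial>gauss I) = ennreal (sqrt 2 ^ card J)"
  using assms by (simp add: nn_integral_gauss_exp_sum[where h = "\<lambda>_ y. y\<^sup>2 / 4"] gauss_exp_square ennreal_power)

text \<open>Writing \<open>exp (y\<^sup>2 / 4)\<close> as a Gaussian average of \<open>exp (y * z / sqrt 2)\<close> reduces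
  the exponential moment of a sum of squared linear forms to that of a single linear form.\<close>

lemma gauss_exp_squared_forms:
  assumes I: "finite I" and B: "finite B" and K: "finite K"
    and inj: "inj_on \<beta> (B \<times> K)" and sub: "\<beta> ` (B \<times> K) \<subseteq> I"
    and c: "(\<Sum>k\<in>K. (c k)\<^sup>2) \<le> 1"
  shows "(\<integral>\<^sup>+x. ennreal (exp (\<Sum>b\<in>B. (\<Sum>k\<in>K. c k * x (\<beta> (b, k)))\<^sup>2 / 4)) \<partial>gauss I)
    \<le> ennreal (sqrt 2 ^ card B)"
proof -
  interpret GI: prob_space "gauss I" by (rule prob_space_gauss)
  interpret GB: prob_space "gauss B" by (rule prob_space_gauss)
  interpret P: pair_sigma_finite "gauss B" "gauss I" ..
  define y where "y x b = (\<Sum>k\<in>K. c k * x (\<beta> (b, k)))" for x b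
  define F where "F z x = ennreal (exp (\<Sum>b\<in>B. (y x b / sqrt 2) * z b))" for z x
  have "(\<integral>\<^sup>+x. ennreal (exp (\<Sum>b\<in>B. (y x b)\<^sup>2 / 4)) \<partial>gauss I) = (\<integral>\<^sup>+x. (\<integral>\<^sup>+z. F z x \<partial>gauss B) \<partial>gauss I)"
    unfolding F_def by (subst gauss_exp_linear_form) (auto simp: B power_divide)
  also have "\<dots> = (\<integral>\<^sup>+z. (\<integral>\<^sup>+x. F z x \<partial>gauss I) \<partial>gauss B)"
    unfolding F_def y_def by (rule P.Fubini') measurable
  also have "\<dots> \<le> (\<integral>\<^sup>+z. ennreal (exp (\<Sum>b\<in>B. (z b)\<^sup>2 / 4)) \<partial>gauss B)"
  proof (rule nn_integral_mono)
    fix z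
    define s where "s j = (case inv_into (B \<times> K) \<beta> j of (b, k) \<Rightarrow> c k * z b / sqrt 2)" for j
    have s: "s (\<beta> (b, k)) = c k * z b / sqrt 2" if "b \<in> B" "k \<in> K" for b k
      unfolding s_def using that inj by (subst inv_into_f_f) auto
    have "(\<Sum>b\<in>B. (y x b / sqrt 2) * z b) = (\<Sum>j\<in>\<beta> ` (B \<times> K). s j * x j)" for x
    proof -
      have "(\<Sum>b\<in>B. (y x b / sqrt 2) * z b) = (\<Sum>b\<in>B. \<Sum>k\<in>K. (c k * z b / sqrt 2) * x (\<beta> (b, k)))"
        unfolding y_def sum_divide_distrib sum_distrib_right
        by (intro sum.cong refl) (simp add: field_simps)
      also have "\<dots> = (\<Sum>b\<in>B. \<Sum>k\<in>K. s (\<beta> (b, k)) * x (\<beta> (b, k)))"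
        by (intro sum.cong refl) (simp add: s)
      also have "\<dots> = (\<Sum>j\<in>\<beta> ` (B \<times> K). s j * x j)"
        by (subst sum.reindex[OF inj]) (simp add: sum.cartesian_product)
      finally show ?thesis .
    qed
    then have "(\<integral>\<^sup>+x. F z x \<partial>gauss I) = ennreal (exp (\<Sum>j\<in>\<beta> ` (B \<times> K). (s j)\<^sup>2 / 2))"
      unfolding F_def by (simp add: gauss_exp_linear_form[OF I sub])
    also have "(\<Sum>j\<in>\<beta> ` (B \<times> K). (s j)\<^sup>2 / 2) = (\<Sum>b\<in>B. \<Sum>k\<in>K. (s (\<beta> (b, k)))\<^sup>2 / 2)"
      by (subst sum.reindex[OF inj]) (simp add: sum.cartesian_product)
    also have "\<dots> = (\<Sum>b\<in>B. \<Sum>k\<in>K. (c k)\<^sup>2 * ((z b)\<^sup>2 / 4))"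
      by (intro sum.cong refl) (simp add: s power_divide power_mult_distrib)
    also have "\<dots> = (\<Sum>b\<in>B. (\<Sum>k\<in>K. (c k)\<^sup>2) * ((z b)\<^sup>2 / 4))"
      by (simp only: sum_distrib_right)
    also have "\<dots> \<le> (\<Sum>b\<in>B. (z b)\<^sup>2 / 4)"
      using c by (intro sum_mono) (simp add: mult_left_le_one_le sum_nonneg)
    finally show "(\<integral>\<^sup>+x. F z x \<partial>gauss I) \<le> ennreal (exp (\<Sum>b\<in>B. (z b)\<^sup>2 / 4))"
      by simp
  qed
  also have "\<dots> = ennreal (sqrt 2 ^ card B)"
    by (rule gauss_exp_sum_squares) (use B in auto)
  finally show ?thesis by (simp only: y_def)
qed

text \<open>Condition on the block addressed by \<open>\<alpha>\<close>: the inner sums divided by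
  \<open>sqrt (V x)\<close> are then linear forms in fresh coordinates with coefficient norm at most
  one, so \<open>gauss_exp_squared_forms\<close> applies. Markov's inequality is used for the
  self-normalized quotient, so the size of the first block does not enter the bound.\<close>

lemma gauss_cross_tail:
  assumes I: "finite I" and B: "finite B" and K: "finite K"
    and inj: "inj_on \<beta> (B \<times> K)" and sub: "\<beta> ` (B \<times> K) \<subseteq> I" "\<alpha> ` K \<subseteq> I"
    and disj: "\<alpha> ` K \<inter> \<beta> ` (B \<times> K) = {}"
  shows "emeasure (gauss I) {x \<in> space (gauss I).
      t * (\<Sum>k\<in>K. (x (\<alpha> k))\<^sup>2) < (\<Sum>b\<in>B. (\<Sum>k\<in>K. x (\<alpha> k) * x (\<beta> (b, k)))\<^sup>2)}
    \<le> ennreal (sqrt 2 ^ card B * exp (- t / 4))"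
proof -
  interpret product_sigma_finite "\<lambda>_::'a. N1" by (rule product_sigma_finite_N1)
  define V where "V x = (\<Sum>k\<in>K. (x (\<alpha> k))\<^sup>2)" for x :: "'a \<Rightarrow> real"
  define Y where "Y x = (\<Sum>b\<in>B. (\<Sum>k\<in>K. x (\<alpha> k) * x (\<beta> (b, k)))\<^sup>2)" for x :: "'a \<Rightarrow> real"
  define I1 where "I1 = \<alpha> ` K"
  define I2 where "I2 = I - I1"
  interpret G1: prob_space "gauss I1" by (rule prob_space_gauss)
  have [measurable]: "V \<in> borel_measurable (gauss I)" "Y \<in> borel_measurable (gauss I)"
    unfolding V_def Y_def by measurable
  have inner: "(\<integral>\<^sup>+y. ennreal (exp (Y (merge I1 I2 (x, y)) / (4 * V (merge I1 I2 (x, y))))) \<partial>gauss I2)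
      \<le> ennreal (sqrt 2 ^ card B)" for x
  proof -
    define c where "c k = x (\<alpha> k) / sqrt (V x)" for k
    have V: "V (merge I1 I2 (x, y)) = V x" for y
      unfolding V_def by (intro sum.cong) (auto simp: merge_def I1_def)
    have "V x \<ge> 0" unfolding V_def by (simp add: sum_nonneg)
    have Y: "Y (merge I1 I2 (x, y)) / (4 * V x) = (\<Sum>b\<in>B. (\<Sum>k\<in>K. c k * y (\<beta> (b, k)))\<^sup>2 / 4)" for y
    proof -
      have "Y (merge I1 I2 (x, y)) = (\<Sum>b\<in>B. (\<Sum>k\<in>K. x (\<alpha> k) * y (\<beta> (b, k)))\<^sup>2)"
        unfolding Y_def
      proof (intro sum.cong refl arg_cong[where f = "\<lambda>u. u\<^sup>2"])
        fix b k assume "b \<in> B" "k \<in> K"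
        then have "\<beta> (b, k) \<in> I2" "\<beta> (b, k) \<notin> I1" "\<alpha> k \<in> I1"
          using disj sub unfolding I1_def I2_def by auto
        then show "merge I1 I2 (x, y) (\<alpha> k) * merge I1 I2 (x, y) (\<beta> (b, k)) = x (\<alpha> k) * y (\<beta> (b, k))"
          by (simp add: merge_def)
      qed
      moreover have "(\<Sum>k\<in>K. c k * y (\<beta> (b, k)))\<^sup>2 / 4 = (\<Sum>k\<in>K. x (\<alpha> k) * y (\<beta> (b, k)))\<^sup>2 / (4 * V x)" for b
      proof -
        have "(\<Sum>k\<in>K. c k * y (\<beta> (b, k))) = (\<Sum>k\<in>K. x (\<alpha> k) * y (\<beta> (b, k))) / sqrt (V x)"
          unfolding c_def sum_divide_distrib by (intro sum.cong) auto
        then show ?thesis using \<open>V x \<ge> 0\<close> by (simp add: power_divide)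
      qed
      ultimately show ?thesis by (simp add: sum_divide_distrib mult.commute)
    qed
    \<comment> \<open>The quotient is 0 by convention when \<open>V x = 0\<close>, hence only an
      inequality with 1 afterwards.\<close>
    have "(\<Sum>k\<in>K. (c k)\<^sup>2) = V x / V x"
      using \<open>V x \<ge> 0\<close> by (simp add: c_def power_divide sum_divide_distrib[symmetric]) (simp add: V_def)
    then have "(\<Sum>k\<in>K. (c k)\<^sup>2) \<le> 1" by simp
    moreover have "finite I2" using I by (simp add: I2_def)
    moreover have "\<beta> ` (B \<times> K) \<subseteq> I2" using sub disj by (auto simp: I2_def I1_def)
    ultimately show ?thesis
      unfolding V Y by (intro gauss_exp_squared_forms B K inj)
  qed
  have "(\<integral>\<^sup>+x. ennreal (exp (Y x / (4 * V x))) \<partial>gauss I)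
      = (\<integral>\<^sup>+x. (\<integral>\<^sup>+y. ennreal (exp (Y (merge I1 I2 (x, y)) / (4 * V (merge I1 I2 (x, y))))) \<partial>gauss I2) \<partial>gauss I1)"
  proof -
    have e: "I = I1 \<union> I2" "I1 \<inter> I2 = {}" "finite I1" "finite I2"
      using sub I K by (auto simp: I1_def I2_def)
    have [measurable]: "(\<lambda>x. ennreal (exp (Y x / (4 * V x)))) \<in> borel_measurable (gauss (I1 \<union> I2))"
      unfolding e(1)[symmetric] by measurable
    show ?thesis
      by (subst e(1)) (rule product_nn_integral_fold[OF e(2-4)], measurable)
  qed
  also have "\<dots> \<le> (\<integral>\<^sup>+x. ennreal (sqrt 2 ^ card B) \<partial>gauss I1)"
    by (intro nn_integral_mono inner)
  also have "\<dots> = ennreal (sqrt 2 ^ card B)" by (simp add: G1.emeasure_space_1)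
  finally have E: "(\<integral>\<^sup>+x. ennreal (exp (Y x / (4 * V x))) \<partial>gauss I) \<le> ennreal (sqrt 2 ^ card B)" .
  have "emeasure (gauss I) {x \<in> space (gauss I). t * V x < Y x}
      = (\<integral>\<^sup>+x. indicator {x \<in> space (gauss I). t * V x < Y x} x \<partial>gauss I)"
    by (rule nn_integral_indicator[symmetric]) measurable
  also have "\<dots> \<le> (\<integral>\<^sup>+x. ennreal (exp (- t / 4)) * ennreal (exp (Y x / (4 * V x))) \<partial>gauss I)"
  proof (rule nn_integral_mono)
    fix x
    show "indicator {x \<in> space (gauss I). t * V x < Y x} x
        \<le> ennreal (exp (- t / 4)) * ennreal (exp (Y x / (4 * V x)))"
    proof (cases "t * V x < Y x")
      case True
      have "V x \<noteq> 0"
      proof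
        assume "V x = 0"
        then have "\<forall>k\<in>K. x (\<alpha> k) = 0" using K by (simp add: V_def sum_nonneg_eq_0_iff)
        then have "Y x = 0" by (simp add: Y_def)
        with True \<open>V x = 0\<close> show False by simp
      qed
      moreover have "V x \<ge> 0" unfolding V_def by (simp add: sum_nonneg)
      ultimately have "V x > 0" by simp
      with True have "t / 4 \<le> Y x / (4 * V x)" by (simp add: field_simps)
      then have "1 \<le> exp (- t / 4) * exp (Y x / (4 * V x))" by (simp add: exp_add[symmetric])
      then have "1 \<le> ennreal (exp (- t / 4) * exp (Y x / (4 * V x)))"
        by (metis ennreal_1 ennreal_leI)
      then show ?thesis by (simp add: ennreal_mult indicator_def)
    qed simp
  qed
  also have "\<dots> = ennreal (exp (- t / 4)) * (\<integral>\<^sup>+x. ennreal (exp (Y x / (4 * V x))) \<partial>gauss I)"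
    by (rule nn_integral_cmult) measurable
  also have "\<dots> \<le> ennreal (exp (- t / 4)) * ennreal (sqrt 2 ^ card B)"
    by (rule mult_left_mono[OF E]) simp
  finally show ?thesis
    by (simp add: V_def Y_def ennreal_mult mult.commute)
qed

lemma gauss_square_tail:
  assumes I: "finite I" and J: "J \<subseteq> I"
  shows "emeasure (gauss I) {x \<in> space (gauss I). t < (\<Sum>j\<in>J. (x j)\<^sup>2)}
    \<le> ennreal (sqrt 2 ^ card J * exp (- t / 4))"
proof -
  define Y where "Y x = (\<Sum>j\<in>J. (x j)\<^sup>2 / 4)" for x :: "'a \<Rightarrow> real"
  have [measurable]: "Y \<in> borel_measurable (gauss I)"
    unfolding Y_def by measurable
  have e: "t < (\<Sum>j\<in>J. (x j)\<^sup>2) \<longleftrightarrow> t / 4 < Y x" for x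
    by (simp add: Y_def sum_divide_distrib[symmetric])
  have "emeasure (gauss I) {x \<in> space (gauss I). t / 4 < Y x}
      = (\<integral>\<^sup>+x. indicator {x \<in> space (gauss I). t / 4 < Y x} x \<partial>gauss I)"
    by (rule nn_integral_indicator[symmetric]) measurable
  also have "\<dots> \<le> (\<integral>\<^sup>+x. ennreal (exp (- t / 4)) * ennreal (exp (Y x)) \<partial>gauss I)"
  proof (rule nn_integral_mono)
    fix x
    show "indicator {x \<in> space (gauss I). t / 4 < Y x} x \<le> ennreal (exp (- t / 4)) * ennreal (exp (Y x))"
    proof (cases "t / 4 < Y x")
      case True
      then have "1 \<le> exp (- t / 4) * exp (Y x)" by (simp add: exp_add[symmetric])
      then have "1 \<le> ennreal (exp (- t / 4) * exp (Y x))"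
        by (metis ennreal_1 ennreal_leI)
      then show ?thesis by (simp add: ennreal_mult indicator_def)
    qed simp
  qed
  also have "\<dots> = ennreal (exp (- t / 4)) * (\<integral>\<^sup>+x. ennreal (exp (Y x)) \<partial>gauss I)"
    by (rule nn_integral_cmult) measurable
  also have "\<dots> = ennreal (sqrt 2 ^ card J * exp (- t / 4))"
    by (simp add: Y_def gauss_exp_sum_squares[OF I J] ennreal_mult mult.commute)
  finally show ?thesis by (simp only: e)
qed

section \<open>Invariance of the Gaussian measure under sign flips\<close>

lemma N1_uminus:
  assumes [measurable]: "A \<in> sets borel"
  shows "emeasure N1 (uminus -` A) = emeasure N1 A"
proof -
  have m: "uminus -` A \<in> sets lborel"
    using measurable_sets[of uminus borel borel A] by simp
  have "emeasure N1 (uminus -` A) = (\<integral>\<^sup>+x. ennreal (std_normal_density x) * indicator (uminus -` A) x \<partial>lborel)"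
    using m by (simp add: emeasure_density)
  also have "\<dots> = (\<integral>\<^sup>+x. ennreal (std_normal_density (- x)) * indicator A (- x) \<partial>lborel)"
    by (intro nn_integral_cong) (simp add: normal_density_def indicator_def)
  also have "\<dots> = (\<integral>\<^sup>+x. ennreal (std_normal_density x) * indicator A x \<partial>distr lborel borel uminus)"
    by (subst nn_integral_distr) auto
  also have "\<dots> = emeasure N1 A"
    by (simp add: lborel_distr_uminus emeasure_density)
  finally show ?thesis .
qed

lemma measurable_gauss_flip:
  assumes "T \<subseteq> I"
  shows "(\<lambda>x i. if i \<in> T then - x i else x i) \<in> gauss I \<rightarrow>\<^sub>M gauss I"
proof (rule measurable_PiM_single')
  fix i assume "i \<in> I"
  have "(\<lambda>x. if i \<in> T then - x i else x i) \<in> borel_measurable (gauss I)" by measurable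
  then show "(\<lambda>x. if i \<in> T then - x i else x i) \<in> gauss I \<rightarrow>\<^sub>M N1" by simp
next
  show "(\<lambda>x i. if i \<in> T then - x i else x i) \<in> space (gauss I) \<rightarrow> (\<Pi>\<^sub>E i\<in>I. space N1)"
    using assms by (auto simp: space_PiM PiE_def extensional_def)
qed

lemma distr_gauss_flip:
  assumes I: "finite I" and T: "T \<subseteq> I"
  shows "distr (gauss I) (gauss I) (\<lambda>x i. if i \<in> T then - x i else x i) = gauss I"
proof -
  interpret product_sigma_finite "\<lambda>_::'a. N1" by (rule product_sigma_finite_N1)
  let ?f = "\<lambda>(x :: 'a \<Rightarrow> real) i. if i \<in> T then - x i else x i"
  have f: "?f \<in> gauss I \<rightarrow>\<^sub>M gauss I" by (rule measurable_gauss_flip[OF T])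
  show ?thesis
  proof (rule PiM_eqI[OF I])
    fix A assume A: "\<And>i. i \<in> I \<Longrightarrow> A i \<in> sets N1"
    define A' where "A' i = (if i \<in> T then uminus -` A i else A i)" for i
    have A': "A' i \<in> sets N1" if "i \<in> I" for i
      using A[OF that] measurable_sets[of uminus borel borel "A i"] by (auto simp: A'_def)
    have "?f -` Pi\<^sub>E I A \<inter> space (gauss I) = Pi\<^sub>E I A'"
      using T by (auto simp: space_PiM PiE_def extensional_def A'_def Pi_def split: if_splits)
    then have "emeasure (distr (gauss I) (gauss I) ?f) (Pi\<^sub>E I A) = emeasure (gauss I) (Pi\<^sub>E I A')"
      using A by (subst emeasure_distr[OF f]) (auto intro!: sets_PiM_I_finite I)
    also have "\<dots> = (\<Prod>i\<in>I. emeasure N1 (A' i))"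
      by (rule emeasure_PiM[OF I A'])
    also have "\<dots> = (\<Prod>i\<in>I. emeasure N1 (A i))"
      using A by (intro prod.cong) (auto simp: A'_def N1_uminus)
    finally show "emeasure (distr (gauss I) (gauss I) ?f) (Pi\<^sub>E I A) = (\<Prod>i\<in>I. emeasure N1 (A i))" .
  qed simp
qed

lemma nn_integral_gauss_flip:
  assumes I: "finite I" and T: "T \<subseteq> I" and f: "f \<in> borel_measurable (gauss I)"
  shows "(\<integral>\<^sup>+x. f (\<lambda>i. if i \<in> T then - x i else x i) \<partial>gauss I) = (\<integral>\<^sup>+x. f x \<partial>gauss I)"
  using nn_integral_distr[OF measurable_gauss_flip[OF T], of f] f
  by (simp add: distr_gauss_flip[OF I T])

section \<open>Pseudo-expectations on the sphere\<close>

text \<open>Multisets form a commutative additive monoid, so finitely supported maps on them are a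
  commutative ring, in which polynomial identities follow by ring normalization. The link to the
  coefficient functions of the definitions is \<open>pe_mult_polys\<close>.\<close>

type_synonym rpoly = "nat multiset \<Rightarrow>\<^sub>0 real"

abbreviation coef :: "rpoly \<Rightarrow> nat multiset \<Rightarrow> real" where "coef \<equiv> Poly_Mapping.lookup"

definition pe :: "(nat multiset \<Rightarrow> real) \<Rightarrow> rpoly \<Rightarrow> real" where
  "pe L p = (\<Sum>m\<in>Poly_Mapping.keys p. coef p m * L m)"

definition polys :: "nat \<Rightarrow> nat \<Rightarrow> rpoly set" where
  "polys n d = {p. Poly_Mapping.keys p \<subseteq> monoms n d}"

abbreviation xvar :: "nat \<Rightarrow> rpoly" where "xvar i \<equiv> Poly_Mapping.single {#i#} 1"
abbreviation Co :: "real \<Rightarrow> rpoly" where "Co c \<equiv> Poly_Mapping.single 0 c"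

lemma pe_eq:
  assumes "finite S" "Poly_Mapping.keys p \<subseteq> S"
  shows "pe L p = (\<Sum>m\<in>S. coef p m * L m)"
  unfolding pe_def by (rule sum.mono_neutral_left) (use assms in \<open>auto simp: in_keys_iff\<close>)

lemma pe_add: "pe L (p + q) = pe L p + pe L q"
proof -
  let ?S = "Poly_Mapping.keys p \<union> Poly_Mapping.keys q"
  have "pe L r = (\<Sum>m\<in>?S. coef r m * L m)" if "r \<in> {p, q, p + q}" for r
    using that keys_add[of p q] by (intro pe_eq) auto
  then show ?thesis by (simp add: lookup_add sum.distrib distrib_right)
qed

lemma pe_0 [simp]: "pe L 0 = 0" by (simp add: pe_def)

lemma pe_uminus: "pe L (- p) = - pe L p"
  using pe_add[of L p "- p"] by simp

lemma pe_diff: "pe L (p - q) = pe L p - pe L q"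
  using pe_add[of L p "- q"] by (simp add: pe_uminus)

lemma pe_sum: "pe L (sum f A) = (\<Sum>x\<in>A. pe L (f x))"
  by (induction A rule: infinite_finite_induct) (auto simp: pe_add)

lemma pe_single: "pe L (Poly_Mapping.single m c) = c * L m"
  by (subst pe_eq[of "{m}"]) auto

lemma poly_expand:
  assumes "finite S" "Poly_Mapping.keys p \<subseteq> S"
  shows "p = (\<Sum>m\<in>S. Poly_Mapping.single m (coef p m))"
proof (rule poly_mapping_eqI)
  fix k
  have "coef (\<Sum>m\<in>S. Poly_Mapping.single m (coef p m)) k = (\<Sum>m\<in>S. if m = k then coef p k else 0)"
    unfolding lookup_sum by (rule sum.cong) (auto simp: lookup_single when_def)
  also have "\<dots> = coef p k"
    using assms by (auto simp: in_keys_iff)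
  finally show "coef p k = coef (\<Sum>m\<in>S. Poly_Mapping.single m (coef p m)) k" ..
qed

lemma pe_mult:
  assumes "finite S" "Poly_Mapping.keys p \<subseteq> S" "finite T" "Poly_Mapping.keys q \<subseteq> T"
  shows "pe L (p * q) = (\<Sum>a\<in>S. \<Sum>b\<in>T. coef p a * coef q b * L (a + b))"
proof -
  have "p * q = (\<Sum>a\<in>S. \<Sum>b\<in>T. Poly_Mapping.single (a + b) (coef p a * coef q b))"
    by (subst poly_expand[OF assms(1,2)], subst poly_expand[OF assms(3,4)])
       (simp only: sum_product mult_single)
  then show ?thesis by (simp only: pe_sum pe_single)
qed

lemma pe_Co_mult: "pe L (Co c * p) = c * pe L p"
proof -
  have "pe L (Co c * p) = (\<Sum>a\<in>{0}. \<Sum>b\<in>Poly_Mapping.keys p. coef (Co c) a * coef p b * L (a + b))"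
    by (rule pe_mult) auto
  then show ?thesis by (simp add: pe_def sum_distrib_left mult.assoc)
qed

lemma finite_monoms [simp]: "finite (monoms n d)"
proof (rule finite_subset)
  show "monoms n d \<subseteq> mset ` {xs. set xs \<subseteq> {..<n} \<and> length xs \<le> d}"
  proof
    fix m assume "m \<in> monoms n d"
    moreover obtain xs where "mset xs = m" using ex_mset by blast
    ultimately show "m \<in> mset ` {xs. set xs \<subseteq> {..<n} \<and> length xs \<le> d}"
      by (intro image_eqI[of _ _ xs]) (auto simp: monoms_def)
  qed
qed (simp add: finite_lists_length_le)

lemma monoms_add: "a \<in> monoms n d \<Longrightarrow> b \<in> monoms n e \<Longrightarrow> a + b \<in> monoms n (d + e)"
  by (auto simp: monoms_def)

lemma polys_add: "p \<in> polys n d \<Longrightarrow> q \<in> polys n d \<Longrightarrow> p + q \<in> polys n d"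
  using keys_add[of p q] by (auto simp: polys_def)

lemma polys_0: "0 \<in> polys n d" by (simp add: polys_def)

lemma polys_uminus: "p \<in> polys n d \<Longrightarrow> - p \<in> polys n d"
  by (auto simp: polys_def in_keys_iff)

lemma polys_diff: "p \<in> polys n d \<Longrightarrow> q \<in> polys n d \<Longrightarrow> p - q \<in> polys n d"
  using polys_add[of p n d "- q"] polys_uminus by simp

lemma polys_sum: "(\<And>x. x \<in> A \<Longrightarrow> f x \<in> polys n d) \<Longrightarrow> sum f A \<in> polys n d"
  by (induction A rule: infinite_finite_induct) (auto simp: polys_0 polys_add)

lemma polys_mult: "p \<in> polys n d \<Longrightarrow> q \<in> polys n e \<Longrightarrow> p * q \<in> polys n (d + e)"
  using keys_mult[of p q] monoms_add unfolding polys_def by blast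

lemma polys_mono: "p \<in> polys n d \<Longrightarrow> d \<le> e \<Longrightarrow> p \<in> polys n e"
  unfolding polys_def monoms_def by auto

lemma polys_Co: "Co c \<in> polys n d"
  by (auto simp: polys_def monoms_def)

lemma polys_X: "i < n \<Longrightarrow> xvar i \<in> polys n 1"
  by (auto simp: polys_def monoms_def)

lemma pe_apply_poly_mult:
  "pe_apply n (d + e) L (poly_mult n d e p q) = (\<Sum>a\<in>monoms n d. \<Sum>b\<in>monoms n e. p a * q b * L (a + b))"
proof -
  have "pe_apply n (d + e) L (poly_mult n d e p q)
      = (\<Sum>m\<in>monoms n (d + e). \<Sum>a\<in>monoms n d. \<Sum>b\<in>monoms n e. if a + b = m then p a * q b * L m else 0)"
    unfolding pe_apply_def poly_mult_def sum_distrib_right by (intro sum.cong refl) simp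
  also have "\<dots> = (\<Sum>a\<in>monoms n d. \<Sum>m\<in>monoms n (d + e). \<Sum>b\<in>monoms n e. if a + b = m then p a * q b * L m else 0)"
    by (rule sum.swap)
  also have "\<dots> = (\<Sum>a\<in>monoms n d. \<Sum>b\<in>monoms n e. \<Sum>m\<in>monoms n (d + e). if a + b = m then p a * q b * L m else 0)"
    by (rule sum.cong[OF refl], rule sum.swap)
  also have "\<dots> = (\<Sum>a\<in>monoms n d. \<Sum>b\<in>monoms n e. p a * q b * L (a + b))"
    by (intro sum.cong refl) (simp add: monoms_add)
  finally show ?thesis .
qed

lemma pe_mult_polys:
  assumes "p \<in> polys n d" "q \<in> polys n e"
  shows "pe L (p * q) = pe_apply n (d + e) L (poly_mult n d e (coef p) (coef q))"
  using assms unfolding pe_apply_poly_mult polys_def by (intro pe_mult) auto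

lemma pe_square_nonneg:
  assumes "sphere_pe4 n L" "p \<in> polys n 2"
  shows "pe L (p * p) \<ge> 0"
proof -
  have "supported n 2 (coef p)"
    using assms(2) by (auto simp: supported_def polys_def in_keys_iff)
  then show ?thesis
    using assms pe_mult_polys[of p n 2 p 2 L]
    by (simp add: sphere_pe4_def pseudo_expectation_def)
qed

section \<open>The sphere constraint and linear forms\<close>

definition normsq :: "nat \<Rightarrow> rpoly" where
  "normsq n = (\<Sum>i<n. xvar i * xvar i)"

lemma X_mult: "xvar i * xvar j = Poly_Mapping.single {#i, j#} 1"
  by (simp add: mult_single add_mset_commute)

lemma lookup_sphere: "coef (normsq n - 1) = sphere_poly n"
proof
  fix m
  have inj: "{#i, i#} = {#j, j#} \<longleftrightarrow> i = j" for i j :: nat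
    by (auto dest: arg_cong[where f = set_mset])
  have "coef (normsq n) m = (\<Sum>i<n. if m = {#i, i#} then 1 else 0)"
    unfolding normsq_def lookup_sum X_mult by (rule sum.cong) (auto simp: lookup_single when_def)
  also have "\<dots> = (if \<exists>i<n. m = {#i, i#} then 1 else 0)"
  proof (cases "\<exists>i<n. m = {#i, i#}")
    case True
    then obtain i where i: "i < n" "m = {#i, i#}" by blast
    have "(\<Sum>j<n. if m = {#j, j#} then 1 else 0) = (\<Sum>j<n. if j = i then 1 else (0 :: real))"
      by (rule sum.cong) (auto simp: i(2) inj)
    with True i show ?thesis by simp
  qed auto
  finally show "coef (normsq n - 1) m = sphere_poly n m"
    by (auto simp: lookup_minus lookup_one sphere_poly_def when_def)
qed

lemma polys_normsq: "normsq n \<in> polys n 2"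
  unfolding normsq_def using polys_mult[OF polys_X polys_X] by (intro polys_sum) (auto simp: numeral_2_eq_2)

lemma polys_1: "1 \<in> polys n d"
  using polys_Co[of 1] by simp

lemma pe_sphere:
  assumes "sphere_pe4 n L" "q \<in> polys n 2"
  shows "pe L (normsq n * q) = pe L q"
proof -
  have "supported n 2 (coef q)"
    using assms(2) by (auto simp: supported_def polys_def in_keys_iff)
  moreover have "pe L ((normsq n - 1) * q) = pe_apply n (2 + 2) L (poly_mult n 2 2 (coef (normsq n - 1)) (coef q))"
    by (rule pe_mult_polys) (auto intro: polys_diff polys_normsq polys_1 assms)
  ultimately have "pe L ((normsq n - 1) * q) = 0"
    using assms(1) by (simp add: sphere_pe4_def satisfies_def lookup_sphere)
  then show ?thesis by (simp add: left_diff_distrib pe_diff)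
qed

lemma pe_one: "sphere_pe4 n L \<Longrightarrow> pe L 1 = 1"
  using pe_single[of L 0 1] by (simp add: sphere_pe4_def pseudo_expectation_def)

lemma pe_normsq: "sphere_pe4 n L \<Longrightarrow> pe L (normsq n) = 1"
  using pe_sphere[of n L 1] by (simp add: pe_one polys_1)

lemma pe_normsq_sq: "sphere_pe4 n L \<Longrightarrow> pe L (normsq n * normsq n) = 1"
  using pe_sphere[of n L "normsq n"] by (simp add: pe_normsq polys_normsq)

definition linform :: "nat \<Rightarrow> (nat \<Rightarrow> real) \<Rightarrow> rpoly" where
  "linform n v = (\<Sum>i<n. Co (v i) * xvar i)"

lemma polys_Co_mult: "p \<in> polys n d \<Longrightarrow> Co c * p \<in> polys n d"
  using polys_mult[OF polys_Co[of c n 0]] by simp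

lemma polys_linform: "linform n v \<in> polys n 1"
  unfolding linform_def by (intro polys_sum polys_Co_mult polys_X) simp

lemma pe_linform: "pe L (linform n v) = vinner n (pe_vec L) v"
  unfolding linform_def pe_sum pe_Co_mult vinner_def pe_vec_def
  by (simp add: pe_single mult.commute)

lemma Co_mult: "Co a * Co b = Co (a * b)" by (simp add: mult_single)
lemma Co_sum: "(\<Sum>i\<in>A. Co (f i)) = Co (sum f A)"
  by (induction A rule: infinite_finite_induct) (auto simp: single_add)

text \<open>On \<open>[-1, 1]\<close> one has \<open>1 - t\<^sup>3 \<ge> 3/4 * (1 - t)\<close>; with \<open>w = 2 * t + 1\<close> the difference
  is \<open>(1 - t) * w\<^sup>2 / 4\<close>, and \<open>2 * (1 - t) = (1 - t)\<^sup>2 + (1 - t\<^sup>2)\<close> makes it a sum of squares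
  modulo the sphere constraint.\<close>

lemma pe_cube_linform:
  assumes L: "sphere_pe4 n L" and v: "vnorm n v = 1"
  defines "t \<equiv> linform n v"
  shows "3 * (1 - pe L t) \<le> 4 * (1 - pe L (t * t * t))"
proof -
  define N where "N = normsq n"
  define w where "w = t + t + 1"
  \<comment> \<open>The component of \<open>x\<close> orthogonal to \<open>v\<close>. Its squares
    add up to \<open>N - t * t\<close>, which exhibits \<open>1 - t\<^sup>2\<close> as a sum of
    squares modulo \<open>N = 1\<close>.\<close>
  define u where "u i = xvar i - Co (v i) * t" for i
  have t: "t \<in> polys n 1" unfolding t_def by (rule polys_linform)
  have w: "w \<in> polys n 1" unfolding w_def by (intro polys_add t polys_1)
  have u: "u i \<in> polys n 1" if "i < n" for i
    unfolding u_def using that by (intro polys_diff polys_X polys_Co_mult t)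
  have vv: "(\<Sum>i<n. v i * v i) = 1"
    using v by (simp add: vnorm_def power2_eq_square)
  have "(\<Sum>i<n. u i * u i) = (\<Sum>i<n. xvar i * xvar i - (Co (v i) * xvar i) * t - (Co (v i) * xvar i) * t + Co (v i * v i) * (t * t))"
    by (intro sum.cong refl) (simp add: u_def algebra_simps Co_mult[symmetric])
  also have "\<dots> = N - t * t - t * t + (\<Sum>i<n. Co (v i * v i)) * (t * t)"
    by (simp only: sum.distrib sum_subtractf sum_distrib_right[symmetric] N_def normsq_def t_def linform_def)
  also have "(\<Sum>i<n. Co (v i * v i)) = 1" by (simp add: Co_sum vv)
  finally have uu: "(\<Sum>i<n. u i * u i) = N - t * t" by simp
  have id: "8 * (1 - t * t * t) - 6 * (1 - t)
      = ((1 - t) * w) * ((1 - t) * w) + (\<Sum>i<n. (u i * w) * (u i * w)) + (w * w - N * (w * w))"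
  proof -
    have "(\<Sum>i<n. (u i * w) * (u i * w)) = (\<Sum>i<n. u i * u i) * (w * w)"
      unfolding sum_distrib_right by (intro sum.cong refl) (simp add: algebra_simps)
    then show ?thesis unfolding uu w_def by (simp add: algebra_simps)
  qed
  have "pe L (((1 - t) * w) * ((1 - t) * w)) \<ge> 0"
    using polys_mult[OF polys_diff[OF polys_1 t] w] by (intro pe_square_nonneg[OF L]) (simp add: numeral_2_eq_2)
  moreover have "pe L (\<Sum>i<n. (u i * w) * (u i * w)) \<ge> 0"
    unfolding pe_sum using polys_mult[OF u w] by (intro sum_nonneg pe_square_nonneg[OF L]) (auto simp: numeral_2_eq_2)
  moreover have "pe L (w * w - N * (w * w)) = 0"
    using pe_sphere[OF L, of "w * w"] polys_mult[OF w w] by (simp add: pe_diff N_def numeral_2_eq_2)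
  ultimately have "pe L (8 * (1 - t * t * t) - 6 * (1 - t)) \<ge> 0"
    unfolding id by (simp add: pe_add)
  moreover have "pe L (8 * (1 - t * t * t) - 6 * (1 - t)) = 8 * (1 - pe L (t * t * t)) - 6 * (1 - pe L t)"
  proof -
    have "(8 :: rpoly) = Co 8" "(6 :: rpoly) = Co 6" by simp_all
    then show ?thesis by (simp only: pe_diff pe_Co_mult pe_one[OF L])
  qed
  ultimately show ?thesis by simp
qed

lemma pe_linform_cube:
  "pe L (linform n v * linform n v * linform n v) = (\<Sum>i<n. \<Sum>j<n. \<Sum>k<n. v i * v j * v k * L {#i, j, k#})"
proof -
  have "linform n v * linform n v * linform n v
      = (\<Sum>i<n. \<Sum>j<n. \<Sum>k<n. Poly_Mapping.single {#i, j, k#} (v i * v j * v k))"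
    unfolding linform_def sum_product sum_distrib_left sum_distrib_right
    by (intro sum.cong refl) (simp add: mult_single add_mset_commute mult_ac)
  then show ?thesis by (simp only: pe_sum pe_single)
qed

text \<open>Each coordinate has nonnegative pseudo-variance, and the second moments add up to
  1.\<close>

lemma pe_vec_norm_le:
  assumes L: "sphere_pe4 n L"
  shows "(\<Sum>i<n. (pe_vec L i)\<^sup>2) \<le> 1"
proof -
  have "0 \<le> pe L ((xvar i - Co (pe_vec L i)) * (xvar i - Co (pe_vec L i)))" if "i < n" for i
    using that by (intro pe_square_nonneg[OF L] polys_diff polys_Co polys_mono[OF polys_X]) auto
  moreover have "pe L ((xvar i - Co (pe_vec L i)) * (xvar i - Co (pe_vec L i))) = pe L (xvar i * xvar i) - (pe_vec L i)\<^sup>2" for i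
  proof -
    have "(xvar i - Co (pe_vec L i)) * (xvar i - Co (pe_vec L i))
        = xvar i * xvar i - Co (pe_vec L i) * xvar i - Co (pe_vec L i) * xvar i + Co (pe_vec L i) * Co (pe_vec L i)"
      by (simp add: algebra_simps)
    then show ?thesis
      using L by (simp only: pe_add pe_diff pe_Co_mult pe_single)
        (simp add: pe_vec_def power2_eq_square sphere_pe4_def pseudo_expectation_def)
  qed
  ultimately have "(\<Sum>i<n. (pe_vec L i)\<^sup>2) \<le> (\<Sum>i<n. pe L (xvar i * xvar i))"
    by (intro sum_mono) simp
  also have "\<dots> = 1" using pe_normsq[OF L] by (simp add: normsq_def pe_sum)
  finally show ?thesis .
qed

text \<open>Point evaluation is multiplicative, so every product factors: a square becomes a real
  square, and the sphere polynomial contributes a factor 0.\<close>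

lemma sphere_pe4_point:
  assumes v: "vnorm n v = 1"
  shows "sphere_pe4 n (\<lambda>m. \<Prod>i\<in>#m. v i)"
proof -
  let ?L = "\<lambda>m. \<Prod>i\<in>#m. v i"
  have m: "pe_apply n (d + e) ?L (poly_mult n d e p q)
      = (\<Sum>a\<in>monoms n d. p a * ?L a) * (\<Sum>b\<in>monoms n e. q b * ?L b)" for d e p q
    unfolding pe_apply_poly_mult sum_product by (intro sum.cong refl) (simp add: mult_ac)
  have vv: "(\<Sum>i<n. v i * v i) = 1"
    using v by (simp add: vnorm_def power2_eq_square)
  have "(\<Sum>a\<in>monoms n 2. sphere_poly n a * ?L a) = pe ?L (normsq n - 1)"
    unfolding lookup_sphere[symmetric]
    using polys_diff[OF polys_normsq polys_1] by (intro pe_eq[symmetric]) (auto simp: polys_def)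
  also have "\<dots> = 0"
    using pe_single[of ?L 0 1] by (simp add: pe_diff normsq_def pe_sum X_mult pe_single vv)
  finally have "(\<Sum>a\<in>monoms n 2. sphere_poly n a * ?L a) = 0" .
  then show ?thesis
    using m[of 2 2] by (simp add: sphere_pe4_def pseudo_expectation_def satisfies_def)
qed

text \<open>The left side of \<open>R\<close> is the pseudo-expectation of
  \<open>\<Sum>\<^sub>i q\<^sub>i\<^sup>2\<close> written out in monomials. Cauchy--Schwarz is
  carried out by summing the squares of \<open>s * x\<^sub>i + q\<^sub>i\<close> over
  \<open>i\<close> and taking \<open>s = \<beta>\<close> and \<open>s = - \<beta>\<close>, one for
  each sign.\<close>

lemma pe_tensor_abs_le:
  assumes L: "sphere_pe4 n L" and \<beta>: "\<beta> > 0"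
    and R: "(\<Sum>i<n. \<Sum>a<n. \<Sum>b<n. \<Sum>c<n. \<Sum>d<n. A i a b * A i c d * L {#a, b, c, d#}) \<le> \<beta>\<^sup>2"
  shows "\<bar>pe_tensor n L A\<bar> \<le> \<beta>"
proof -
  define q where "q i = (\<Sum>a<n. \<Sum>b<n. Poly_Mapping.single {#a, b#} (A i a b))" for i
  have q: "q i \<in> polys n 2" for i
    unfolding q_def by (intro polys_sum) (auto simp: polys_def monoms_def)
  have "(\<Sum>i<n. pe L (q i * q i)) = (\<Sum>i<n. \<Sum>a<n. \<Sum>b<n. \<Sum>c<n. \<Sum>d<n. A i a b * A i c d * L {#a, b, c, d#})"
  proof (rule sum.cong[OF refl])
    fix i
    have "q i * q i = (\<Sum>a<n. \<Sum>b<n. \<Sum>c<n. \<Sum>d<n. Poly_Mapping.single {#a, b, c, d#} (A i a b * A i c d))"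
      unfolding q_def sum_distrib_left sum_distrib_right
      by (intro sum.cong refl) (simp add: mult_single add_mset_commute mult.commute)
    then show "pe L (q i * q i) = (\<Sum>a<n. \<Sum>b<n. \<Sum>c<n. \<Sum>d<n. A i a b * A i c d * L {#a, b, c, d#})"
      by (simp only: pe_sum pe_single)
  qed
  with R have qq: "(\<Sum>i<n. pe L (q i * q i)) \<le> \<beta>\<^sup>2" by simp
  have Xq: "(\<Sum>i<n. pe L (xvar i * q i)) = pe_tensor n L A"
    unfolding pe_tensor_def
  proof (rule sum.cong[OF refl])
    fix i
    have "xvar i * q i = (\<Sum>a<n. \<Sum>b<n. Poly_Mapping.single {#i, a, b#} (A i a b))"
      unfolding q_def sum_distrib_left by (intro sum.cong refl) (simp add: mult_single add_mset_commute)
    then show "pe L (xvar i * q i) = (\<Sum>j<n. \<Sum>k<n. A i j k * L {#i, j, k#})"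
      by (simp only: pe_sum pe_single)
  qed
  have XX: "(\<Sum>i<n. pe L (xvar i * xvar i)) = 1"
    using pe_normsq[OF L] by (simp add: normsq_def pe_sum)
  have sq: "0 \<le> s\<^sup>2 + 2 * s * pe_tensor n L A + \<beta>\<^sup>2" for s
  proof -
    have "0 \<le> (\<Sum>i<n. pe L ((Co s * xvar i + q i) * (Co s * xvar i + q i)))"
      by (intro sum_nonneg pe_square_nonneg[OF L] polys_add q polys_Co_mult polys_mono[OF polys_X]) auto
    also have "\<dots> = (\<Sum>i<n. s * (s * pe L (xvar i * xvar i)) + 2 * s * pe L (xvar i * q i) + pe L (q i * q i))"
    proof (rule sum.cong[OF refl])
      fix i
      have "(Co s * xvar i + q i) * (Co s * xvar i + q i)
          = Co s * (Co s * (xvar i * xvar i)) + Co s * (xvar i * q i) + Co s * (xvar i * q i) + q i * q i"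
        by (simp only: algebra_simps)
      then show "pe L ((Co s * xvar i + q i) * (Co s * xvar i + q i))
          = s * (s * pe L (xvar i * xvar i)) + 2 * s * pe L (xvar i * q i) + pe L (q i * q i)"
        by (simp only: pe_add pe_Co_mult)
    qed
    also have "\<dots> = s * (s * (\<Sum>i<n. pe L (xvar i * xvar i))) + 2 * s * (\<Sum>i<n. pe L (xvar i * q i)) + (\<Sum>i<n. pe L (q i * q i))"
      by (simp only: sum.distrib sum_distrib_left)
    also have "\<dots> \<le> s\<^sup>2 + 2 * s * pe_tensor n L A + \<beta>\<^sup>2"
      using qq by (simp only: XX Xq) (simp add: power2_eq_square)
    finally show ?thesis .
  qed
  from sq[of \<beta>] sq[of "- \<beta>"] have "0 \<le> 2 * \<beta> * (\<beta> + pe_tensor n L A)" "0 \<le> 2 * \<beta> * (\<beta> - pe_tensor n L A)"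
    by (simp_all add: power2_eq_square algebra_simps)
  with \<beta> have "0 \<le> \<beta> + pe_tensor n L A" "0 \<le> \<beta> - pe_tensor n L A"
    by (simp_all add: zero_le_mult_iff)
  then show ?thesis by simp
qed

text \<open>\<open>m\<close> may repeat a monomial: \<open>(a, b)\<close> and \<open>(b, a)\<close>
  label the same one, so ordered pairs can index the moment matrix.\<close>

lemma pe_psd:
  assumes L: "sphere_pe4 n L" and K: "finite K" and m: "\<And>k. k \<in> K \<Longrightarrow> m k \<in> monoms n 2"
  shows "0 \<le> (\<Sum>a\<in>K. \<Sum>b\<in>K. z a * z b * L (m a + m b))"
proof -
  define p where "p = (\<Sum>k\<in>K. Poly_Mapping.single (m k) (z k))"
  have "p \<in> polys n 2"
    unfolding p_def by (intro polys_sum) (use m in \<open>auto simp: polys_def\<close>)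
  then have "0 \<le> pe L (p * p)" by (rule pe_square_nonneg[OF L])
  also have "p * p = (\<Sum>a\<in>K. \<Sum>b\<in>K. Poly_Mapping.single (m a + m b) (z a * z b))"
    by (simp only: p_def sum_product mult_single)
  finally show ?thesis by (simp only: pe_sum pe_single)
qed

definition sqidx :: "nat \<Rightarrow> (nat \<times> nat) set" where
  "sqidx n = {..<n} \<times> {..<n}"

definition moment2 :: "(nat multiset \<Rightarrow> real) \<Rightarrow> nat \<times> nat \<Rightarrow> nat \<times> nat \<Rightarrow> real" where
  "moment2 L \<alpha> \<beta> = L ({#fst \<alpha>, snd \<alpha>#} + {#fst \<beta>, snd \<beta>#})"

text \<open>The trace is the pseudo-expectation of the fourth power of the norm, which the
  constraint makes 1.\<close>

lemma density_matrix_moment2: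
  assumes L: "sphere_pe4 n L"
  shows "density_matrix (sqidx n) (moment2 L)" "density_matrix.trQ (sqidx n) (moment2 L) = 1"
proof -
  show d: "density_matrix (sqidx n) (moment2 L)"
  proof
    show "finite (sqidx n)" by (simp add: sqidx_def)
    show "moment2 L a b = moment2 L b a" for a b by (simp add: moment2_def union_commute)
    show "0 \<le> (\<Sum>a\<in>sqidx n. \<Sum>b\<in>sqidx n. z a * z b * moment2 L a b)" for z
      unfolding moment2_def by (rule pe_psd[OF L]) (auto simp: sqidx_def monoms_def)
  qed
  have "normsq n * normsq n = (\<Sum>\<alpha>\<in>sqidx n. Poly_Mapping.single ({#fst \<alpha>, snd \<alpha>#} + {#fst \<alpha>, snd \<alpha>#}) 1)"
    unfolding normsq_def sum_product sqidx_def sum.cartesian_product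
    by (intro sum.cong refl) (auto simp: mult_single add_mset_commute)
  then have "pe L (normsq n * normsq n) = (\<Sum>\<alpha>\<in>sqidx n. moment2 L \<alpha> \<alpha>)"
    by (simp only: pe_sum pe_single moment2_def mult_1)
  then show "density_matrix.trQ (sqidx n) (moment2 L) = 1"
    using pe_normsq_sq[OF L] by (simp add: density_matrix.trQ_def[OF d])
qed

text \<open>This diagonal block of the moment matrix is what the same-row terms of row
  \<open>a\<close> pair with; over all \<open>a\<close> the traces of the blocks add up to the full
  trace.\<close>

lemma density_matrix_slice:
  assumes L: "sphere_pe4 n L" and a: "a < n"
  shows "density_matrix {..<n} (\<lambda>b d. moment2 L (a, b) (a, d))"
proof
  show "finite {..<n}" by simp
  show "moment2 L (a, b) (a, d) = moment2 L (a, d) (a, b)" for b d by (simp add: moment2_def union_commute)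
  show "0 \<le> (\<Sum>b<n. \<Sum>d<n. z b * z d * moment2 L (a, b) (a, d))" for z
    using pe_psd[OF L, of "{..<n}" "\<lambda>b. {#a, b#}" z] a by (auto simp: monoms_def moment2_def)
qed

section \<open>Values of the spiked tensors\<close>

lemma pe_tensor_spiked:
  "pe_tensor n L (spiked \<tau> v G)
    = \<tau> * pe L (linform n v * linform n v * linform n v) + pe_tensor n L (\<lambda>i j k. G (i, j, k))"
proof -
  have "pe_tensor n L (spiked \<tau> v G)
      = (\<Sum>i<n. \<Sum>j<n. \<Sum>k<n. \<tau> * (v i * v j * v k * L {#i, j, k#}) + G (i, j, k) * L {#i, j, k#})"
    unfolding pe_tensor_def spiked_def rank_one3_def by (intro sum.cong refl) (simp add: algebra_simps)
  then show ?thesis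
    by (simp only: sum.distrib sum_distrib_left[symmetric] pe_linform_cube pe_tensor_def)
qed

text \<open>\<open>L\<close> sees only the multiset of the three indices, so summation indices can
  be exchanged; the two adjacent swaps generate all six permutations.\<close>

lemma pe_tensor_perm:
  assumes "\<pi> permutes {0 :: nat, 1, 2}"
  shows "pe_tensor n L (tensor_perm \<pi> A) = pe_tensor n L A"
proof -
  define S where "S f = (\<Sum>i<n. \<Sum>j<n. \<Sum>k<n. f i j k * L {#i, j, k#})" for f :: "nat \<Rightarrow> nat \<Rightarrow> nat \<Rightarrow> real"
  have sw23: "S (\<lambda>i j k. f i k j) = S f" for f
    unfolding S_def by (rule sum.cong[OF refl], subst sum.swap) (simp add: add_mset_commute)
  have sw12: "S (\<lambda>i j k. f j i k) = S f" for f
    unfolding S_def by (subst sum.swap) (simp add: add_mset_commute)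
  define \<rho> where "\<rho> = inv \<pi>"
  have p: "\<rho> permutes {0, 1, 2}" unfolding \<rho>_def by (rule permutes_inv[OF assms])
  have mem: "\<rho> 0 \<in> {0, 1, 2}" "\<rho> 1 \<in> {0, 1, 2}" "\<rho> 2 \<in> {0, 1, 2}"
    using permutes_in_image[OF p] by auto
  have ne: "\<rho> 0 \<noteq> \<rho> 1" "\<rho> 0 \<noteq> \<rho> 2" "\<rho> 1 \<noteq> \<rho> 2"
    using inj_eq[OF permutes_inj[OF p]] by simp_all
  consider "\<rho> 0 = 0" "\<rho> 1 = 1" "\<rho> 2 = 2" | "\<rho> 0 = 0" "\<rho> 1 = 2" "\<rho> 2 = 1"
    | "\<rho> 0 = 1" "\<rho> 1 = 0" "\<rho> 2 = 2" | "\<rho> 0 = 1" "\<rho> 1 = 2" "\<rho> 2 = 0"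
    | "\<rho> 0 = 2" "\<rho> 1 = 0" "\<rho> 2 = 1" | "\<rho> 0 = 2" "\<rho> 1 = 1" "\<rho> 2 = 0"
    using mem ne by auto
  then have "S (\<lambda>i j k. A ([i, j, k] ! \<rho> 0) ([i, j, k] ! \<rho> 1) ([i, j, k] ! \<rho> 2)) = S A"
  proof cases
    case 1 then show ?thesis by simp
  next
    case 2 then show ?thesis using sw23[of A] by simp
  next
    case 3 then show ?thesis using sw12[of A] by simp
  next
    case 4
    have "S (\<lambda>i j k. A j k i) = S A"
      using sw12[of "\<lambda>i j k. A i k j"] sw23[of A] by (rule trans)
    with 4 show ?thesis by simp
  next
    case 5
    have "S (\<lambda>i j k. A k i j) = S A"
      using sw23[of "\<lambda>i j k. A j i k"] sw12[of A] by (rule trans)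
    with 5 show ?thesis by simp
  next
    case 6
    have "S (\<lambda>i j k. A k i j) = S A"
      using sw23[of "\<lambda>i j k. A j i k"] sw12[of A] by (rule trans)
    with sw12[of "\<lambda>i j k. A k i j"] have "S (\<lambda>i j k. A k j i) = S A" by (rule trans)
    with 6 show ?thesis by simp
  qed
  then show ?thesis
    by (simp add: pe_tensor_def tensor_perm_def S_def \<rho>_def Let_def)
qed

lemma pe_tensor_spiked_sym: "pe_tensor n L (spiked_sym \<tau> v G) = pe_tensor n L (spiked \<tau> v G)"
proof -
  let ?P = "{\<pi>. \<pi> permutes {0 :: nat, 1, 2}}"
  let ?A = "\<lambda>a b c. G (a, b, c)"
  have fin: "finite ?P" by (rule finite_permutations) simp
  have card: "card ?P = 6" by (subst card_permutations[OF refl]) (auto simp: fact_numeral)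
  have "pe_tensor n L (spiked_sym \<tau> v G) = (\<Sum>i<n. \<Sum>j<n. \<Sum>k<n. rank_one3 \<tau> v i j k * L {#i, j, k#}
      + (\<Sum>\<pi>\<in>?P. (1 / 6) * (tensor_perm \<pi> ?A i j k * L {#i, j, k#})))"
    unfolding pe_tensor_def spiked_sym_def
    by (intro sum.cong refl) (simp only: distrib_right sum_distrib_left sum_distrib_right mult.assoc)
  also have "\<dots> = pe_tensor n L (rank_one3 \<tau> v) + (\<Sum>\<pi>\<in>?P. (1 / 6) * pe_tensor n L (tensor_perm \<pi> ?A))"
    by (simp only: sum.distrib sum.swap[of _ ?P] sum_distrib_left[symmetric] pe_tensor_def)
  also have "(\<Sum>\<pi>\<in>?P. (1 / 6) * pe_tensor n L (tensor_perm \<pi> ?A)) = (\<Sum>\<pi>\<in>?P. (1 / 6) * pe_tensor n L ?A)"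
    by (intro sum.cong refl) (simp add: pe_tensor_perm)
  also have "\<dots> = pe_tensor n L ?A" unfolding sum_constant card by simp
  also have "pe_tensor n L (rank_one3 \<tau> v) + pe_tensor n L ?A = pe_tensor n L (spiked \<tau> v G)"
    unfolding pe_tensor_def spiked_def by (simp add: sum.distrib distrib_right)
  finally show ?thesis .
qed

section \<open>Splitting the rows into two classes\<close>

lemma tr_tp_mult:
  assumes "finite I" "\<And>a b. a \<notin> I \<Longrightarrow> entry U a b = 0" "finite T" "\<And>a b. b \<notin> T \<Longrightarrow> entry U a b = 0"
  shows "tr (tp U * U) = (\<Sum>c\<in>T. \<Sum>a\<in>I. (entry U a c)\<^sup>2)"
proof -
  have 1: "entry (tp U * U) c c = (\<Sum>a\<in>I. (entry U a c)\<^sup>2)" for c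
    by (subst entry_mult[of I]) (use assms in \<open>auto simp: power2_eq_square\<close>)
  have "tr (tp U * U) = (\<Sum>c\<in>T. entry (tp U * U) c c)"
    by (rule tr_eq) (use assms in \<open>auto simp: 1\<close>)
  then show ?thesis by (simp only: 1)
qed

text \<open>The vector bound is applied to each column of \<open>Z\<close>, and for the second claim
  to the unit vectors.\<close>

lemma variance_of_vectors:
  fixes B :: "'j \<Rightarrow> 'i fmat"
  assumes I: "finite I" and supp: "\<And>j. j \<in> J \<Longrightarrow> idx (B j) \<subseteq> I" and v: "v \<ge> 0"
    and vec: "\<And>z. (\<Sum>j\<in>J. \<Sum>a\<in>I. (\<Sum>b\<in>I. entry (B j) a b * z b)\<^sup>2) \<le> v * (\<Sum>b\<in>I. (z b)\<^sup>2)"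
  shows "(\<Sum>j\<in>J. tr (tp (B j * Z) * (B j * Z))) \<le> v * tr (tp Z * Z)"
    and "(\<Sum>j\<in>J. tr (tp (B j) * B j)) \<le> v * card I"
proof -
  define T where "T = I \<union> idx Z"
  have T: "finite T" "I \<subseteq> T" using I by (auto simp: T_def)
  have out: "entry (B j) a b = 0" if "j \<in> J" "a \<notin> I \<or> b \<notin> I" for j a b
    using entry_eq_0[of a "B j" b] that supp[of j] by blast
  have BZ: "entry (B j * Z) a c = (\<Sum>b\<in>I. entry (B j) a b * entry Z b c)" if "j \<in> J" for j a c
    by (rule entry_mult) (use I out that in auto)
  have "(\<Sum>j\<in>J. tr (tp (B j * Z) * (B j * Z)))
      = (\<Sum>j\<in>J. \<Sum>c\<in>T. \<Sum>a\<in>I. (\<Sum>b\<in>I. entry (B j) a b * entry Z b c)\<^sup>2)"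
  proof (rule sum.cong[OF refl])
    fix j assume j: "j \<in> J"
    have "tr (tp (B j * Z) * (B j * Z)) = (\<Sum>c\<in>T. \<Sum>a\<in>I. (entry (B j * Z) a c)\<^sup>2)"
    proof (rule tr_tp_mult[OF I _ T(1)])
      show "entry (B j * Z) a b = 0" if "a \<notin> I" for a b
        using that j by (simp add: BZ out)
      show "entry (B j * Z) a b = 0" if "b \<notin> T" for a b
      proof -
        have "b \<notin> idx Z" using that by (simp add: T_def)
        then show ?thesis using j by (simp add: BZ)
      qed
    qed
    then show "tr (tp (B j * Z) * (B j * Z)) = (\<Sum>c\<in>T. \<Sum>a\<in>I. (\<Sum>b\<in>I. entry (B j) a b * entry Z b c)\<^sup>2)"
      using j by (simp add: BZ)
  qed
  also have "\<dots> = (\<Sum>c\<in>T. \<Sum>j\<in>J. \<Sum>a\<in>I. (\<Sum>b\<in>I. entry (B j) a b * entry Z b c)\<^sup>2)"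
    by (rule sum.swap)
  also have "\<dots> \<le> (\<Sum>c\<in>T. v * (\<Sum>b\<in>I. (entry Z b c)\<^sup>2))"
    by (intro sum_mono vec)
  also have "\<dots> \<le> (\<Sum>c\<in>T. v * (\<Sum>b\<in>T. (entry Z b c)\<^sup>2))"
    by (intro sum_mono mult_left_mono sum_mono2 T v) auto
  also have "\<dots> = v * tr (tp Z * Z)"
  proof -
    have "tr (tp Z * Z) = (\<Sum>c\<in>T. \<Sum>b\<in>T. (entry Z b c)\<^sup>2)"
      by (rule tr_tp_mult[OF T(1) _ T(1)]) (simp_all add: T_def)
    then show ?thesis by (simp only: sum_distrib_left)
  qed
  finally show "(\<Sum>j\<in>J. tr (tp (B j * Z) * (B j * Z))) \<le> v * tr (tp Z * Z)" .
  have "(\<Sum>j\<in>J. tr (tp (B j) * B j)) = (\<Sum>j\<in>J. \<Sum>c\<in>I. \<Sum>a\<in>I. (entry (B j) a c)\<^sup>2)"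
    by (rule sum.cong[OF refl], rule tr_tp_mult[OF I _ I]) (simp_all add: out)
  also have "\<dots> = (\<Sum>c\<in>I. \<Sum>j\<in>J. \<Sum>a\<in>I. (entry (B j) a c)\<^sup>2)"
    by (rule sum.swap)
  also have "\<dots> \<le> (\<Sum>c\<in>I. v)"
  proof (rule sum_mono)
    fix c assume c: "c \<in> I"
    have "(\<Sum>b\<in>I. entry (B j) a b * (if b = c then 1 else 0)) = entry (B j) a c" for j a
      using I c by (simp add: if_distrib[of "\<lambda>x. _ * x"] cong: if_cong)
    moreover have "(\<Sum>b\<in>I. (if b = c then 1 else 0 :: real)\<^sup>2) = 1"
      using I c by (simp add: if_distrib[of "\<lambda>x. x\<^sup>2"] cong: if_cong)
    ultimately show "(\<Sum>j\<in>J. \<Sum>a\<in>I. (entry (B j) a c)\<^sup>2) \<le> v"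
      using vec[of "\<lambda>b. if b = c then 1 else 0"] by simp
  qed
  finally show "(\<Sum>j\<in>J. tr (tp (B j) * B j)) \<le> v * card I" by (simp add: mult.commute)
qed

text \<open>For \<open>j = (i, a, b)\<close> this is \<open>G j\<close> times the Kronecker product
  of the matrix unit at \<open>(a, b)\<close> with slice \<open>i\<close> cut to the rows outside
  \<open>S\<close>: the entry in row \<open>(a, c)\<close> and column \<open>(b, d)\<close> is
  \<open>G (i, a, b) * G (i, c, d)\<close>.\<close>

definition halfmat :: "nat \<Rightarrow> nat set \<Rightarrow> (nat \<times> nat \<times> nat \<Rightarrow> real) \<Rightarrow> nat \<times> nat \<times> nat
    \<Rightarrow> nat \<times> nat \<Rightarrow> nat \<times> nat \<Rightarrow> real" where
  "halfmat n S G j \<alpha> \<beta> = (if \<alpha> \<in> sqidx n \<and> \<beta> \<in> sqidx n \<and> fst \<alpha> = fst (snd j) \<and> fst \<beta> = snd (snd j) \<and> snd \<alpha> \<notin> S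
     then G j * G (fst j, snd \<alpha>, snd \<beta>) else 0)"

lemma finite_sqidx [simp]: "finite (sqidx n)" by (simp add: sqidx_def)

lemma halfmat_outside: "\<alpha> \<notin> sqidx n \<or> \<beta> \<notin> sqidx n \<Longrightarrow> halfmat n S G j \<alpha> \<beta> = 0"
  by (auto simp: halfmat_def)

text \<open>Symmetrized because both Khintchine and the power bound concern symmetric matrices; the
  pairing with the symmetric \<open>moment2 L\<close> does not see the difference.\<close>

lift_definition splitmat :: "nat \<Rightarrow> nat set \<Rightarrow> (nat \<times> nat \<times> nat \<Rightarrow> real) \<Rightarrow> nat \<times> nat \<times> nat
    \<Rightarrow> (nat \<times> nat) fmat" is "\<lambda>n S G j \<alpha> \<beta>. (halfmat n S G j \<alpha> \<beta> + halfmat n S G j \<beta> \<alpha>) / 2"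
proof -
  fix n S G j
  have "{(\<alpha>, \<beta>). (halfmat n S G j \<alpha> \<beta> + halfmat n S G j \<beta> \<alpha>) / 2 \<noteq> 0} \<subseteq> sqidx n \<times> sqidx n"
  proof (rule subsetI)
    fix x
    assume x: "x \<in> {(\<alpha>, \<beta>). (halfmat n S G j \<alpha> \<beta> + halfmat n S G j \<beta> \<alpha>) / 2 \<noteq> 0}"
    obtain \<alpha> \<beta> where e: "x = (\<alpha>, \<beta>)" by (cases x)
    show "x \<in> sqidx n \<times> sqidx n"
    proof (rule ccontr)
      assume "x \<notin> sqidx n \<times> sqidx n"
      then have "halfmat n S G j \<alpha> \<beta> = 0" "halfmat n S G j \<beta> \<alpha> = 0"
        unfolding e by (auto intro!: halfmat_outside)
      then show False using x e by simp
    qed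
  qed
  then show "finite {(\<alpha>, \<beta>). (halfmat n S G j \<alpha> \<beta> + halfmat n S G j \<beta> \<alpha>) / 2 \<noteq> 0}"
    by (rule finite_subset) simp
qed

lemmas entry_splitmat = splitmat.rep_eq

definition splitidx :: "nat \<Rightarrow> nat set \<Rightarrow> (nat \<times> nat \<times> nat) set" where
  "splitidx n S = {..<n} \<times> ({..<n} \<inter> S) \<times> {..<n}"

definition splitsum :: "nat \<Rightarrow> nat set \<Rightarrow> (nat \<times> nat \<times> nat \<Rightarrow> real) \<Rightarrow> (nat \<times> nat) fmat" where
  "splitsum n S G = (\<Sum>j\<in>splitidx n S. splitmat n S G j)"

lemma tp_splitmat: "tp (splitmat n S G j) = splitmat n S G j"
  by (rule fmat_eqI) (simp add: entry_splitmat add.commute)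

lemma idx_splitmat: "idx (splitmat n S G j) \<subseteq> sqidx n"
proof -
  have "\<alpha> \<in> sqidx n \<and> \<beta> \<in> sqidx n" if "entry (splitmat n S G j) \<alpha> \<beta> \<noteq> 0" for \<alpha> \<beta>
  proof (rule ccontr)
    assume "\<not> (\<alpha> \<in> sqidx n \<and> \<beta> \<in> sqidx n)"
    then have "halfmat n S G j \<alpha> \<beta> = 0" "halfmat n S G j \<beta> \<alpha> = 0"
      by (auto intro!: halfmat_outside)
    then show False using that by (simp add: entry_splitmat)
  qed
  then show ?thesis by (rule idx_subsetI)
qed

lemma finite_splitidx [simp]: "finite (splitidx n S)" by (simp add: splitidx_def)

lemma tp_splitsum: "tp (splitsum n S G) = splitsum n S G"
  unfolding splitsum_def tp_sum tp_splitmat ..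

lemma idx_splitsum: "idx (splitsum n S G) \<subseteq> sqidx n"
proof (rule idx_subsetI, rule ccontr)
  fix \<alpha> \<beta> assume nz: "entry (splitsum n S G) \<alpha> \<beta> \<noteq> 0" and out: "\<not> (\<alpha> \<in> sqidx n \<and> \<beta> \<in> sqidx n)"
  have "entry (splitmat n S G j) \<alpha> \<beta> = 0" for j
    using out idx_splitmat[of n S G j] entry_eq_0[of \<alpha> "splitmat n S G j" \<beta>] by blast
  then have "entry (splitsum n S G) \<alpha> \<beta> = 0" by (simp add: splitsum_def)
  with nz show False by contradiction
qed

lemma sum_sqidx: "(\<Sum>\<alpha>\<in>sqidx n. f \<alpha>) = (\<Sum>a<n. \<Sum>c<n. f (a, c))"
  by (simp add: sqidx_def sum.cartesian_product)

lemma sum_splitidx: "(\<Sum>j\<in>splitidx n S. f j) = (\<Sum>i<n. \<Sum>a\<in>{..<n} \<inter> S. \<Sum>b<n. f (i, a, b))"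
  by (simp add: splitidx_def sum.cartesian_product)

lemma sum_if_notin: "(\<Sum>c<n. if c \<notin> S then f c else 0) = (\<Sum>c\<in>{..<n} - S. f c)" for f :: "nat \<Rightarrow> real"
  by (rule sum.mono_neutral_cong_right) auto

text \<open>By the Kronecker form, the image of \<open>z\<close> lives in block \<open>a\<close> and
  is the cut slice applied to block \<open>b\<close> of \<open>z\<close>, scaled by
  \<open>G (i, a, b)\<close>; \<open>halfmat_col\<close> is the transposed computation.\<close>

lemma halfmat_row:
  assumes "i < n" "a < n" "b < n"
  shows "(\<Sum>\<alpha>\<in>sqidx n. (\<Sum>\<beta>\<in>sqidx n. halfmat n S G (i, a, b) \<alpha> \<beta> * z \<beta>)\<^sup>2)
    = (G (i, a, b))\<^sup>2 * (\<Sum>c\<in>{..<n} - S. (\<Sum>d<n. G (i, c, d) * z (b, d))\<^sup>2)"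
proof -
  have in1: "(\<Sum>\<beta>\<in>sqidx n. halfmat n S G (i, a, b) (a', c) \<beta> * z \<beta>)
      = (if a' = a then if c \<notin> S then G (i, a, b) * (\<Sum>d<n. G (i, c, d) * z (b, d)) else 0 else 0)"
    if "a' < n" "c < n" for a' c
  proof -
    have "(\<Sum>\<beta>\<in>sqidx n. halfmat n S G (i, a, b) (a', c) \<beta> * z \<beta>)
        = (\<Sum>b'<n. if b' = b then (if a' = a \<and> c \<notin> S then G (i, a, b) * (\<Sum>d<n. G (i, c, d) * z (b, d)) else 0) else 0)"
      unfolding sum_sqidx
      by (rule sum.cong[OF refl]) (use that in \<open>auto simp: halfmat_def sqidx_def sum_distrib_left mult.assoc\<close>)
    also have "\<dots> = (if a' = a \<and> c \<notin> S then G (i, a, b) * (\<Sum>d<n. G (i, c, d) * z (b, d)) else 0)"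
      using assms by simp
    finally show ?thesis by simp
  qed
  have "(\<Sum>\<alpha>\<in>sqidx n. (\<Sum>\<beta>\<in>sqidx n. halfmat n S G (i, a, b) \<alpha> \<beta> * z \<beta>)\<^sup>2)
      = (\<Sum>a'<n. if a' = a then (\<Sum>c<n. if c \<notin> S then (G (i, a, b))\<^sup>2 * (\<Sum>d<n. G (i, c, d) * z (b, d))\<^sup>2 else 0) else 0)"
    unfolding sum_sqidx[where f = "\<lambda>\<alpha>. (\<Sum>\<beta>\<in>sqidx n. halfmat n S G (i, a, b) \<alpha> \<beta> * z \<beta>)\<^sup>2"]
  proof (rule sum.cong[OF refl])
    fix a' assume a': "a' \<in> {..<n}"
    have "(\<Sum>c<n. (\<Sum>\<beta>\<in>sqidx n. halfmat n S G (i, a, b) (a', c) \<beta> * z \<beta>)\<^sup>2)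
        = (\<Sum>c<n. if a' = a then if c \<notin> S then (G (i, a, b))\<^sup>2 * (\<Sum>d<n. G (i, c, d) * z (b, d))\<^sup>2 else 0 else 0)"
      by (rule sum.cong[OF refl]) (use a' in \<open>simp add: in1 power_mult_distrib\<close>)
    then show "(\<Sum>c<n. (\<Sum>\<beta>\<in>sqidx n. halfmat n S G (i, a, b) (a', c) \<beta> * z \<beta>)\<^sup>2)
        = (if a' = a then \<Sum>c<n. if c \<notin> S then (G (i, a, b))\<^sup>2 * (\<Sum>d<n. G (i, c, d) * z (b, d))\<^sup>2 else 0 else 0)"
      by simp
  qed
  also have "\<dots> = (\<Sum>c<n. if c \<notin> S then (G (i, a, b))\<^sup>2 * (\<Sum>d<n. G (i, c, d) * z (b, d))\<^sup>2 else 0)"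
    using assms by simp
  finally show ?thesis by (simp only: sum_if_notin sum_distrib_left)
qed

lemma halfmat_col:
  assumes "i < n" "a < n" "b < n"
  shows "(\<Sum>\<alpha>\<in>sqidx n. (\<Sum>\<beta>\<in>sqidx n. halfmat n S G (i, a, b) \<beta> \<alpha> * z \<beta>)\<^sup>2)
    = (G (i, a, b))\<^sup>2 * (\<Sum>d<n. (\<Sum>c\<in>{..<n} - S. G (i, c, d) * z (a, c))\<^sup>2)"
proof -
  have in1: "(\<Sum>\<beta>\<in>sqidx n. halfmat n S G (i, a, b) \<beta> (b', d) * z \<beta>)
      = (if b' = b then G (i, a, b) * (\<Sum>c\<in>{..<n} - S. G (i, c, d) * z (a, c)) else 0)"
    if "b' < n" "d < n" for b' d
  proof -
    have "(\<Sum>\<beta>\<in>sqidx n. halfmat n S G (i, a, b) \<beta> (b', d) * z \<beta>)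
        = (\<Sum>a'<n. if a' = a then (if b' = b then (\<Sum>c<n. if c \<notin> S then G (i, a, b) * (G (i, c, d) * z (a, c)) else 0) else 0) else 0)"
      unfolding sum_sqidx
      by (rule sum.cong[OF refl]) (use that in \<open>auto simp: halfmat_def sqidx_def mult.assoc intro!: sum.cong\<close>)
    also have "\<dots> = (if b' = b then (\<Sum>c<n. if c \<notin> S then G (i, a, b) * (G (i, c, d) * z (a, c)) else 0) else 0)"
      using assms by simp
    finally show ?thesis by (simp only: sum_if_notin sum_distrib_left)
  qed
  have "(\<Sum>\<alpha>\<in>sqidx n. (\<Sum>\<beta>\<in>sqidx n. halfmat n S G (i, a, b) \<beta> \<alpha> * z \<beta>)\<^sup>2)
      = (\<Sum>b'<n. if b' = b then (\<Sum>d<n. (G (i, a, b))\<^sup>2 * (\<Sum>c\<in>{..<n} - S. G (i, c, d) * z (a, c))\<^sup>2) else 0)"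
    unfolding sum_sqidx[where f = "\<lambda>\<alpha>. (\<Sum>\<beta>\<in>sqidx n. halfmat n S G (i, a, b) \<beta> \<alpha> * z \<beta>)\<^sup>2"]
  proof (rule sum.cong[OF refl])
    fix b' assume b': "b' \<in> {..<n}"
    have "(\<Sum>d<n. (\<Sum>\<beta>\<in>sqidx n. halfmat n S G (i, a, b) \<beta> (b', d) * z \<beta>)\<^sup>2)
        = (\<Sum>d<n. if b' = b then (G (i, a, b))\<^sup>2 * (\<Sum>c\<in>{..<n} - S. G (i, c, d) * z (a, c))\<^sup>2 else 0)"
      by (rule sum.cong[OF refl]) (use b' in \<open>simp add: in1 power_mult_distrib\<close>)
    then show "(\<Sum>d<n. (\<Sum>\<beta>\<in>sqidx n. halfmat n S G (i, a, b) \<beta> (b', d) * z \<beta>)\<^sup>2)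
        = (if b' = b then \<Sum>d<n. (G (i, a, b))\<^sup>2 * (\<Sum>c\<in>{..<n} - S. G (i, c, d) * z (a, c))\<^sup>2 else 0)"
      by simp
  qed
  also have "\<dots> = (\<Sum>d<n. (G (i, a, b))\<^sup>2 * (\<Sum>c\<in>{..<n} - S. G (i, c, d) * z (a, c))\<^sup>2)"
    using assms by simp
  finally show ?thesis by (simp only: sum_distrib_left)
qed

text \<open>The square of \<open>G (i, a, b)\<close> is summed along a fibre, at cost
  \<open>r\<close>; what remains is the stack of all cut slices applied to a block of
  \<open>z\<close>, at cost \<open>w\<close>. The row part uses \<open>col\<close> and
  \<open>op1\<close>, the column part \<open>row\<close> and \<open>op2\<close>, and symmetrization
  averages the two.\<close>

lemma splitmat_variance:
  assumes col: "\<And>i b. i < n \<Longrightarrow> b < n \<Longrightarrow> (\<Sum>a<n. (G (i, a, b))\<^sup>2) \<le> r"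
    and row: "\<And>i a. i < n \<Longrightarrow> a < n \<Longrightarrow> (\<Sum>b<n. (G (i, a, b))\<^sup>2) \<le> r"
    and op1: "\<And>z. (\<Sum>i<n. \<Sum>c\<in>{..<n} - S. (\<Sum>d<n. G (i, c, d) * z d)\<^sup>2) \<le> w * (\<Sum>d<n. (z d)\<^sup>2)"
    and op2: "\<And>z. (\<Sum>i<n. \<Sum>d<n. (\<Sum>c\<in>{..<n} - S. G (i, c, d) * z c)\<^sup>2) \<le> w * (\<Sum>c<n. (z c)\<^sup>2)"
    and r: "r \<ge> 0"  and w: "w \<ge> 0"
  shows "(\<Sum>j\<in>splitidx n S. \<Sum>\<alpha>\<in>sqidx n. (\<Sum>\<beta>\<in>sqidx n. entry (splitmat n S G j) \<alpha> \<beta> * z \<beta>)\<^sup>2)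
    \<le> (r * w) * (\<Sum>\<beta>\<in>sqidx n. (z \<beta>)\<^sup>2)"
proof -
  define f where "f j \<alpha> = (\<Sum>\<beta>\<in>sqidx n. halfmat n S G j \<alpha> \<beta> * z \<beta>)" for j \<alpha>
  define g where "g j \<alpha> = (\<Sum>\<beta>\<in>sqidx n. halfmat n S G j \<beta> \<alpha> * z \<beta>)" for j \<alpha>
  have e: "(\<Sum>\<beta>\<in>sqidx n. entry (splitmat n S G j) \<alpha> \<beta> * z \<beta>) = (f j \<alpha> + g j \<alpha>) / 2" for j \<alpha>
    unfolding f_def g_def sum.distrib[symmetric] sum_divide_distrib
    by (intro sum.cong refl) (simp add: entry_splitmat algebra_simps add_divide_distrib)
  have sq: "((x + y) / 2)\<^sup>2 \<le> (x\<^sup>2 + y\<^sup>2) / 2" for x y :: real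
    using sum_squares_bound[of x y] by (simp add: power2_sum power_divide)
  have F: "(\<Sum>j\<in>splitidx n S. \<Sum>\<alpha>\<in>sqidx n. (f j \<alpha>)\<^sup>2) \<le> (r * w) * (\<Sum>\<beta>\<in>sqidx n. (z \<beta>)\<^sup>2)"
  proof -
    define Y where "Y i b = (\<Sum>c\<in>{..<n} - S. (\<Sum>d<n. G (i, c, d) * z (b, d))\<^sup>2)" for i b
    have Y: "Y i b \<ge> 0" for i b unfolding Y_def by (intro sum_nonneg) simp
    have "(\<Sum>j\<in>splitidx n S. \<Sum>\<alpha>\<in>sqidx n. (f j \<alpha>)\<^sup>2)
        = (\<Sum>i<n. \<Sum>a\<in>{..<n} \<inter> S. \<Sum>b<n. (G (i, a, b))\<^sup>2 * Y i b)"
      unfolding sum_splitidx f_def Y_def by (intro sum.cong refl halfmat_row) auto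
    also have "\<dots> \<le> (\<Sum>i<n. \<Sum>a<n. \<Sum>b<n. (G (i, a, b))\<^sup>2 * Y i b)"
      using Y by (intro sum_mono sum_mono2) (auto intro!: sum_nonneg)
    also have "\<dots> = (\<Sum>i<n. \<Sum>b<n. (\<Sum>a<n. (G (i, a, b))\<^sup>2) * Y i b)"
      unfolding sum_distrib_right by (rule sum.cong[OF refl], rule sum.swap)
    also have "\<dots> \<le> (\<Sum>i<n. \<Sum>b<n. r * Y i b)"
      using Y col by (intro sum_mono mult_right_mono) auto
    also have "\<dots> = r * (\<Sum>b<n. \<Sum>i<n. Y i b)"
      by (subst sum.swap) (simp only: sum_distrib_left)
    also have "\<dots> \<le> r * (\<Sum>b<n. w * (\<Sum>d<n. (z (b, d))\<^sup>2))"
      unfolding Y_def using op1 r by (intro mult_left_mono sum_mono) auto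
    finally show ?thesis by (simp only: sum_sqidx sum_distrib_left mult.assoc)
  qed
  have GG: "(\<Sum>j\<in>splitidx n S. \<Sum>\<alpha>\<in>sqidx n. (g j \<alpha>)\<^sup>2) \<le> (r * w) * (\<Sum>\<beta>\<in>sqidx n. (z \<beta>)\<^sup>2)"
  proof -
    define Y where "Y i a = (\<Sum>d<n. (\<Sum>c\<in>{..<n} - S. G (i, c, d) * z (a, c))\<^sup>2)" for i a
    have Y: "Y i a \<ge> 0" for i a unfolding Y_def by (intro sum_nonneg) simp
    have "(\<Sum>j\<in>splitidx n S. \<Sum>\<alpha>\<in>sqidx n. (g j \<alpha>)\<^sup>2)
        = (\<Sum>i<n. \<Sum>a\<in>{..<n} \<inter> S. \<Sum>b<n. (G (i, a, b))\<^sup>2 * Y i a)"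
      unfolding sum_splitidx g_def Y_def by (intro sum.cong refl halfmat_col) auto
    also have "\<dots> \<le> (\<Sum>i<n. \<Sum>a<n. \<Sum>b<n. (G (i, a, b))\<^sup>2 * Y i a)"
      using Y by (intro sum_mono sum_mono2) (auto intro!: sum_nonneg)
    also have "\<dots> = (\<Sum>i<n. \<Sum>a<n. (\<Sum>b<n. (G (i, a, b))\<^sup>2) * Y i a)"
      unfolding sum_distrib_right by (rule refl)
    also have "\<dots> \<le> (\<Sum>i<n. \<Sum>a<n. r * Y i a)"
      using Y row by (intro sum_mono mult_right_mono) auto
    also have "\<dots> = r * (\<Sum>a<n. \<Sum>i<n. Y i a)"
      by (subst sum.swap) (simp only: sum_distrib_left)
    also have "\<dots> \<le> r * (\<Sum>a<n. w * (\<Sum>c<n. (z (a, c))\<^sup>2))"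
      unfolding Y_def using op2 r by (intro mult_left_mono sum_mono) auto
    finally show ?thesis by (simp only: sum_sqidx sum_distrib_left mult.assoc)
  qed
  have "(\<Sum>j\<in>splitidx n S. \<Sum>\<alpha>\<in>sqidx n. (\<Sum>\<beta>\<in>sqidx n. entry (splitmat n S G j) \<alpha> \<beta> * z \<beta>)\<^sup>2)
      \<le> (\<Sum>j\<in>splitidx n S. \<Sum>\<alpha>\<in>sqidx n. ((f j \<alpha>)\<^sup>2 + (g j \<alpha>)\<^sup>2) / 2)"
    unfolding e by (intro sum_mono sq)
  also have "\<dots> = ((\<Sum>j\<in>splitidx n S. \<Sum>\<alpha>\<in>sqidx n. (f j \<alpha>)\<^sup>2) + (\<Sum>j\<in>splitidx n S. \<Sum>\<alpha>\<in>sqidx n. (g j \<alpha>)\<^sup>2)) / 2"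
    by (simp only: sum.distrib sum_divide_distrib[symmetric])
  also have "\<dots> \<le> (r * w) * (\<Sum>\<beta>\<in>sqidx n. (z \<beta>)\<^sup>2)"
    using F GG by simp
  finally show ?thesis .
qed

definition flipsign :: "'j set \<Rightarrow> ('j \<Rightarrow> real) \<Rightarrow> 'j \<Rightarrow> real" where
  "flipsign T G = (\<lambda>j. if j \<in> T then - G j else G j)"

text \<open>Only the factor \<open>G j\<close> changes sign: the other factor lies in a row outside
  \<open>S\<close>, where \<open>T\<close> has no element. This is the linearity gained by splitting
  the rows.\<close>

lemma splitmat_flip:
  assumes T: "T \<subseteq> splitidx n S" and j: "j \<in> splitidx n S"
  shows "splitmat n S (flipsign T G) j = flip T j (splitmat n S G j)"
proof -
  have "halfmat n S (flipsign T G) j \<alpha> \<beta> = (if j \<in> T then - halfmat n S G j \<alpha> \<beta> else halfmat n S G j \<alpha> \<beta>)" for \<alpha> \<beta>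
    using T by (auto simp: halfmat_def flipsign_def splitidx_def)
  then show ?thesis
    by (intro fmat_eqI) (auto simp: flip_def entry_splitmat minus_divide_left)
qed

lemma splitsum_flip_moment:
  assumes "\<And>i b. i < n \<Longrightarrow> b < n \<Longrightarrow> (\<Sum>a<n. (G (i, a, b))\<^sup>2) \<le> r"
    and "\<And>i a. i < n \<Longrightarrow> a < n \<Longrightarrow> (\<Sum>b<n. (G (i, a, b))\<^sup>2) \<le> r"
    and "\<And>z. (\<Sum>i<n. \<Sum>c\<in>{..<n} - S. (\<Sum>d<n. G (i, c, d) * z d)\<^sup>2) \<le> w * (\<Sum>d<n. (z d)\<^sup>2)"
    and "\<And>z. (\<Sum>i<n. \<Sum>d<n. (\<Sum>c\<in>{..<n} - S. G (i, c, d) * z c)\<^sup>2) \<le> w * (\<Sum>c<n. (z c)\<^sup>2)"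
    and r: "r \<ge> 0"  and w: "w \<ge> 0"
  shows "(\<Sum>T\<in>Pow (splitidx n S). tr (actl (splitsum n S (flipsign T G)) (2 * m + 1) (splitsum n S (flipsign T G))))
    \<le> (4 * real (m + 1) * (r * w)) ^ (m + 1) * (real n)\<^sup>2 * 2 ^ card (splitidx n S)"
proof -
  have rw: "r * w \<ge> 0" using r w by simp
  note vec = splitmat_variance[OF assms]
  have s: "splitsum n S (flipsign T G) = (\<Sum>j\<in>splitidx n S. flip T j (splitmat n S G j))"
    if "T \<subseteq> splitidx n S" for T
    unfolding splitsum_def using that by (intro sum.cong refl splitmat_flip)
  have c: "real (card (sqidx n)) = (real n)\<^sup>2" by (simp add: sqidx_def power2_eq_square)
  have "(\<Sum>T\<in>Pow (splitidx n S). tr (actl (\<Sum>j\<in>splitidx n S. flip T j (splitmat n S G j)) (2 * m + 1) (\<Sum>j\<in>splitidx n S. flip T j (splitmat n S G j))))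
    \<le> (4 * real (m + 1) * (r * w)) ^ (m + 1) * (real n)\<^sup>2 * 2 ^ card (splitidx n S)"
  proof (rule rademacher_khintchine[OF finite_splitidx tp_splitmat _ _ rw])
    show "(\<Sum>j\<in>splitidx n S. tr (tp (splitmat n S G j * Z) * (splitmat n S G j * Z))) \<le> r * w * tr (tp Z * Z)" for Z
      by (rule variance_of_vectors(1)[OF finite_sqidx idx_splitmat rw vec])
    show "(\<Sum>j\<in>splitidx n S. tr (tp (splitmat n S G j) * splitmat n S G j)) \<le> r * w * (real n)\<^sup>2"
      using variance_of_vectors(2)[OF finite_sqidx idx_splitmat rw vec] unfolding c .
  qed auto
  then show ?thesis by (simp add: s)
qed

lemma pairing_splitsum:
  assumes L: "sphere_pe4 n L"
  shows "density_matrix.pairing (sqidx n) (moment2 L) (splitsum n S G)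
    = (\<Sum>i<n. \<Sum>a\<in>{..<n} \<inter> S. \<Sum>b<n. \<Sum>c\<in>{..<n} - S. \<Sum>d<n. G (i, a, b) * G (i, c, d) * L {#a, b, c, d#})"
proof -
  interpret density_matrix "sqidx n" "moment2 L" by (rule density_matrix_moment2[OF L])
  have B: "pairing (splitmat n S G (i, a, b)) = (\<Sum>c\<in>{..<n} - S. \<Sum>d<n. G (i, a, b) * G (i, c, d) * L {#a, b, c, d#})"
    if "a < n" "b < n" for i a b
  proof -
    let ?H = "halfmat n S G (i, a, b)"
    have sw: "(\<Sum>\<alpha>\<in>sqidx n. \<Sum>\<beta>\<in>sqidx n. ?H \<beta> \<alpha> * moment2 L \<alpha> \<beta>) = (\<Sum>\<alpha>\<in>sqidx n. \<Sum>\<beta>\<in>sqidx n. ?H \<alpha> \<beta> * moment2 L \<alpha> \<beta>)"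
      by (subst sum.swap) (intro sum.cong refl, simp add: moment2_def union_commute)
    have "pairing (splitmat n S G (i, a, b)) = ((\<Sum>\<alpha>\<in>sqidx n. \<Sum>\<beta>\<in>sqidx n. ?H \<alpha> \<beta> * moment2 L \<alpha> \<beta>)
        + (\<Sum>\<alpha>\<in>sqidx n. \<Sum>\<beta>\<in>sqidx n. ?H \<beta> \<alpha> * moment2 L \<alpha> \<beta>)) / 2"
      unfolding pairing_def entry_splitmat sum.distrib[symmetric] sum_divide_distrib
      by (intro sum.cong refl) (simp add: distrib_right)
    also have "\<dots> = (\<Sum>\<alpha>\<in>sqidx n. \<Sum>\<beta>\<in>sqidx n. ?H \<alpha> \<beta> * moment2 L \<alpha> \<beta>)"
      unfolding sw by simp
    also have "\<dots> = (\<Sum>a'<n. if a' = a then (\<Sum>c<n. if c \<notin> S then (\<Sum>d<n. G (i, a, b) * G (i, c, d) * moment2 L (a, c) (b, d)) else 0) else 0)"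
      unfolding sum_sqidx[where f = "\<lambda>\<alpha>. \<Sum>\<beta>\<in>sqidx n. ?H \<alpha> \<beta> * moment2 L \<alpha> \<beta>"]
    proof (rule sum.cong[OF refl])
      fix a' assume a': "a' \<in> {..<n}"
      have "(\<Sum>\<beta>\<in>sqidx n. ?H (a', c) \<beta> * moment2 L (a', c) \<beta>)
          = (if a' = a then if c \<notin> S then (\<Sum>d<n. G (i, a, b) * G (i, c, d) * moment2 L (a, c) (b, d)) else 0 else 0)"
        if c: "c < n" for c
      proof -
        have "(\<Sum>\<beta>\<in>sqidx n. ?H (a', c) \<beta> * moment2 L (a', c) \<beta>)
            = (\<Sum>b'<n. if b' = b then (if a' = a \<and> c \<notin> S then (\<Sum>d<n. G (i, a, b) * G (i, c, d) * moment2 L (a, c) (b, d)) else 0) else 0)"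
          unfolding sum_sqidx
          by (rule sum.cong[OF refl]) (use a' c in \<open>auto simp: halfmat_def sqidx_def\<close>)
        also have "\<dots> = (if a' = a \<and> c \<notin> S then (\<Sum>d<n. G (i, a, b) * G (i, c, d) * moment2 L (a, c) (b, d)) else 0)"
          using \<open>b < n\<close> by simp
        finally show ?thesis by simp
      qed
      then show "(\<Sum>c<n. \<Sum>\<beta>\<in>sqidx n. ?H (a', c) \<beta> * moment2 L (a', c) \<beta>)
          = (if a' = a then (\<Sum>c<n. if c \<notin> S then (\<Sum>d<n. G (i, a, b) * G (i, c, d) * moment2 L (a, c) (b, d)) else 0) else 0)"
        by simp
    qed
    also have "\<dots> = (\<Sum>c\<in>{..<n} - S. \<Sum>d<n. G (i, a, b) * G (i, c, d) * moment2 L (a, c) (b, d))"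
      using that by (simp add: sum_if_notin)
    also have "\<dots> = (\<Sum>c\<in>{..<n} - S. \<Sum>d<n. G (i, a, b) * G (i, c, d) * L {#a, b, c, d#})"
      by (intro sum.cong refl) (simp add: moment2_def add_mset_commute)
    finally show ?thesis .
  qed
  have "pairing (splitsum n S G) = (\<Sum>j\<in>splitidx n S. pairing (splitmat n S G j))"
  proof -
    have "pairing (splitsum n S G)
        = (\<Sum>\<alpha>\<in>sqidx n. \<Sum>\<beta>\<in>sqidx n. \<Sum>j\<in>splitidx n S. entry (splitmat n S G j) \<alpha> \<beta> * moment2 L \<alpha> \<beta>)"
      by (simp only: splitsum_def pairing_def entry_sum sum_distrib_right)
    also have "\<dots> = (\<Sum>\<alpha>\<in>sqidx n. \<Sum>j\<in>splitidx n S. \<Sum>\<beta>\<in>sqidx n. entry (splitmat n S G j) \<alpha> \<beta> * moment2 L \<alpha> \<beta>)"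
      by (rule sum.cong[OF refl], rule sum.swap)
    also have "\<dots> = (\<Sum>j\<in>splitidx n S. pairing (splitmat n S G j))"
      unfolding pairing_def by (rule sum.swap)
    finally show ?thesis .
  qed
  also have "\<dots> = (\<Sum>i<n. \<Sum>a\<in>{..<n} \<inter> S. \<Sum>b<n. pairing (splitmat n S G (i, a, b)))"
    by (rule sum_splitidx)
  also have "\<dots> = (\<Sum>i<n. \<Sum>a\<in>{..<n} \<inter> S. \<Sum>b<n. \<Sum>c\<in>{..<n} - S. \<Sum>d<n. G (i, a, b) * G (i, c, d) * L {#a, b, c, d#})"
    by (intro sum.cong refl B) auto
  finally show ?thesis .
qed

text \<open>Fibre norms in the three directions, then off-diagonal Gram bounds: for the slices at
  fixed second and at fixed third index, and for the fibres along the first index. The Gram bounds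
  have a random right-hand side because \<open>gauss_cross_tail\<close> is self-normalized; the
  fibre bounds turn it into a number. With 64 the tail rate is 64/4 = 16 per dimension, enough to
  beat the factor \<open>sqrt 2 ^ n\<close> and a union bound.\<close>

definition good_tensor :: "nat \<Rightarrow> (nat \<times> nat \<times> nat \<Rightarrow> real) \<Rightarrow> bool" where
  "good_tensor n G \<longleftrightarrow>
    (\<forall>a<n. \<forall>b<n. (\<Sum>k<n. (G (k, a, b))\<^sup>2) \<le> 64 * real n) \<and>
    (\<forall>a<n. \<forall>b<n. (\<Sum>k<n. (G (a, k, b))\<^sup>2) \<le> 64 * real n) \<and>
    (\<forall>a<n. \<forall>b<n. (\<Sum>k<n. (G (a, b, k))\<^sup>2) \<le> 64 * real n) \<and>
    (\<forall>a<n. (\<Sum>b\<in>{..<n} - {a}. (\<Sum>k\<in>sqidx n. G (fst k, a, snd k) * G (fst k, b, snd k))\<^sup>2)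
      \<le> 64 * real n * (\<Sum>k\<in>sqidx n. (G (fst k, a, snd k))\<^sup>2)) \<and>
    (\<forall>a<n. (\<Sum>b\<in>{..<n} - {a}. (\<Sum>k\<in>sqidx n. G (fst k, snd k, a) * G (fst k, snd k, b))\<^sup>2)
      \<le> 64 * real n * (\<Sum>k\<in>sqidx n. (G (fst k, snd k, a))\<^sup>2)) \<and>
    (\<forall>a<n. \<forall>b<n. (\<Sum>d\<in>{..<n} - {b}. (\<Sum>k<n. G (k, a, b) * G (k, a, d))\<^sup>2)
      \<le> 64 * real n * (\<Sum>k<n. (G (k, a, b))\<^sup>2))"

lemma good_tensorD:
  assumes "good_tensor n G" "a < n"
  shows "b < n \<Longrightarrow> (\<Sum>k<n. (G (k, a, b))\<^sup>2) \<le> 64 * real n"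
    and "b < n \<Longrightarrow> (\<Sum>k<n. (G (a, k, b))\<^sup>2) \<le> 64 * real n"
    and "b < n \<Longrightarrow> (\<Sum>k<n. (G (a, b, k))\<^sup>2) \<le> 64 * real n"
    and "(\<Sum>b\<in>{..<n} - {a}. (\<Sum>k\<in>sqidx n. G (fst k, a, snd k) * G (fst k, b, snd k))\<^sup>2)
      \<le> 64 * real n * (\<Sum>k\<in>sqidx n. (G (fst k, a, snd k))\<^sup>2)"
    and "(\<Sum>b\<in>{..<n} - {a}. (\<Sum>k\<in>sqidx n. G (fst k, snd k, a) * G (fst k, snd k, b))\<^sup>2)
      \<le> 64 * real n * (\<Sum>k\<in>sqidx n. (G (fst k, snd k, a))\<^sup>2)"
    and "b < n \<Longrightarrow> (\<Sum>d\<in>{..<n} - {b}. (\<Sum>k<n. G (k, a, b) * G (k, a, d))\<^sup>2)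
      \<le> 64 * real n * (\<Sum>k<n. (G (k, a, b))\<^sup>2)"
proof -
  note g = assms(1)[unfolded good_tensor_def]
  note g2 = conjunct2[OF g] note g3 = conjunct2[OF g2] note g4 = conjunct2[OF g3] note g5 = conjunct2[OF g4]
  note all = conjunct1[OF g, rule_format, OF assms(2)] conjunct1[OF g2, rule_format, OF assms(2)]
    conjunct1[OF g3, rule_format, OF assms(2)] conjunct1[OF g4, rule_format, OF assms(2)]
    conjunct1[OF g5, rule_format, OF assms(2)] conjunct2[OF g5, rule_format, OF assms(2)]
  show "b < n \<Longrightarrow> (\<Sum>k<n. (G (k, a, b))\<^sup>2) \<le> 64 * real n" by (rule all(1))
  show "b < n \<Longrightarrow> (\<Sum>k<n. (G (a, k, b))\<^sup>2) \<le> 64 * real n" by (rule all(2))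
  show "b < n \<Longrightarrow> (\<Sum>k<n. (G (a, b, k))\<^sup>2) \<le> 64 * real n" by (rule all(3))
  show "(\<Sum>b\<in>{..<n} - {a}. (\<Sum>k\<in>sqidx n. G (fst k, a, snd k) * G (fst k, b, snd k))\<^sup>2)
      \<le> 64 * real n * (\<Sum>k\<in>sqidx n. (G (fst k, a, snd k))\<^sup>2)" by (rule all(4))
  show "(\<Sum>b\<in>{..<n} - {a}. (\<Sum>k\<in>sqidx n. G (fst k, snd k, a) * G (fst k, snd k, b))\<^sup>2)
      \<le> 64 * real n * (\<Sum>k\<in>sqidx n. (G (fst k, snd k, a))\<^sup>2)" by (rule all(5))
  show "b < n \<Longrightarrow> (\<Sum>d\<in>{..<n} - {b}. (\<Sum>k<n. G (k, a, b) * G (k, a, d))\<^sup>2)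
      \<le> 64 * real n * (\<Sum>k<n. (G (k, a, b))\<^sup>2)" by (rule all(6))
qed

text \<open>An operator-norm bound, valid for all \<open>z\<close> at once without a net: the Gram
  matrix of the vectors \<open>g a\<close> is paired with the rank-one matrix of \<open>z\<close>,
  its diagonal estimated by the maximum and the rest in Frobenius norm.\<close>

lemma gram_bound:
  assumes A: "finite A" and diag: "\<And>a. a \<in> A \<Longrightarrow> (\<Sum>k\<in>K. (g a k)\<^sup>2) \<le> D"
    and cross: "\<And>a. a \<in> A \<Longrightarrow> (\<Sum>b\<in>A - {a}. (\<Sum>k\<in>K. g a k * g b k)\<^sup>2) \<le> E"
    and F: "real (card A) * E \<le> F\<^sup>2" "F \<ge> 0"
  shows "(\<Sum>k\<in>K. (\<Sum>a\<in>A. g a k * z a)\<^sup>2) \<le> (D + F) * (\<Sum>a\<in>A. (z a)\<^sup>2)"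
proof -
  interpret density_matrix A "\<lambda>a b. z a * z b"
  proof
    fix y :: "'a \<Rightarrow> real"
    have "(\<Sum>a\<in>A. \<Sum>b\<in>A. y a * y b * (z a * z b)) = (\<Sum>a\<in>A. y a * z a) * (\<Sum>b\<in>A. y b * z b)"
      unfolding sum_product by (intro sum.cong refl) simp
    then show "0 \<le> (\<Sum>a\<in>A. \<Sum>b\<in>A. y a * y b * (z a * z b))" by simp
  qed (use A in auto)
  define V where "V a b = (\<Sum>k\<in>K. g a k * g b k)" for a b
  have "(\<Sum>k\<in>K. (\<Sum>a\<in>A. g a k * z a)\<^sup>2) = (\<Sum>k\<in>K. \<Sum>a\<in>A. \<Sum>b\<in>A. g a k * g b k * (z a * z b))"
    unfolding power2_eq_square sum_product by (intro sum.cong refl) simp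
  also have "\<dots> = (\<Sum>a\<in>A. \<Sum>k\<in>K. \<Sum>b\<in>A. g a k * g b k * (z a * z b))"
    by (rule sum.swap)
  also have "\<dots> = (\<Sum>a\<in>A. \<Sum>b\<in>A. \<Sum>k\<in>K. g a k * g b k * (z a * z b))"
    by (rule sum.cong[OF refl], rule sum.swap)
  also have "\<dots> = (\<Sum>a\<in>A. \<Sum>b\<in>A. V a b * (z a * z b))"
    by (simp only: V_def sum_distrib_right)
  also have "\<dots> \<le> (D + F) * trQ"
  proof (rule pairing_le_diag_plus_frobenius)
    show "V a a \<le> D" if "a \<in> A" for a
      using diag[OF that] by (simp add: V_def power2_eq_square)
    have "(\<Sum>a\<in>A. \<Sum>b\<in>A - {a}. (V a b)\<^sup>2) \<le> (\<Sum>a\<in>A. E)"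
      unfolding V_def by (intro sum_mono cross)
    then show "(\<Sum>a\<in>A. \<Sum>b\<in>A - {a}. (V a b)\<^sup>2) \<le> F\<^sup>2" using F(1) by simp
  qed (rule F(2))
  also have "trQ = (\<Sum>a\<in>A. (z a)\<^sup>2)" by (simp add: trQ_def power2_eq_square)
  finally show ?thesis .
qed

text \<open>Intended for a good tensor \<open>G'\<close> obtained from \<open>G\<close> by flipping
  signs in the rows in \<open>S\<close>. Being good need not survive such flips, but fibre norms see
  only squares and the stacked slices only rows outside \<open>S\<close>, so these consequences pass
  from \<open>G'\<close> to \<open>G\<close>.\<close>

lemma good_tensor_bounds:
  assumes good: "good_tensor n G'" and sq: "\<And>j. (G j)\<^sup>2 = (G' j)\<^sup>2"
    and off: "\<And>i c d. c \<notin> S \<Longrightarrow> G (i, c, d) = G' (i, c, d)"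
  shows "i < n \<Longrightarrow> b < n \<Longrightarrow> (\<Sum>a<n. (G (i, a, b))\<^sup>2) \<le> 64 * real n"
    and "i < n \<Longrightarrow> a < n \<Longrightarrow> (\<Sum>b<n. (G (i, a, b))\<^sup>2) \<le> 64 * real n"
    and "(\<Sum>i<n. \<Sum>c\<in>{..<n} - S. (\<Sum>d<n. G (i, c, d) * z d)\<^sup>2) \<le> (128 * (real n)\<^sup>2) * (\<Sum>d<n. (z d)\<^sup>2)"
    and "(\<Sum>i<n. \<Sum>d<n. (\<Sum>c\<in>{..<n} - S. G (i, c, d) * z c)\<^sup>2) \<le> (128 * (real n)\<^sup>2) * (\<Sum>c<n. (z c)\<^sup>2)"
proof -
  have fib: "\<And>a b. a < n \<Longrightarrow> b < n \<Longrightarrow> (\<Sum>k<n. (G' (a, k, b))\<^sup>2) \<le> 64 * real n"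
    "\<And>a b. a < n \<Longrightarrow> b < n \<Longrightarrow> (\<Sum>k<n. (G' (a, b, k))\<^sup>2) \<le> 64 * real n"
    using good_tensorD[OF good] by blast+
  show "i < n \<Longrightarrow> b < n \<Longrightarrow> (\<Sum>a<n. (G (i, a, b))\<^sup>2) \<le> 64 * real n"
    "i < n \<Longrightarrow> a < n \<Longrightarrow> (\<Sum>b<n. (G (i, a, b))\<^sup>2) \<le> 64 * real n"
    using fib by (simp_all add: sq)
  have e: "64 * (real n)\<^sup>2 + 64 * (real n)\<^sup>2 = 128 * (real n)\<^sup>2" by simp
  have EF: "real m * (64 * real n * (64 * (real n)\<^sup>2)) \<le> (64 * (real n)\<^sup>2)\<^sup>2" if "m \<le> n" for m
  proof -
    have "real m * (64 * real n * (64 * (real n)\<^sup>2)) \<le> real n * (64 * real n * (64 * (real n)\<^sup>2))"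
      using that by (intro mult_right_mono) auto
    also have "\<dots> = (64 * (real n)\<^sup>2)\<^sup>2" by (simp add: power2_eq_square)
    finally show ?thesis .
  qed
  have rows: "(\<Sum>k\<in>sqidx n. (G' (fst k, a, snd k))\<^sup>2) \<le> 64 * (real n)\<^sup>2" if "a < n" for a
  proof -
    have "(\<Sum>k\<in>sqidx n. (G' (fst k, a, snd k))\<^sup>2) \<le> (\<Sum>i<n. 64 * real n)"
      unfolding sum_sqidx using that fib by (intro sum_mono) auto
    then show ?thesis by (simp add: power2_eq_square)
  qed
  have cols: "(\<Sum>k\<in>sqidx n. (G' (fst k, snd k, a))\<^sup>2) \<le> 64 * (real n)\<^sup>2" if "a < n" for a
  proof -
    have "(\<Sum>k\<in>sqidx n. (G' (fst k, snd k, a))\<^sup>2) \<le> (\<Sum>i<n. 64 * real n)"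
      unfolding sum_sqidx using that fib by (intro sum_mono) auto
    then show ?thesis by (simp add: power2_eq_square)
  qed
  show "(\<Sum>i<n. \<Sum>c\<in>{..<n} - S. (\<Sum>d<n. G (i, c, d) * z d)\<^sup>2) \<le> (128 * (real n)\<^sup>2) * (\<Sum>d<n. (z d)\<^sup>2)"
  proof -
    have "(\<Sum>i<n. \<Sum>c\<in>{..<n} - S. (\<Sum>d<n. G (i, c, d) * z d)\<^sup>2)
        = (\<Sum>i<n. \<Sum>c\<in>{..<n} - S. (\<Sum>d<n. G' (i, c, d) * z d)\<^sup>2)"
      by (intro sum.cong refl) (simp add: off)
    also have "\<dots> \<le> (\<Sum>i<n. \<Sum>c<n. (\<Sum>d<n. G' (i, c, d) * z d)\<^sup>2)"
      by (intro sum_mono sum_mono2) auto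
    also have "\<dots> = (\<Sum>k\<in>sqidx n. (\<Sum>d<n. G' (fst k, snd k, d) * z d)\<^sup>2)"
      by (simp add: sum_sqidx)
    also have "\<dots> \<le> (64 * (real n)\<^sup>2 + 64 * (real n)\<^sup>2) * (\<Sum>d<n. (z d)\<^sup>2)"
    proof (rule gram_bound)
      show "(\<Sum>b\<in>{..<n} - {a}. (\<Sum>k\<in>sqidx n. G' (fst k, snd k, a) * G' (fst k, snd k, b))\<^sup>2)
          \<le> 64 * real n * (64 * (real n)\<^sup>2)" if "a \<in> {..<n}" for a
      proof -
        have "(\<Sum>b\<in>{..<n} - {a}. (\<Sum>k\<in>sqidx n. G' (fst k, snd k, a) * G' (fst k, snd k, b))\<^sup>2)
            \<le> 64 * real n * (\<Sum>k\<in>sqidx n. (G' (fst k, snd k, a))\<^sup>2)"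
          using good_tensorD(5)[OF good, of a] that by blast
        also have "\<dots> \<le> 64 * real n * (64 * (real n)\<^sup>2)"
          using that by (intro mult_left_mono cols) auto
        finally show ?thesis .
      qed
      show "real (card {..<n}) * (64 * real n * (64 * (real n)\<^sup>2)) \<le> (64 * (real n)\<^sup>2)\<^sup>2"
        using EF[of n] by simp
    qed (use cols in auto)
    finally show ?thesis unfolding e .
  qed
  show "(\<Sum>i<n. \<Sum>d<n. (\<Sum>c\<in>{..<n} - S. G (i, c, d) * z c)\<^sup>2) \<le> (128 * (real n)\<^sup>2) * (\<Sum>c<n. (z c)\<^sup>2)"
  proof -
    have "(\<Sum>i<n. \<Sum>d<n. (\<Sum>c\<in>{..<n} - S. G (i, c, d) * z c)\<^sup>2)
        = (\<Sum>k\<in>sqidx n. (\<Sum>c\<in>{..<n} - S. G' (fst k, c, snd k) * z c)\<^sup>2)"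
      by (simp add: sum_sqidx off)
    also have "\<dots> \<le> (64 * (real n)\<^sup>2 + 64 * (real n)\<^sup>2) * (\<Sum>c\<in>{..<n} - S. (z c)\<^sup>2)"
    proof (rule gram_bound)
      show "(\<Sum>b\<in>{..<n} - S - {a}. (\<Sum>k\<in>sqidx n. G' (fst k, a, snd k) * G' (fst k, b, snd k))\<^sup>2)
          \<le> 64 * real n * (64 * (real n)\<^sup>2)" if "a \<in> {..<n} - S" for a
      proof -
        have "(\<Sum>b\<in>{..<n} - S - {a}. (\<Sum>k\<in>sqidx n. G' (fst k, a, snd k) * G' (fst k, b, snd k))\<^sup>2)
            \<le> (\<Sum>b\<in>{..<n} - {a}. (\<Sum>k\<in>sqidx n. G' (fst k, a, snd k) * G' (fst k, b, snd k))\<^sup>2)"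
          by (rule sum_mono2) auto
        also have "\<dots> \<le> 64 * real n * (\<Sum>k\<in>sqidx n. (G' (fst k, a, snd k))\<^sup>2)"
          using good_tensorD(4)[OF good, of a] that by blast
        also have "\<dots> \<le> 64 * real n * (64 * (real n)\<^sup>2)"
          using that by (intro mult_left_mono rows) auto
        finally show ?thesis .
      qed
      have "card ({..<n} - S) \<le> n"
        using card_mono[of "{..<n}" "{..<n} - S"] by simp
      then show "real (card ({..<n} - S)) * (64 * real n * (64 * (real n)\<^sup>2)) \<le> (64 * (real n)\<^sup>2)\<^sup>2"
        by (rule EF)
    qed (use rows in auto)
    also have "\<dots> \<le> (64 * (real n)\<^sup>2 + 64 * (real n)\<^sup>2) * (\<Sum>c<n. (z c)\<^sup>2)"
      by (intro mult_left_mono sum_mono2) auto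
    finally show ?thesis unfolding e .
  qed
qed

text \<open>Membership is prescribed at \<open>a\<close> and \<open>c\<close> and free
  elsewhere.\<close>

lemma split_count:
  assumes "a < n" "c < n" "a \<noteq> c"
  shows "4 * card {S \<in> Pow {..<n}. a \<in> S \<and> c \<notin> S} = 2 ^ n"
proof -
  have "{S \<in> Pow {..<n}. a \<in> S \<and> c \<notin> S} = insert a ` Pow ({..<n} - {a, c})"
  proof (intro equalityI subsetI)
    fix S assume "S \<in> {S \<in> Pow {..<n}. a \<in> S \<and> c \<notin> S}"
    then have "S = insert a (S - {a})" "S - {a} \<in> Pow ({..<n} - {a, c})" by auto
    then show "S \<in> insert a ` Pow ({..<n} - {a, c})" by (rule image_eqI)
  qed (use assms in auto)
  moreover have "inj_on (insert a) (Pow ({..<n} - {a, c}))"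
  proof (rule inj_onI)
    fix S T assume "S \<in> Pow ({..<n} - {a, c})" "T \<in> Pow ({..<n} - {a, c})" and e: "insert a S = insert a T"
    then have "a \<notin> S" "a \<notin> T" by auto
    with e show "S = T" by (simp add: insert_ident)
  qed
  moreover have "card ({..<n} - {a, c}) = n - 2"
    using assms by (subst card_Diff_subset) auto
  ultimately have "card {S \<in> Pow {..<n}. a \<in> S \<and> c \<notin> S} = 2 ^ (n - 2)"
    by (simp add: card_image card_Pow)
  moreover have "n = Suc (Suc (n - 2))" using assms by linarith
  then have "(2 :: nat) ^ n = 2 * (2 * 2 ^ (n - 2))" by (metis power_Suc)
  ultimately show ?thesis by simp
qed

text \<open>The part of \<open>\<Sum>\<^sub>i q\<^sub>i\<^sup>2\<close> with two distinct row indices is four times the average, over all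
  bipartitions of the rows, of the part whose rows lie on different sides.\<close>

lemma moment_of_quadratic_slices_le:
  assumes L: "sphere_pe4 n L" and good: "good_tensor n G" and s: "s > 0"
    and M: "(\<Sum>S\<in>Pow {..<n}. tr (actl (splitsum n S G) (2 ^ Suc k - 1) (splitsum n S G))) \<le> 2 ^ n * s ^ (2 ^ Suc k)"
  shows "(\<Sum>i<n. \<Sum>a<n. \<Sum>b<n. \<Sum>c<n. \<Sum>d<n. G (i, a, b) * G (i, c, d) * L {#a, b, c, d#})
    \<le> 128 * (real n * sqrt (real n)) + 8 * s"
proof -
  define h where "h a c = (\<Sum>i<n. \<Sum>b<n. \<Sum>d<n. G (i, a, b) * G (i, c, d) * L {#a, b, c, d#})" for a c
  have reorg: "(\<Sum>i<n. \<Sum>a\<in>A. \<Sum>b<n. \<Sum>c\<in>C. \<Sum>d<n. G (i, a, b) * G (i, c, d) * L {#a, b, c, d#})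
      = (\<Sum>a\<in>A. \<Sum>c\<in>C. h a c)" for A C
  proof -
    have "(\<Sum>i<n. \<Sum>a\<in>A. \<Sum>b<n. \<Sum>c\<in>C. \<Sum>d<n. G (i, a, b) * G (i, c, d) * L {#a, b, c, d#})
        = (\<Sum>a\<in>A. \<Sum>i<n. \<Sum>b<n. \<Sum>c\<in>C. \<Sum>d<n. G (i, a, b) * G (i, c, d) * L {#a, b, c, d#})"
      by (rule sum.swap)
    also have "\<dots> = (\<Sum>a\<in>A. \<Sum>i<n. \<Sum>c\<in>C. \<Sum>b<n. \<Sum>d<n. G (i, a, b) * G (i, c, d) * L {#a, b, c, d#})"
      by (intro sum.cong[OF refl], rule sum.swap)
    also have "\<dots> = (\<Sum>a\<in>A. \<Sum>c\<in>C. h a c)"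
      unfolding h_def by (rule sum.cong[OF refl], rule sum.swap)
    finally show ?thesis .
  qed
  \<comment> \<open>With a shared row, \<open>h a a\<close> pairs a block of the moment matrix with
    the Gram matrix of the fibres along the first index; its Frobenius part, of order
    \<open>n * sqrt n\<close>, stays within the target.\<close>
  have diag: "(\<Sum>a<n. h a a) \<le> 128 * (real n * sqrt (real n))"
  proof -
    have "h a a \<le> 128 * (real n * sqrt (real n)) * (\<Sum>b<n. moment2 L (a, b) (a, b))" if a: "a < n" for a
    proof -
      interpret density_matrix "{..<n}" "\<lambda>b d. moment2 L (a, b) (a, d)"
        by (rule density_matrix_slice[OF L a])
      define V where "V b d = (\<Sum>i<n. G (i, a, b) * G (i, a, d))" for b d
      have fib: "(\<Sum>i<n. (G (i, a, b))\<^sup>2) \<le> 64 * real n" if "b < n" for b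
        by (rule good_tensorD(1)[OF good a that])
      have "h a a = (\<Sum>b<n. \<Sum>d<n. V b d * moment2 L (a, b) (a, d))"
      proof -
        have "h a a = (\<Sum>b<n. \<Sum>i<n. \<Sum>d<n. G (i, a, b) * G (i, a, d) * L {#a, b, a, d#})"
          unfolding h_def by (rule sum.swap)
        also have "\<dots> = (\<Sum>b<n. \<Sum>d<n. \<Sum>i<n. G (i, a, b) * G (i, a, d) * L {#a, b, a, d#})"
          by (rule sum.cong[OF refl], rule sum.swap)
        finally show ?thesis
          by (simp add: V_def sum_distrib_right moment2_def add_mset_commute)
      qed
      also have "\<dots> \<le> (64 * real n + 64 * (real n * sqrt (real n))) * trQ"
      proof (rule pairing_le_diag_plus_frobenius)
        show "V b b \<le> 64 * real n" if "b \<in> {..<n}" for b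
          using fib[of b] that by (simp add: V_def power2_eq_square)
        have "(\<Sum>b<n. \<Sum>d\<in>{..<n} - {b}. (V b d)\<^sup>2) \<le> (\<Sum>b<n. 64 * real n * (64 * real n))"
        proof (rule sum_mono)
          fix b assume b: "b \<in> {..<n}"
          then have "(\<Sum>d\<in>{..<n} - {b}. (V b d)\<^sup>2) \<le> 64 * real n * (\<Sum>i<n. (G (i, a, b))\<^sup>2)"
            using good_tensorD(6)[OF good a, of b] unfolding V_def by simp
          also have "\<dots> \<le> 64 * real n * (64 * real n)"
            using b by (intro mult_left_mono fib) auto
          finally show "(\<Sum>d\<in>{..<n} - {b}. (V b d)\<^sup>2) \<le> 64 * real n * (64 * real n)" .
        qed
        also have "\<dots> = (64 * (real n * sqrt (real n)))\<^sup>2"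
          by (simp add: power_mult_distrib) (simp add: power2_eq_square)
        finally show "(\<Sum>b<n. \<Sum>d\<in>{..<n} - {b}. (V b d)\<^sup>2) \<le> (64 * (real n * sqrt (real n)))\<^sup>2" .
      qed simp
      also have "\<dots> \<le> (128 * (real n * sqrt (real n))) * trQ"
      proof (rule mult_right_mono[OF _ trQ_nonneg])
        have "real n * 1 \<le> real n * sqrt (real n)" using a by (intro mult_left_mono) auto
        then show "64 * real n + 64 * (real n * sqrt (real n)) \<le> 128 * (real n * sqrt (real n))" by simp
      qed
      finally show ?thesis by (simp only: trQ_def)
    qed
    then have "(\<Sum>a<n. h a a) \<le> (\<Sum>a<n. 128 * (real n * sqrt (real n)) * (\<Sum>b<n. moment2 L (a, b) (a, b)))"
      by (intro sum_mono) auto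
    also have "\<dots> = 128 * (real n * sqrt (real n)) * (\<Sum>\<alpha>\<in>sqidx n. moment2 L \<alpha> \<alpha>)"
      by (simp only: sum_sqidx sum_distrib_left)
    also have "(\<Sum>\<alpha>\<in>sqidx n. moment2 L \<alpha> \<alpha>) = 1"
      using density_matrix_moment2(2)[OF L]
      by (simp only: density_matrix.trQ_def[OF density_matrix_moment2(1)[OF L]])
    finally show ?thesis by simp
  qed
  have offdiag: "(\<Sum>a<n. \<Sum>c\<in>{..<n} - {a}. h a c) \<le> 8 * s"
  proof -
    interpret density_matrix "sqidx n" "moment2 L" by (rule density_matrix_moment2[OF L])
    have y: "pairing (splitsum n S G) \<le> s * (1 + tr (actl (splitsum n S G) (2 ^ Suc k - 1) (splitsum n S G)) / s ^ (2 ^ Suc k))" for S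
    proof -
      define X where "X = splitsum n S G"
      have "tp X = X" "idx X \<subseteq> sqidx n"
        unfolding X_def by (rule tp_splitsum idx_splitsum)+
      then have p: "pairing X ^ (2 ^ Suc k) \<le> tr (actl X (2 ^ Suc k - 1) X)"
        by (rule pairing_power_le_tr[OF density_matrix_moment2(2)[OF L]])
      define x where "x = pairing X / s"
      \<comment> \<open>The hypothesis \<open>M\<close> controls the traces only on average over
        \<open>S\<close>. This bound is linear in the even power, so it can be averaged without
        extracting a root for each \<open>S\<close>.\<close>
      have "x \<le> 1 + x ^ (2 ^ Suc k)"
      proof (cases "x \<le> 1")
        case True
        have "0 \<le> x ^ (2 ^ Suc k)" by (rule zero_le_even_power) simp
        with True show ?thesis by linarith
      next
        case False
        then have "x ^ 1 \<le> x ^ (2 ^ Suc k)" by (intro power_increasing) auto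
        then show ?thesis unfolding power_one_right by linarith
      qed
      then have "pairing X \<le> s * (1 + x ^ (2 ^ Suc k))" using s by (simp add: x_def field_simps)
      also have "\<dots> \<le> s * (1 + tr (actl X (2 ^ Suc k - 1) X) / s ^ (2 ^ Suc k))"
        using p s unfolding x_def power_divide
        by (intro mult_left_mono add_left_mono divide_right_mono) auto
      finally show ?thesis by (simp only: X_def)
    qed
    have "(\<Sum>S\<in>Pow {..<n}. pairing (splitsum n S G))
        \<le> (\<Sum>S\<in>Pow {..<n}. s * (1 + tr (actl (splitsum n S G) (2 ^ Suc k - 1) (splitsum n S G)) / s ^ (2 ^ Suc k)))"
      by (intro sum_mono y)
    also have "\<dots> = s * (2 ^ n + (\<Sum>S\<in>Pow {..<n}. tr (actl (splitsum n S G) (2 ^ Suc k - 1) (splitsum n S G))) / s ^ (2 ^ Suc k))"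
      by (simp only: sum_distrib_left[symmetric] sum.distrib sum_divide_distrib[symmetric]) (simp add: card_Pow)
    also have "\<dots> \<le> s * (2 ^ n + 2 ^ n)"
      using M s by (intro mult_left_mono add_left_mono) (auto simp: pos_divide_le_eq)
    finally have up: "(\<Sum>S\<in>Pow {..<n}. pairing (splitsum n S G)) \<le> 2 * s * 2 ^ n" by simp
    have "(\<Sum>S\<in>Pow {..<n}. pairing (splitsum n S G))
        = (\<Sum>S\<in>Pow {..<n}. \<Sum>a<n. \<Sum>c<n. if a \<in> S \<and> c \<notin> S then h a c else 0)"
    proof (rule sum.cong[OF refl])
      fix S
      have "pairing (splitsum n S G) = (\<Sum>a\<in>{..<n} \<inter> S. \<Sum>c\<in>{..<n} - S. h a c)"
        unfolding pairing_splitsum[OF L] by (rule reorg)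
      also have "\<dots> = (\<Sum>a<n. if a \<in> S then (\<Sum>c\<in>{..<n} - S. h a c) else 0)"
        by (simp add: sum.inter_restrict)
      also have "\<dots> = (\<Sum>a<n. \<Sum>c<n. if a \<in> S \<and> c \<notin> S then h a c else 0)"
        by (intro sum.cong refl) (simp add: sum_if_notin)
      finally show "pairing (splitsum n S G) = (\<Sum>a<n. \<Sum>c<n. if a \<in> S \<and> c \<notin> S then h a c else 0)" .
    qed
    also have "\<dots> = (\<Sum>a<n. \<Sum>S\<in>Pow {..<n}. \<Sum>c<n. if a \<in> S \<and> c \<notin> S then h a c else 0)"
      by (rule sum.swap)
    also have "\<dots> = (\<Sum>a<n. \<Sum>c<n. \<Sum>S\<in>Pow {..<n}. if a \<in> S \<and> c \<notin> S then h a c else 0)"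
      by (rule sum.cong[OF refl], rule sum.swap)
    also have "\<dots> = (\<Sum>a<n. \<Sum>c\<in>{..<n} - {a}. 2 ^ n / 4 * h a c)"
    proof (rule sum.cong[OF refl])
      fix a assume a: "a \<in> {..<n}"
      have "(\<Sum>S\<in>Pow {..<n}. if a \<in> S \<and> c \<notin> S then h a c else 0) = (if c = a then 0 else 2 ^ n / 4 * h a c)"
        if c: "c < n" for c
      proof (cases "c = a")
        case False
        have "(\<Sum>S\<in>Pow {..<n}. if a \<in> S \<and> c \<notin> S then h a c else 0)
            = (\<Sum>S\<in>{S \<in> Pow {..<n}. a \<in> S \<and> c \<notin> S}. h a c)"
          by (rule sum.inter_filter[symmetric]) simp
        also have "\<dots> = real (card {S \<in> Pow {..<n}. a \<in> S \<and> c \<notin> S}) * h a c" by simp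
        also have "real (card {S \<in> Pow {..<n}. a \<in> S \<and> c \<notin> S}) = 2 ^ n / 4"
        proof -
          have "real (4 * card {S \<in> Pow {..<n}. a \<in> S \<and> c \<notin> S}) = real (2 ^ n)"
            using a c False by (subst split_count) auto
          then show ?thesis by simp
        qed
        finally show ?thesis using False by simp
      qed auto
      then have "(\<Sum>c<n. \<Sum>S\<in>Pow {..<n}. if a \<in> S \<and> c \<notin> S then h a c else 0)
          = (\<Sum>c<n. if c = a then 0 else 2 ^ n / 4 * h a c)"
        by (intro sum.cong) auto
      also have "\<dots> = (\<Sum>c\<in>{..<n} - {a}. 2 ^ n / 4 * h a c)"
        by (rule sum.mono_neutral_cong_right) auto
      finally show "(\<Sum>c<n. \<Sum>S\<in>Pow {..<n}. if a \<in> S \<and> c \<notin> S then h a c else 0)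
          = (\<Sum>c\<in>{..<n} - {a}. 2 ^ n / 4 * h a c)" .
    qed
    also have "\<dots> = 2 ^ n / 4 * (\<Sum>a<n. \<Sum>c\<in>{..<n} - {a}. h a c)"
      by (simp only: sum_distrib_left)
    \<comment> \<open>The average over bipartitions sees a quarter of the off-diagonal total, so the
      bound \<open>2 * s\<close> becomes \<open>8 * s\<close>.\<close>
    finally have "2 ^ n / 4 * (\<Sum>a<n. \<Sum>c\<in>{..<n} - {a}. h a c) \<le> 2 * s * 2 ^ n"
      using up by linarith
    then have "2 ^ n * (\<Sum>a<n. \<Sum>c\<in>{..<n} - {a}. h a c) \<le> 2 ^ n * (8 * s)" by simp
    then show ?thesis by (subst (asm) mult_le_cancel_left_pos) auto
  qed
  have "(\<Sum>a<n. \<Sum>c<n. h a c) = (\<Sum>a<n. h a a + (\<Sum>c\<in>{..<n} - {a}. h a c))"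
    by (intro sum.cong refl sum.remove) auto
  then have "(\<Sum>a<n. \<Sum>c<n. h a c) = (\<Sum>a<n. h a a) + (\<Sum>a<n. \<Sum>c\<in>{..<n} - {a}. h a c)"
    by (simp only: sum.distrib)
  then show ?thesis unfolding reorg using diag offdiag by linarith
qed

section \<open>The probability estimate\<close>

abbreviation cube :: "nat \<Rightarrow> (nat \<times> nat \<times> nat) set" where
  "cube n \<equiv> {..<n} \<times> {..<n} \<times> {..<n}"

lemma splitidx_subset_cube: "splitidx n S \<subseteq> cube n"
  by (auto simp: splitidx_def)

lemma ennreal_two_power: "ennreal (2 ^ c) = 2 ^ c"
  using ennreal_power[of 2 c] by simp

text \<open>Of the rate 16, one unit is spent on \<open>sqrt 2 ^ c\<close>, bounded crudely by
  \<open>exp n\<close>.\<close>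

lemma tail_constant_le: "c \<le> n \<Longrightarrow> sqrt 2 ^ c * exp (- (64 * real n) / 4) \<le> exp (- 15 * real n)"
proof -
  assume c: "c \<le> n"
  have "sqrt 2 \<le> exp (1 :: real)"
    using exp_ge_add_one_self[of 1] sqrt2_less_2 by linarith
  then have "sqrt 2 ^ c \<le> exp 1 ^ c" by (intro power_mono) auto
  also have "\<dots> \<le> exp 1 ^ n" by (intro power_increasing c) simp
  also have "\<dots> = exp (real n)" by (simp add: exp_of_nat_mult[symmetric])
  finally have "sqrt 2 ^ c * exp (- (64 * real n) / 4) \<le> exp (real n) * exp (- (64 * real n) / 4)"
    by (intro mult_right_mono) auto
  also have "\<dots> = exp (- 15 * real n)" by (simp add: exp_add[symmetric])
  finally show ?thesis .
qed

lemma fibre_tail: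
  assumes "inj_on \<phi> {..<n}" "\<phi> ` {..<n} \<subseteq> cube n"
  shows "emeasure (gauss (cube n)) {G \<in> space (gauss (cube n)). 64 * real n < (\<Sum>k<n. (G (\<phi> k))\<^sup>2)}
    \<le> ennreal (exp (- 15 * real n))"
proof -
  have "emeasure (gauss (cube n)) {G \<in> space (gauss (cube n)). 64 * real n < (\<Sum>j\<in>\<phi> ` {..<n}. (G j)\<^sup>2)}
      \<le> ennreal (sqrt 2 ^ card (\<phi> ` {..<n}) * exp (- (64 * real n) / 4))"
    by (rule gauss_square_tail) (use assms in auto)
  also have "\<dots> \<le> ennreal (exp (- 15 * real n))"
    using card_image[OF assms(1)] by (intro ennreal_leI tail_constant_le) simp
  finally show ?thesis by (simp only: sum.reindex[OF assms(1)] o_def)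
qed

lemma cross_tail:
  assumes "a < n" "finite K" "inj_on (\<lambda>(b, k). \<beta> b k) (({..<n} - {a}) \<times> K)"
    and "\<And>b k. b < n \<Longrightarrow> k \<in> K \<Longrightarrow> \<beta> b k \<in> cube n"
    and "\<And>b k k'. b < n \<Longrightarrow> b \<noteq> a \<Longrightarrow> k \<in> K \<Longrightarrow> k' \<in> K \<Longrightarrow> \<beta> b k \<noteq> \<beta> a k'"
  shows "emeasure (gauss (cube n)) {G \<in> space (gauss (cube n)).
      64 * real n * (\<Sum>k\<in>K. (G (\<beta> a k))\<^sup>2) < (\<Sum>b\<in>{..<n} - {a}. (\<Sum>k\<in>K. G (\<beta> a k) * G (\<beta> b k))\<^sup>2)}
    \<le> ennreal (exp (- 15 * real n))"
proof -
  have "emeasure (gauss (cube n)) {G \<in> space (gauss (cube n)).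
      64 * real n * (\<Sum>k\<in>K. (G (\<beta> a k))\<^sup>2)
        < (\<Sum>b\<in>{..<n} - {a}. (\<Sum>k\<in>K. G (\<beta> a k) * G ((\<lambda>(b, k). \<beta> b k) (b, k)))\<^sup>2)}
    \<le> ennreal (sqrt 2 ^ card ({..<n} - {a}) * exp (- (64 * real n) / 4))"
  proof (rule gauss_cross_tail)
    show "finite (cube n)" "finite ({..<n} - {a})" by simp_all
    show "finite K" "inj_on (\<lambda>(b, k). \<beta> b k) (({..<n} - {a}) \<times> K)" by (rule assms)+
    show "(\<lambda>(b, k). \<beta> b k) ` (({..<n} - {a}) \<times> K) \<subseteq> cube n"
    proof (rule image_subsetI)
      fix q assume "q \<in> ({..<n} - {a}) \<times> K"
      then obtain b k where "q = (b, k)" "b < n" "k \<in> K" by blast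
      then show "(\<lambda>(b, k). \<beta> b k) q \<in> cube n" using assms(4)[of b k] by simp
    qed
    show "\<beta> a ` K \<subseteq> cube n"
      using assms(4)[OF assms(1)] by (rule image_subsetI)
    show "\<beta> a ` K \<inter> (\<lambda>(b, k). \<beta> b k) ` (({..<n} - {a}) \<times> K) = {}"
    proof (rule equals0I)
      fix y assume y: "y \<in> \<beta> a ` K \<inter> (\<lambda>(b, k). \<beta> b k) ` (({..<n} - {a}) \<times> K)"
      then obtain k' where k': "k' \<in> K" "y = \<beta> a k'" by blast
      from y obtain q where "q \<in> ({..<n} - {a}) \<times> K" "y = (\<lambda>(b, k). \<beta> b k) q" by blast
      then have "fst q < n" "fst q \<noteq> a" "snd q \<in> K" "y = \<beta> (fst q) (snd q)" by (auto split: prod.splits)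
      then show False using assms(5)[of "fst q" "snd q" k'] k' by simp
    qed
  qed
  also have "\<dots> \<le> ennreal (exp (- 15 * real n))"
    by (intro ennreal_leI tail_constant_le) (simp add: card_Diff_singleton_if)
  finally show ?thesis by simp
qed

lemma not_good_tensor_tail:
  "emeasure (gauss (cube n)) {G \<in> space (gauss (cube n)). \<not> good_tensor n G}
    \<le> ennreal (6 * (real n)\<^sup>2 * exp (- 15 * real n))"
proof -
  let ?M = "gauss (cube n)"
  define d where "d = ennreal (exp (- 15 * real n))"
  define A1 where "A1 ab = {G \<in> space ?M. 64 * real n < (\<Sum>k<n. (G (k, fst ab, snd ab))\<^sup>2)}" for ab
  define A2 where "A2 ab = {G \<in> space ?M. 64 * real n < (\<Sum>k<n. (G (fst ab, k, snd ab))\<^sup>2)}" for ab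
  define A3 where "A3 ab = {G \<in> space ?M. 64 * real n < (\<Sum>k<n. (G (fst ab, snd ab, k))\<^sup>2)}" for ab
  \<comment> \<open>\<open>A4\<close> and \<open>A5\<close> depend only on the first component;
    indexing them by pairs as well allows one union bound over \<open>sqidx n\<close> for all six
    families.\<close>
  define A4 where "A4 ab = {G \<in> space ?M. 64 * real n * (\<Sum>k\<in>sqidx n. (G (fst k, fst ab, snd k))\<^sup>2)
    < (\<Sum>b\<in>{..<n} - {fst ab}. (\<Sum>k\<in>sqidx n. G (fst k, fst ab, snd k) * G (fst k, b, snd k))\<^sup>2)}" for ab :: "nat \<times> nat"
  define A5 where "A5 ab = {G \<in> space ?M. 64 * real n * (\<Sum>k\<in>sqidx n. (G (fst k, snd k, fst ab))\<^sup>2)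
    < (\<Sum>b\<in>{..<n} - {fst ab}. (\<Sum>k\<in>sqidx n. G (fst k, snd k, fst ab) * G (fst k, snd k, b))\<^sup>2)}" for ab :: "nat \<times> nat"
  define A6 where "A6 ab = {G \<in> space ?M. 64 * real n * (\<Sum>k<n. (G (k, fst ab, snd ab))\<^sup>2)
    < (\<Sum>b\<in>{..<n} - {snd ab}. (\<Sum>k<n. G (k, fst ab, snd ab) * G (k, fst ab, b))\<^sup>2)}" for ab
  note defs = A1_def A2_def A3_def A4_def A5_def A6_def
  have meas: "A1 ab \<in> sets ?M" "A2 ab \<in> sets ?M" "A3 ab \<in> sets ?M"
      "A4 ab \<in> sets ?M" "A5 ab \<in> sets ?M" "A6 ab \<in> sets ?M" for ab
    unfolding defs by measurable
  have bnd: "emeasure ?M (A1 (a, b)) \<le> d" "emeasure ?M (A2 (a, b)) \<le> d" "emeasure ?M (A3 (a, b)) \<le> d"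
      "emeasure ?M (A4 (a, b)) \<le> d" "emeasure ?M (A5 (a, b)) \<le> d" "emeasure ?M (A6 (a, b)) \<le> d"
    if "a < n" "b < n" for a b
    unfolding defs d_def fst_conv snd_conv
    using that fibre_tail[of "\<lambda>k. (k, a, b)" n] fibre_tail[of "\<lambda>k. (a, k, b)" n] fibre_tail[of "\<lambda>k. (a, b, k)" n]
      cross_tail[of a n "sqidx n" "\<lambda>b k. (fst k, b, snd k)"]
      cross_tail[of a n "sqidx n" "\<lambda>b k. (fst k, snd k, b)"]
      cross_tail[of b n "{..<n}" "\<lambda>b k. (k, a, b)"]
    by (auto simp: inj_on_def sqidx_def)
  have "{G \<in> space ?M. \<not> good_tensor n G}
      \<subseteq> (\<Union>ab\<in>sqidx n. A1 ab \<union> (A2 ab \<union> (A3 ab \<union> (A4 ab \<union> (A5 ab \<union> A6 ab)))))"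
  proof
    fix G assume G: "G \<in> {G \<in> space ?M. \<not> good_tensor n G}"
    show "G \<in> (\<Union>ab\<in>sqidx n. A1 ab \<union> (A2 ab \<union> (A3 ab \<union> (A4 ab \<union> (A5 ab \<union> A6 ab)))))"
    proof (rule ccontr)
      assume "G \<notin> (\<Union>ab\<in>sqidx n. A1 ab \<union> (A2 ab \<union> (A3 ab \<union> (A4 ab \<union> (A5 ab \<union> A6 ab)))))"
      then have no: "G \<notin> A1 (a, b)" "G \<notin> A2 (a, b)" "G \<notin> A3 (a, b)" "G \<notin> A4 (a, b)" "G \<notin> A5 (a, b)" "G \<notin> A6 (a, b)"
        if "a < n" "b < n" for a b using that by (auto simp: sqidx_def)
      have "good_tensor n G"
        unfolding good_tensor_def
      proof (intro conjI allI impI)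
        fix a b assume ab: "a < n" "b < n"
        note no = no[OF ab, unfolded defs fst_conv snd_conv]
        show "(\<Sum>k<n. (G (k, a, b))\<^sup>2) \<le> 64 * real n" using no(1) G by simp
        show "(\<Sum>k<n. (G (a, k, b))\<^sup>2) \<le> 64 * real n" using no(2) G by simp
        show "(\<Sum>k<n. (G (a, b, k))\<^sup>2) \<le> 64 * real n" using no(3) G by simp
        show "(\<Sum>d\<in>{..<n} - {b}. (\<Sum>k<n. G (k, a, b) * G (k, a, d))\<^sup>2)
          \<le> 64 * real n * (\<Sum>k<n. (G (k, a, b))\<^sup>2)" using no(6) G by simp
      next
        fix a assume a: "a < n"
        note no = no[OF a a, unfolded defs fst_conv snd_conv]
        show "(\<Sum>b\<in>{..<n} - {a}. (\<Sum>k\<in>sqidx n. G (fst k, a, snd k) * G (fst k, b, snd k))\<^sup>2)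
          \<le> 64 * real n * (\<Sum>k\<in>sqidx n. (G (fst k, a, snd k))\<^sup>2)" using no(4) G by simp
        show "(\<Sum>b\<in>{..<n} - {a}. (\<Sum>k\<in>sqidx n. G (fst k, snd k, a) * G (fst k, snd k, b))\<^sup>2)
          \<le> 64 * real n * (\<Sum>k\<in>sqidx n. (G (fst k, snd k, a))\<^sup>2)" using no(5) G by simp
      qed
      with G show False by simp
    qed
  qed
  then have "emeasure ?M {G \<in> space ?M. \<not> good_tensor n G}
      \<le> emeasure ?M (\<Union>ab\<in>sqidx n. A1 ab \<union> (A2 ab \<union> (A3 ab \<union> (A4 ab \<union> (A5 ab \<union> A6 ab)))))"
    using meas by (intro emeasure_mono sets.finite_UN) (auto intro!: sets.Un)
  also have "\<dots> \<le> (\<Sum>ab\<in>sqidx n. emeasure ?M (A1 ab \<union> (A2 ab \<union> (A3 ab \<union> (A4 ab \<union> (A5 ab \<union> A6 ab))))))"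
    using meas by (intro emeasure_subadditive_finite) (auto intro!: sets.Un)
  also have "\<dots> \<le> (\<Sum>ab\<in>sqidx n. d + (d + (d + (d + (d + d)))))"
  proof (rule sum_mono)
    fix ab assume "ab \<in> sqidx n"
    then obtain a b where ab: "ab = (a, b)" "a < n" "b < n" by (auto simp: sqidx_def)
    have un: "emeasure ?M (U \<union> V) \<le> x + y"
      if "U \<in> sets ?M" "V \<in> sets ?M" "emeasure ?M U \<le> x" "emeasure ?M V \<le> y" for U V x y
      using emeasure_subadditive[OF that(1,2)] add_mono[OF that(3,4)] by (rule order_trans)
    show "emeasure ?M (A1 ab \<union> (A2 ab \<union> (A3 ab \<union> (A4 ab \<union> (A5 ab \<union> A6 ab))))) \<le> d + (d + (d + (d + (d + d))))"
      unfolding ab(1) by (intro un bnd ab sets.Un meas)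
  qed
  also have "\<dots> = of_nat (card (sqidx n)) * (d + (d + (d + (d + (d + d)))))" by simp
  also have "\<dots> = ennreal (6 * (real n)\<^sup>2 * exp (- 15 * real n))"
  proof -
    have "d + (d + (d + (d + (d + d)))) = ennreal (6 * exp (- 15 * real n))"
      unfolding d_def by (simp add: ennreal_plus[symmetric] del: ennreal_plus)
    moreover have "(of_nat (card (sqidx n)) :: ennreal) = ennreal ((real n)\<^sup>2)"
      by (simp add: sqidx_def power2_eq_square ennreal_of_nat_eq_real_of_nat)
    ultimately show ?thesis by (simp add: ennreal_mult[symmetric] mult_ac)
  qed
  finally show ?thesis .
qed

section \<open>Measurability of the good event and of the traces\<close>

lemma pred_good_tensor [measurable]: "Measurable.pred (gauss (cube n)) (good_tensor n)"
proof -
  have all: "Measurable.pred M (\<lambda>G. \<forall>a<n. P a G)" if "\<And>a. Measurable.pred M (P a)"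
    for P and M :: "(nat \<times> nat \<times> nat \<Rightarrow> real) measure"
    by (rule pred_intros_countable(1), rule pred_intros_logic(4)) (use that in simp_all)
  have le: "Measurable.pred M (\<lambda>G. f G \<le> g G)"
    if "f \<in> borel_measurable M" "g \<in> borel_measurable M"
    for f g :: "_ \<Rightarrow> real" and M :: "(nat \<times> nat \<times> nat \<Rightarrow> real) measure"
    unfolding pred_def using that by (rule borel_measurable_le)
  show ?thesis
    unfolding good_tensor_def
    by (intro pred_intros_logic(3) all le borel_measurable_sum borel_measurable_power
        borel_measurable_times borel_measurable_const measurable_gauss_component)
qed

lemma tr_power_measurable:
  assumes I: "finite I" and idx: "\<And>\<omega>. idx (f \<omega>) \<subseteq> I"
    and meas: "\<And>a b. (\<lambda>\<omega>. entry (f \<omega>) a b) \<in> borel_measurable M"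
  shows "(\<lambda>\<omega>. tr (actl (f \<omega>) q (f \<omega>))) \<in> borel_measurable M"
proof -
  have *: "(\<forall>\<omega>. idx (actl (f \<omega>) q (f \<omega>)) \<subseteq> I) \<and> (\<forall>a b. (\<lambda>\<omega>. entry (actl (f \<omega>) q (f \<omega>)) a b) \<in> borel_measurable M)" for q
  proof (induction q)
    case 0
    show ?case using idx meas by simp
  next
    case (Suc q)
    have e: "entry (actl (f \<omega>) (Suc q) (f \<omega>)) a b
        = (\<Sum>c\<in>I. entry (f \<omega>) a c * entry (actl (f \<omega>) q (f \<omega>)) c b)" for \<omega> a b
    proof -
      have "entry (f \<omega> * actl (f \<omega>) q (f \<omega>)) a b
          = (\<Sum>c\<in>I. entry (f \<omega>) a c * entry (actl (f \<omega>) q (f \<omega>)) c b)"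
        by (rule entry_mult[OF I]) (use idx[of \<omega>] in \<open>auto intro!: entry_eq_0\<close>)
      then show ?thesis by simp
    qed
    have "idx (actl (f \<omega>) (Suc q) (f \<omega>)) \<subseteq> I" for \<omega>
      using Suc idx[of \<omega>] by (simp add: idx_mult)
    moreover have "(\<lambda>\<omega>. entry (actl (f \<omega>) (Suc q) (f \<omega>)) a b) \<in> borel_measurable M" for a b
      unfolding e using Suc meas by (intro borel_measurable_sum borel_measurable_times) auto
    ultimately show ?case by blast
  qed
  have t: "tr (actl (f \<omega>) q (f \<omega>)) = (\<Sum>a\<in>I. entry (actl (f \<omega>) q (f \<omega>)) a a)" for \<omega>
    by (rule tr_eq[OF I]) (use *[of q] in \<open>auto intro!: entry_eq_0\<close>)
  show ?thesis
    unfolding t by (rule borel_measurable_sum) (rule *[THEN conjunct2, rule_format])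
qed

lemma tr_even_power_nonneg:
  assumes "tp X = X"
  shows "tr (actl X (2 * m + 1) X) \<ge> 0"
proof -
  have "tr (tp (actl X m X) * actl X m X) = tr (tp X * actl X m (actl X m X))"
    by (rule actl_adj[OF assms])
  also have "\<dots> = tr (actl X (2 * m + 1) X)"
    by (simp add: assms funpow_add mult_2)
  finally show ?thesis using tr_square_nonneg[of "actl X m X"] by simp
qed

definition splittrace :: "nat \<Rightarrow> nat set \<Rightarrow> nat \<Rightarrow> (nat \<times> nat \<times> nat \<Rightarrow> real) \<Rightarrow> real" where
  "splittrace n S m G = tr (actl (splitsum n S G) (2 * m + 1) (splitsum n S G))"

lemma splittrace_nonneg: "splittrace n S m G \<ge> 0"
  unfolding splittrace_def by (rule tr_even_power_nonneg[OF tp_splitsum])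

lemma splittrace_measurable [measurable]: "splittrace n S m \<in> borel_measurable (gauss I)"
proof -
  have h: "(\<lambda>G. halfmat n S G j \<alpha> \<beta>) \<in> borel_measurable (gauss I)" for j \<alpha> \<beta>
    unfolding halfmat_def by measurable
  have "(\<lambda>G. entry (splitsum n S G) \<alpha> \<beta>) \<in> borel_measurable (gauss I)" for \<alpha> \<beta>
    unfolding splitsum_def entry_sum entry_splitmat using h
    by (intro borel_measurable_sum borel_measurable_divide borel_measurable_add) auto
  then have "(\<lambda>G. tr (actl (splitsum n S G) (2 * m + 1) (splitsum n S G))) \<in> borel_measurable (gauss I)"
    by (rule tr_power_measurable[OF finite_sqidx idx_splitsum])
  then show ?thesis by (simp add: splittrace_def[abs_def])
qed

text \<open>Each flip of entries in the rows in \<open>S\<close> preserves the integral, so it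
  suffices to bound the sum over all flips pointwise. If no flip of \<open>G\<close> is good, this
  sum vanishes. If one is, \<open>good_tensor_bounds\<close> provides the Khintchine hypotheses for
  \<open>G\<close> itself, and the sum is bounded with the indicator dropped. The constant 8192 is
  64 times 128.\<close>

lemma splittrace_moment:
  "(\<integral>\<^sup>+G. (if good_tensor n G then ennreal (splittrace n S m G) else 0) \<partial>gauss (cube n))
    \<le> ennreal ((4 * real (m + 1) * (8192 * real n ^ 3)) ^ (m + 1) * (real n)\<^sup>2)"
proof -
  let ?M = "gauss (cube n)"
  interpret prob_space ?M by (rule prob_space_gauss)
  define \<Phi> where "\<Phi> G = (if good_tensor n G then ennreal (splittrace n S m G) else 0)" for G
  define \<kappa> where "\<kappa> = (4 * real (m + 1) * (8192 * real n ^ 3)) ^ (m + 1) * (real n)\<^sup>2"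
  define J where "J = splitidx n S"
  have [measurable]: "\<Phi> \<in> borel_measurable ?M" unfolding \<Phi>_def by measurable
  have fin: "finite (cube n)" by simp
  have flip: "(\<integral>\<^sup>+G. \<Phi> (flipsign T G) \<partial>?M) = integral\<^sup>N ?M \<Phi>" if "T \<in> Pow J" for T
    unfolding flipsign_def using that splitidx_subset_cube[of n S]
    by (intro nn_integral_gauss_flip fin) (auto simp: J_def)
  have mflip: "(\<lambda>G. \<Phi> (flipsign T G)) \<in> borel_measurable ?M" if "T \<in> Pow J" for T
  proof -
    have "flipsign T \<in> ?M \<rightarrow>\<^sub>M ?M"
      unfolding flipsign_def using that splitidx_subset_cube[of n S]
      by (intro measurable_gauss_flip) (auto simp: J_def)
    then show ?thesis by measurable
  qed
  have pt: "(\<Sum>T\<in>Pow J. \<Phi> (flipsign T G)) \<le> ennreal (2 ^ card J * \<kappa>)" for G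
  proof (cases "\<exists>T\<in>Pow J. good_tensor n (flipsign T G)")
    case False
    then have "(\<Sum>T\<in>Pow J. \<Phi> (flipsign T G)) = 0" by (intro sum.neutral) (auto simp: \<Phi>_def)
    then show ?thesis by simp
  next
    case True
    then obtain T where T: "T \<subseteq> J" "good_tensor n (flipsign T G)" by blast
    have sq: "(G j)\<^sup>2 = (flipsign T G j)\<^sup>2" for j by (simp add: flipsign_def)
    have off: "G (i, c, d) = flipsign T G (i, c, d)" if "c \<notin> S" for i c d
      using T(1) that by (auto simp: flipsign_def J_def splitidx_def)
    note b = good_tensor_bounds[OF T(2) sq off]
    have "(\<Sum>T\<in>Pow J. \<Phi> (flipsign T G)) \<le> (\<Sum>T\<in>Pow J. ennreal (splittrace n S m (flipsign T G)))"
      by (intro sum_mono) (simp add: \<Phi>_def)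
    also have "\<dots> = ennreal (\<Sum>T\<in>Pow J. splittrace n S m (flipsign T G))"
      by (simp add: splittrace_nonneg)
    also have "\<dots> \<le> ennreal (2 ^ card J * \<kappa>)"
    proof (rule ennreal_leI)
      have "(\<Sum>T\<in>Pow J. splittrace n S m (flipsign T G))
          \<le> (4 * real (m + 1) * ((64 * real n) * (128 * (real n)\<^sup>2))) ^ (m + 1) * (real n)\<^sup>2 * 2 ^ card J"
        unfolding splittrace_def J_def by (rule splitsum_flip_moment[OF b]) simp_all
      also have "(64 * real n) * (128 * (real n)\<^sup>2) = 8192 * real n ^ 3"
        by (simp add: power2_eq_square power3_eq_cube)
      finally show "(\<Sum>T\<in>Pow J. splittrace n S m (flipsign T G)) \<le> 2 ^ card J * \<kappa>"
        by (simp add: \<kappa>_def mult_ac)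
    qed
    finally show ?thesis .
  qed
  have "ennreal (2 ^ card J) * integral\<^sup>N ?M \<Phi> = (\<Sum>T\<in>Pow J. \<integral>\<^sup>+G. \<Phi> (flipsign T G) \<partial>?M)"
    using flip by (simp add: J_def card_Pow ennreal_two_power)
  also have "\<dots> = (\<integral>\<^sup>+G. (\<Sum>T\<in>Pow J. \<Phi> (flipsign T G)) \<partial>?M)"
    by (rule nn_integral_sum[symmetric]) (rule mflip)
  also have "\<dots> \<le> (\<integral>\<^sup>+G. ennreal (2 ^ card J * \<kappa>) \<partial>?M)"
    by (intro nn_integral_mono pt)
  also have "\<dots> = ennreal (2 ^ card J) * ennreal \<kappa>"
    by (simp add: emeasure_space_1 ennreal_mult \<kappa>_def)
  finally have "integral\<^sup>N ?M \<Phi> \<le> ennreal \<kappa>"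
    by (subst (asm) ennreal_mult_le_mult_iff) auto
  then show ?thesis by (simp only: \<Phi>_def[abs_def] \<kappa>_def)
qed

text \<open>Markov's inequality for the traces summed over \<open>S\<close>. The factor
  \<open>exp 12\<close> in \<open>s\<close> gives \<open>exp 12 ^ p \<ge> n ^ 12\<close>, which pays
  for the dimension \<open>n ^ 2\<close> and for the failure probability \<open>1 / n ^ 10\<close>.
  The 7 is 6 from the union bound for good tensors plus 1 from Markov.\<close>

lemma tensor_event:
  assumes n: "n \<ge> 1" and p: "real p \<ge> ln (real n)" "p \<ge> 1"
  defines "s \<equiv> sqrt (exp 12 * (4 * real p * (8192 * real n ^ 3)))"
  shows "\<exists>E\<in>sets (gauss (cube n)). measure (gauss (cube n)) E \<ge> 1 - 7 * real n powr (-10) \<and>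
    (\<forall>G\<in>E. good_tensor n G \<and> (\<Sum>S\<in>Pow {..<n}. splittrace n S (p - 1) G) \<le> 2 ^ n * s ^ (2 * p))"
proof -
  let ?M = "gauss (cube n)"
  interpret prob_space ?M by (rule prob_space_gauss)
  define v where "v = 4 * real p * (8192 * real n ^ 3)"
  have v: "v > 0" using n p by (simp add: v_def)
  have s2p: "s ^ (2 * p) = exp 12 ^ p * v ^ p"
    using v by (simp add: s_def v_def[symmetric] power_mult power_mult_distrib)
  have sp: "s ^ (2 * p) > 0" using v by (simp add: s2p)
  define Y where "Y G = (\<Sum>S\<in>Pow {..<n}. splittrace n S (p - 1) G)" for G
  have Y0: "Y G \<ge> 0" for G unfolding Y_def by (intro sum_nonneg splittrace_nonneg)
  have [measurable]: "Y \<in> borel_measurable ?M" unfolding Y_def by measurable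
  define E where "E = {G \<in> space ?M. good_tensor n G \<and> Y G \<le> 2 ^ n * s ^ (2 * p)}"
  define B where "B = {G \<in> space ?M. good_tensor n G \<and> 2 ^ n * s ^ (2 * p) < Y G}"
  have [measurable]: "E \<in> sets ?M" "B \<in> sets ?M" unfolding E_def B_def by measurable
  define x where "x = real n powr (-10)"
  have x: "x = 1 / real n ^ 10" using n by (simp add: x_def powr_minus powr_realpow divide_inverse)
  have n10: "real n ^ 10 > 0" using n by simp
  have n12: "real n ^ 12 = (real n)\<^sup>2 * real n ^ 10" by (simp add: power_add[symmetric])
  have good: "emeasure ?M {G \<in> space ?M. \<not> good_tensor n G} \<le> ennreal (6 * x)"
  proof -
    have "real n \<le> exp (real n)" using exp_ge_add_one_self[of "real n"] by linarith
    then have "real n ^ 12 \<le> exp (real n) ^ 12" by (intro power_mono) auto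
    also have "\<dots> = exp (12 * real n)" by (simp add: exp_of_nat_mult[symmetric])
    also have "\<dots> \<le> exp (15 * real n)" by simp
    finally have "real n ^ 12 * exp (- 15 * real n) \<le> 1"
      by (simp add: exp_minus divide_simps mult.commute)
    moreover have "(real n)\<^sup>2 * exp (- 15 * real n) * real n ^ 10 = real n ^ 12 * exp (- 15 * real n)"
      unfolding n12 by (simp only: mult_ac)
    ultimately have "(real n)\<^sup>2 * exp (- 15 * real n) \<le> x"
      unfolding x pos_le_divide_eq[OF n10] by (simp only:)
    then have "ennreal (6 * (real n)\<^sup>2 * exp (- 15 * real n)) \<le> ennreal (6 * x)"
      by (intro ennreal_leI) simp
    with not_good_tensor_tail show ?thesis by (rule order_trans)
  qed
  have large: "emeasure ?M B \<le> ennreal x"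
  proof -
    define t where "t = 2 ^ n * s ^ (2 * p)"
    have t: "t > 0" using sp by (simp add: t_def)
    have "ennreal t * emeasure ?M B = (\<integral>\<^sup>+G. ennreal t * indicator B G \<partial>?M)"
      by (simp add: nn_integral_cmult_indicator)
    also have "\<dots> \<le> (\<integral>\<^sup>+G. (\<Sum>S\<in>Pow {..<n}. if good_tensor n G then ennreal (splittrace n S (p - 1) G) else 0) \<partial>?M)"
    proof (rule nn_integral_mono)
      fix G
      show "ennreal t * indicator B G \<le> (\<Sum>S\<in>Pow {..<n}. if good_tensor n G then ennreal (splittrace n S (p - 1) G) else 0)"
      proof (cases "G \<in> B")
        case True
        then have g: "good_tensor n G" "t \<le> Y G" by (auto simp: B_def t_def)
        have e: "ennreal (Y G) = (\<Sum>S\<in>Pow {..<n}. ennreal (splittrace n S (p - 1) G))"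
          unfolding Y_def by (simp add: splittrace_nonneg)
        have "ennreal t \<le> (\<Sum>S\<in>Pow {..<n}. ennreal (splittrace n S (p - 1) G))"
          unfolding e[symmetric] using g(2) by (rule ennreal_leI)
        then show ?thesis using True g(1) by simp
      qed simp
    qed
    also have "\<dots> = (\<Sum>S\<in>Pow {..<n}. \<integral>\<^sup>+G. (if good_tensor n G then ennreal (splittrace n S (p - 1) G) else 0) \<partial>?M)"
      by (rule nn_integral_sum) measurable
    also have "\<dots> \<le> (\<Sum>S\<in>Pow {..<n}. ennreal (v ^ p * (real n)\<^sup>2))"
      using splittrace_moment[of n _ "p - 1"] p by (intro sum_mono) (simp add: v_def)
    also have "\<dots> = ennreal (2 ^ n) * ennreal (v ^ p * (real n)\<^sup>2)"
      by (simp add: card_Pow ennreal_two_power)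
    also have "\<dots> \<le> ennreal t * ennreal x"
    proof -
      have "real n ^ 12 \<le> exp 12 ^ p"
      proof -
        have "real n = exp (ln (real n))" using n by simp
        also have "\<dots> \<le> exp (real p)" using p by simp
        finally have "real n ^ 12 \<le> exp (real p) ^ 12" by (intro power_mono) auto
        also have "\<dots> = exp 12 ^ p" by (simp add: exp_of_nat_mult[symmetric] mult.commute)
        finally show ?thesis .
      qed
      then have "(real n)\<^sup>2 \<le> exp 12 ^ p / real n ^ 10"
        unfolding n12 pos_le_divide_eq[OF n10] .
      then have "(real n)\<^sup>2 \<le> exp 12 ^ p * x" by (simp add: x)
      then have "2 ^ n * (v ^ p * (real n)\<^sup>2) \<le> 2 ^ n * (v ^ p * (exp 12 ^ p * x))"
        using v by (intro mult_left_mono) auto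
      also have "\<dots> = t * x" by (simp add: t_def s2p)
      finally have "ennreal (2 ^ n * (v ^ p * (real n)\<^sup>2)) \<le> ennreal (t * x)"
        by (rule ennreal_leI)
      moreover have "ennreal (2 ^ n) * ennreal (v ^ p * (real n)\<^sup>2) = ennreal (2 ^ n * (v ^ p * (real n)\<^sup>2))"
        using v by (intro ennreal_mult[symmetric]) auto
      moreover have "ennreal t * ennreal x = ennreal (t * x)"
        using t by (intro ennreal_mult[symmetric]) (auto simp: x)
      ultimately show ?thesis by (simp only:)
    qed
    finally show ?thesis using t by (subst (asm) ennreal_mult_le_mult_iff) auto
  qed
  have "emeasure ?M (space ?M - E) \<le> emeasure ?M ({G \<in> space ?M. \<not> good_tensor n G} \<union> B)"
    by (rule emeasure_mono) (auto simp: E_def B_def)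
  also have "\<dots> \<le> emeasure ?M {G \<in> space ?M. \<not> good_tensor n G} + emeasure ?M B"
    by (rule emeasure_subadditive) measurable
  also have "\<dots> \<le> ennreal (6 * x) + ennreal x" by (rule add_mono[OF good large])
  also have "\<dots> = ennreal (7 * x)" by (simp add: x ennreal_plus[symmetric] del: ennreal_plus)
  finally have "measure ?M (space ?M - E) \<le> 7 * x"
    by (simp add: emeasure_eq_measure x)
  then have "measure ?M E \<ge> 1 - 7 * x" by (simp add: prob_compl)
  then show ?thesis
    by (intro bexI[of _ E]) (auto simp: E_def x_def Y_def)
qed

section \<open>Correlation of the maximizer\<close>

lemma pe_linform_point: "pe (\<lambda>m. \<Prod>i\<in>#m. v i) (linform n v * linform n v * linform n v) = (\<Sum>i<n. (v i)\<^sup>2) ^ 3"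
  unfolding pe_linform_cube power3_eq_cube power2_eq_square sum_product sum_distrib_left sum_distrib_right
  by (intro sum.cong refl) simp

text \<open>The noise enters twice, at the maximizer and at the point evaluation, and
  \<open>pe_cube_linform\<close> costs a factor 4/3; together 8/3.\<close>

lemma maximizer_linform_ge:
  assumes v: "vnorm n v = 1" and \<tau>: "\<tau> > 0"
    and noise: "\<And>L. sphere_pe4 n L \<Longrightarrow> \<bar>pe_tensor n L (\<lambda>i j k. G (i, j, k))\<bar> \<le> \<beta>"
    and S: "S \<in> {spiked \<tau> v G, spiked_sym \<tau> v G}"
    and L: "sphere_pe4 n L" and max: "\<And>L'. sphere_pe4 n L' \<Longrightarrow> pe_tensor n L' S \<le> pe_tensor n L S"
  shows "1 - 8 / 3 * (\<beta> / \<tau>) \<le> pe L (linform n v)"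
proof -
  let ?P = "\<lambda>m. \<Prod>i\<in>#m. v i" and ?t3 = "linform n v * linform n v * linform n v"
  have val: "pe_tensor n L' S = \<tau> * pe L' ?t3 + pe_tensor n L' (\<lambda>i j k. G (i, j, k))" for L'
    using S by (auto simp: pe_tensor_spiked_sym pe_tensor_spiked)
  have P: "sphere_pe4 n ?P" by (rule sphere_pe4_point[OF v])
  have "(\<Sum>i<n. (v i)\<^sup>2) = 1" using v by (simp add: vnorm_def)
  then have "pe ?P ?t3 = 1" by (simp add: pe_linform_point)
  then have "\<tau> * 1 - \<beta> \<le> \<tau> * pe L ?t3 + \<beta>"
    using max[OF P] noise[OF P] noise[OF L] unfolding val by (simp add: abs_le_iff)
  then have "\<tau> * (1 - pe L ?t3) \<le> 2 * \<beta>" by (simp add: algebra_simps)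
  then have "1 - pe L ?t3 \<le> 2 * (\<beta> / \<tau>)" using \<tau> by (simp add: field_simps)
  with pe_cube_linform[OF L v] show ?thesis by simp
qed

text \<open>The mean vector has norm at most one, so normalizing can only increase a nonnegative
  correlation. The bound -1 is the fallback when nonnegativity is not known. For a zero mean vector
  the quotient is 0 by convention, consistent with both claims.\<close>

lemma normalized_correlation:
  assumes L: "sphere_pe4 n L" and v: "vnorm n v = 1"
  defines "w \<equiv> \<lambda>i. pe_vec L i / vnorm n (pe_vec L)"
  shows "- 1 \<le> vinner n w v" and "0 \<le> pe L (linform n v) \<Longrightarrow> pe L (linform n v) \<le> vinner n w v"
proof -
  define N where "N = vnorm n (pe_vec L)"
  define c where "c = vinner n (pe_vec L) v"
  have N: "0 \<le> N" "N \<le> 1"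
    using pe_vec_norm_le[OF L] by (auto simp: N_def vnorm_def sum_nonneg)
  have w: "vinner n w v = c / N"
    by (simp add: vinner_def w_def c_def N_def sum_divide_distrib)
  have "c\<^sup>2 \<le> (\<Sum>i<n. (pe_vec L i)\<^sup>2) * (\<Sum>i<n. (v i)\<^sup>2)"
    unfolding c_def vinner_def by (rule Cauchy_Schwarz_ineq_sum)
  also have "(\<Sum>i<n. (v i)\<^sup>2) = 1" using v by (simp add: vnorm_def)
  also have "(\<Sum>i<n. (pe_vec L i)\<^sup>2) = N\<^sup>2" by (simp add: N_def vnorm_def sum_nonneg)
  finally have c: "\<bar>c\<bar> \<le> N" using N(1) by (simp add: abs_le_square_iff[symmetric])
  show "- 1 \<le> vinner n w v"
  proof (cases "N = 0")
    case False
    with N c show ?thesis by (simp add: w field_simps)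
  qed (simp add: w)
  assume "0 \<le> pe L (linform n v)"
  then have c0: "0 \<le> c" by (simp add: c_def pe_linform)
  have "c \<le> c / N"
  proof (cases "N = 0")
    case True
    with c c0 show ?thesis by simp
  next
    case False
    have "c * N \<le> c * 1" using N c0 by (intro mult_left_mono)
    with False N show ?thesis by (simp add: pos_le_divide_eq)
  qed
  then show "pe L (linform n v) \<le> vinner n w v" by (simp add: w c_def pe_linform)
qed

text \<open>Supplies the exponent, which has to be a power of two for
  \<open>pairing_power_le_tr\<close> and within a factor 2 of \<open>ln n\<close>. The lower bound
  on \<open>x\<close> serves the case \<open>k = 0\<close>.\<close>

lemma dyadic_approximation:
  fixes x :: real
  assumes "x \<ge> 1 / 2"
  shows "\<exists>k :: nat. x \<le> 2 ^ k \<and> 2 ^ k \<le> 2 * x"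
proof -
  have ex: "\<exists>k :: nat. x \<le> 2 ^ k"
    using real_arch_pow[of 2 x] by (auto intro: less_imp_le)
  define k where "k = (LEAST k. x \<le> 2 ^ k)"
  have k: "x \<le> 2 ^ k" unfolding k_def by (rule LeastI_ex[OF ex])
  moreover have "2 ^ k \<le> 2 * x"
  proof (cases k)
    case 0
    then show ?thesis using assms by simp
  next
    case (Suc l)
    then have "\<not> x \<le> 2 ^ l" using not_less_Least[of l "\<lambda>k. x \<le> 2 ^ k"] by (simp add: k_def)
    with Suc show ?thesis by simp
  qed
  ultimately show ?thesis by blast
qed

text \<open>Squared, it is the factor of \<open>y = n * sqrt n * sqrt (ln n)\<close> in the bound
  for \<open>128 * n * sqrt n + 8 * s\<close>: the first term is at most \<open>256 * y\<close>
  since \<open>sqrt (ln n) \<ge> 1 / 2\<close>, and \<open>s \<le> 256 * exp 6 * y\<close>, with 8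
  times 256 equal to 2048.\<close>

definition noise_const :: real where
  "noise_const = sqrt (256 + 2048 * exp 6)"

lemma gauss_noise_event:
  assumes n: "n \<ge> 2"
  shows "\<exists>E\<in>sets (gauss (cube n)). measure (gauss (cube n)) E \<ge> 1 - 7 * real n powr (-10) \<and>
    (\<forall>G\<in>E. \<forall>L. sphere_pe4 n L \<longrightarrow>
      \<bar>pe_tensor n L (\<lambda>i j k. G (i, j, k))\<bar> \<le> noise_const * (real n powr (3/4) * ln (real n) powr (1/4)))"
proof -
  define l where "l = ln (real n)"
  have "1 / 2 \<le> ln (2 :: real)" by (rule order_trans[OF _ ln2_ge_two_thirds]) simp
  also have "\<dots> \<le> l" unfolding l_def using n by simp
  finally have l: "1 / 2 \<le> l" .
  then obtain k :: nat where k: "l \<le> 2 ^ k" "2 ^ k \<le> 2 * l" using dyadic_approximation by blast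
  define p :: nat where "p = 2 ^ k"
  have p: "real p \<ge> ln (real n)" "p \<ge> 1" "real p \<le> 2 * l"
    using k by (auto simp: p_def l_def)
  define s where "s = sqrt (exp 12 * (4 * real p * (8192 * real n ^ 3)))"
  have s: "s > 0" using p n by (simp add: s_def)
  define y where "y = real n * sqrt (real n) * sqrt l"
  have y: "y > 0" using n l by (simp add: y_def)
  \<comment> \<open>256 is the square root of 4 times 2 times 8192; the 2 is the dyadic loss in
    \<open>p \<le> 2 * l\<close>.\<close>
  have sy: "s \<le> 256 * exp 6 * y"
    unfolding s_def
  proof (rule real_le_lsqrt)
    have "exp 12 * (4 * real p * (8192 * real n ^ 3)) \<le> exp 12 * (4 * (2 * l) * (8192 * real n ^ 3))"
      using p by (intro mult_left_mono mult_right_mono) auto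
    also have "\<dots> = (256 * exp 6 * y)\<^sup>2"
    proof -
      have "(exp 6 :: real)\<^sup>2 = exp 12" by (simp add: exp_of_nat_mult[symmetric] power2_eq_square exp_add[symmetric])
      moreover have "y\<^sup>2 = real n ^ 3 * l"
      proof -
        have "y\<^sup>2 = (real n)\<^sup>2 * (sqrt (real n))\<^sup>2 * (sqrt l)\<^sup>2" by (simp only: y_def power_mult_distrib)
        also have "\<dots> = (real n)\<^sup>2 * real n * l" using l by simp
        finally show ?thesis by (simp add: power2_eq_square power3_eq_cube)
      qed
      ultimately show ?thesis by (simp add: power_mult_distrib)
    qed
    finally show "exp 12 * (4 * real p * (8192 * real n ^ 3)) \<le> (256 * exp 6 * y)\<^sup>2" .
  qed (use y in auto)
  have ny: "128 * (real n * sqrt (real n)) \<le> 256 * y"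
  proof -
    have "sqrt ((1 / 2)\<^sup>2) \<le> sqrt l" using l by (intro real_sqrt_le_mono) (simp add: power2_eq_square)
    then have "real n * sqrt (real n) * (1 / 2) \<le> y"
      unfolding y_def by (intro mult_left_mono) auto
    then show ?thesis by simp
  qed
  define \<beta> where "\<beta> = noise_const * (real n powr (3/4) * l powr (1/4))"
  have "noise_const > 0" by (simp add: noise_const_def add_pos_pos)
  then have \<beta>: "\<beta> > 0" using n l by (simp add: \<beta>_def)
  have \<beta>2: "\<beta>\<^sup>2 = (256 + 2048 * exp 6) * y"
  proof -
    have "(real n powr (3/4))\<^sup>2 = real n powr (3/2)"
      by (simp add: power2_eq_square powr_add[symmetric])
    also have "\<dots> = real n powr 1 * real n powr (1/2)" by (simp only: powr_add[symmetric]) simp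
    also have "\<dots> = real n * sqrt (real n)" using n by (simp add: powr_half_sqrt)
    finally have "(real n powr (3/4))\<^sup>2 = real n * sqrt (real n)" .
    moreover have "(l powr (1/4))\<^sup>2 = sqrt l"
      using l by (simp add: power2_eq_square powr_add[symmetric] powr_half_sqrt)
    moreover have "noise_const\<^sup>2 = 256 + 2048 * exp 6"
      unfolding noise_const_def by (rule real_sqrt_pow2) (simp add: add_nonneg_nonneg)
    ultimately show ?thesis by (simp add: \<beta>_def y_def power_mult_distrib)
  qed
  have "n \<ge> 1" using n by simp
  from tensor_event[OF this p(1,2), folded s_def] obtain E where
    E: "E \<in> sets (gauss (cube n))" "measure (gauss (cube n)) E \<ge> 1 - 7 * real n powr (-10)"
    and good: "\<And>G. G \<in> E \<Longrightarrow> good_tensor n G"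
    and trace: "\<And>G. G \<in> E \<Longrightarrow> (\<Sum>S\<in>Pow {..<n}. splittrace n S (p - 1) G) \<le> 2 ^ n * s ^ (2 * p)"
    by blast
  have "\<bar>pe_tensor n L (\<lambda>i j k. G (i, j, k))\<bar> \<le> \<beta>" if G: "G \<in> E" and L: "sphere_pe4 n L" for G L
  proof (rule pe_tensor_abs_le[OF L \<beta>])
    have e: "2 * p = 2 ^ Suc k" by (simp add: p_def)
    have e': "2 * (p - 1) + 1 = 2 ^ Suc k - 1"
      using p(2) unfolding e[symmetric] by linarith
    have "(\<Sum>i<n. \<Sum>a<n. \<Sum>b<n. \<Sum>c<n. \<Sum>d<n. G (i, a, b) * G (i, c, d) * L {#a, b, c, d#})
        \<le> 128 * (real n * sqrt (real n)) + 8 * s"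
      using trace[OF G] unfolding splittrace_def e e'
      by (rule moment_of_quadratic_slices_le[OF L good[OF G] s])
    also have "\<dots> \<le> \<beta>\<^sup>2" unfolding \<beta>2 using sy ny by (simp add: algebra_simps)
    finally show "(\<Sum>i<n. \<Sum>a<n. \<Sum>b<n. \<Sum>c<n. \<Sum>d<n. G (i, a, b) * G (i, c, d) * L {#a, b, c, d#}) \<le> \<beta>\<^sup>2" .
  qed
  with E show ?thesis unfolding \<beta>_def l_def by blast
qed

theorem mainTheorem4:
  shows "\<exists>C K1 K2 :: real. \<forall>(n::nat) (v0::nat \<Rightarrow> real) (\<epsilon>::real) (\<tau>::real).
    n \<ge> 1 \<and> vnorm n v0 = 1 \<and> \<epsilon> > 0 \<and>
    \<tau> \<ge> C * real n powr (3/4) * ln (real n) powr (1/4) / \<epsilon> \<longrightarrow>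
    (\<exists>E \<in> sets (gauss_tensor n).
       measure (gauss_tensor n) E \<ge> 1 - K1 * real n powr (-10) \<and>
       (\<forall>G \<in> E. \<forall>S \<in> {spiked \<tau> v0 G, spiked_sym \<tau> v0 G}.
          \<forall>L. sphere_pe4 n L \<and> (\<forall>L'. sphere_pe4 n L' \<longrightarrow> pe_tensor n L' S \<le> pe_tensor n L S) \<longrightarrow>
             vinner n (\<lambda>i. pe_vec L i / vnorm n (pe_vec L)) v0 \<ge> 1 - K2 * \<epsilon>))"
proof (rule exI[of _ 1], rule exI[of _ 7], rule exI[of _ "6 * noise_const"], intro allI impI, elim conjE)
  \<comment> \<open>\<open>C = 1\<close> is possible because the noise constant is absorbed into
    \<open>K2\<close>. The factor 6 in \<open>K2\<close> covers 8/3 and also the degenerate case: if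
    \<open>8 / 3 * (noise_const * \<epsilon>) > 1\<close>, then
    \<open>6 * noise_const * \<epsilon> > 2\<close>, and the correlation bound -1 suffices.\<close>
  fix n :: nat and v0 :: "nat \<Rightarrow> real" and \<epsilon> \<tau> :: real
  assume n: "n \<ge> 1" and v: "vnorm n v0 = 1" and \<epsilon>: "\<epsilon> > 0"
    and \<tau>: "\<tau> \<ge> 1 * real n powr (3/4) * ln (real n) powr (1/4) / \<epsilon>"
  have gt: "gauss_tensor n = gauss (cube n)" by (simp add: gauss_tensor_def)
  show "\<exists>E \<in> sets (gauss_tensor n).
       measure (gauss_tensor n) E \<ge> 1 - 7 * real n powr (-10) \<and>
       (\<forall>G \<in> E. \<forall>S \<in> {spiked \<tau> v0 G, spiked_sym \<tau> v0 G}.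
          \<forall>L. sphere_pe4 n L \<and> (\<forall>L'. sphere_pe4 n L' \<longrightarrow> pe_tensor n L' S \<le> pe_tensor n L S) \<longrightarrow>
             vinner n (\<lambda>i. pe_vec L i / vnorm n (pe_vec L)) v0 \<ge> 1 - 6 * noise_const * \<epsilon>)"
  proof (cases "n = 1")
    case True
    \<comment> \<open>Since \<open>ln 1 = 0\<close>, the hypothesis permits
      \<open>\<tau> = 0\<close> here; but the required probability is \<open>1 - 7\<close>, so the
      empty event qualifies.\<close>
    then show ?thesis by (intro bexI[of _ "{}"]) auto
  next
    case False
    with n have n2: "n \<ge> 2" by simp
    define q where "q = real n powr (3/4) * ln (real n) powr (1/4)"
    have q: "q > 0" using n2 by (simp add: q_def)
    have \<tau>q: "q \<le> \<tau> * \<epsilon>" using \<tau> \<epsilon> by (simp add: q_def pos_divide_le_eq)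
    have \<tau>0: "\<tau> > 0" using q \<tau>q \<epsilon> by (smt (verit) mult_nonpos_nonneg)
    have nc: "noise_const > 0" by (simp add: noise_const_def add_pos_pos)
    obtain E where E: "E \<in> sets (gauss (cube n))" "measure (gauss (cube n)) E \<ge> 1 - 7 * real n powr (-10)"
      and noise: "\<And>G L. G \<in> E \<Longrightarrow> sphere_pe4 n L \<Longrightarrow> \<bar>pe_tensor n L (\<lambda>i j k. G (i, j, k))\<bar> \<le> noise_const * q"
      using gauss_noise_event[OF n2] unfolding q_def by blast
    have "1 - 6 * noise_const * \<epsilon> \<le> vinner n (\<lambda>i. pe_vec L i / vnorm n (pe_vec L)) v0"
      if G: "G \<in> E" and S: "S \<in> {spiked \<tau> v0 G, spiked_sym \<tau> v0 G}" and L: "sphere_pe4 n L"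
        and max: "\<And>L'. sphere_pe4 n L' \<Longrightarrow> pe_tensor n L' S \<le> pe_tensor n L S" for G S L
    proof -
      have "noise_const * q / \<tau> \<le> noise_const * \<epsilon>"
        using \<tau>q \<tau>0 nc by (simp add: pos_divide_le_eq mult_ac)
      with maximizer_linform_ge[OF v \<tau>0 noise[OF G] S L max]
      have t: "1 - 8 / 3 * (noise_const * \<epsilon>) \<le> pe L (linform n v0)" by linarith
      note corr = normalized_correlation[OF L v]
      have nonneg: "0 \<le> noise_const * \<epsilon>" using nc \<epsilon> by simp
      show ?thesis
      proof (cases "8 / 3 * (noise_const * \<epsilon>) \<le> 1")
        case True
        with t have "0 \<le> pe L (linform n v0)" by linarith
        from corr(2)[OF this] t nonneg show ?thesis by linarith
      next
        case False
        with corr(1) show ?thesis by linarith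
      qed
    qed
    with E show ?thesis unfolding gt by blast
  qed
qed

end
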